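(* Suppose (A1)–(A3) hold and the thresholds $A,B$ of the MiLRT and of the WGLRT are selected so that both tests belong to $\mathcal C(\alpha,\beta)$. Then, as $\alpha,\beta\to0$: (a) for every $1\le i\le K$, $$\mathsf E_i[M]=\inf_{\delta\in\mathcal C(\alpha,\beta)}\mathsf E_i[T]+O(1),\qquad \mathsf E_i[N]=\inf_{\delta\in\mathcal C(\alpha,\beta)}\mathsf E_i[T]+O(1);$$ (b) if $r=1$, $$\mathsf E_0[M]=\inf_{\delta\in\mathcal C(\alpha,\beta)}\mathsf E_0[T]+O(1),\qquad \mathsf E_0[N]=\inf_{\delta\in\mathcal C(\alpha,\beta)}\mathsf E_0[T]+O(1),$$ whereas if $r>1$, $$\mathsf E_0[M]=\inf_{\delta\in\mathcal C(\alpha,\beta)}\mathsf E_0[T]\,(1+o(1)),\qquad \mathsf E_0[N]=\inf_{\delta\in\mathcal C(\alpha,\beta)}\mathsf E_0[T]\,(1+o(1)).$$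
   Context: Setup: $X_1,X_2,\dots$ are i.i.d. random vectors in $\mathbb R^d$ with common density $f$ with respect to a non-degenerate $\sigma$-finite measure $\nu$; $\mathcal F_t=\sigma(X_1,\dots,X_t)$. Let $f_0,f_1,\dots,f_K$ ($K\ge 1$) be densities with common support; $\mathsf P_j,\mathsf E_j$ denote probability and expectation when $f=f_j$, $j=0,1,\dots,K$. One tests $H_0:f=f_0$ versus $H_1:f\in\{f_1,\dots,f_K\}$. For $1\le i\le K$ let $\Lambda^i_t=\prod_{n=1}^t f_i(X_n)/f_0(X_n)$ and $Z^i_t=\log\Lambda^i_t$. Standing assumptions: for each $i$, $f_i\neq f_0$ on a set of positive $\nu$-measure; $Z^i_1$ is non-arithmetic under $\mathsf P_0$ and under $\mathsf P_i$; $I_i:=\mathsf E_i[Z^i_1]<\infty$ and $I^i_0:=\mathsf E_0[-Z^i_1]<\infty$ (both are then positive). The densities are ordered so that $I_0:=\min_{1\le i\le K}I^i_0=I^1_0=\dots=I^r_0<I^{r+1}_0\le\dots\le I^K_0$ for some integer $1\le r\le K$. Sequential tests: a sequential test $\delta=(T,d_T)$ consists of an $\{\mathcal F_t\}$-stopping time $T$ and an $\mathcal F_T$-measurable decision $d_T\in\{0,1\}$ ($d_T=j$ means accept $H_j$, on $\{T<\infty\}$). For $\alpha,\beta\in(0,1)$, $\mathcal C(\alpha,\beta)=\{\delta:\mathsf P_0(d_T=1)\le\alpha\text{ and }\max_{1\le i\le K}\mathsf P_i(d_T=0)\le\beta\}$. Tests: a weight is a vector $\mathbf q=(q^1,\dots,q^K)$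 with all $q^i>0$; $\Lambda_t(\mathbf q)=\sum_{i=1}^K q^i\Lambda^i_t$, $\hat\Lambda_t(\mathbf q)=\max_{1\le i\le K}q^i\Lambda^i_t$. Given two fixed weights $\mathbf q_0,\mathbf q_1$ and thresholds $A,B>1$, the MiLRT is $M=\inf\{t:\Lambda_t(\mathbf q_1)\ge B\text{ or }\Lambda_t(\mathbf q_0)\le A^{-1}\}$, $d_M=\mathbf 1\{\Lambda_M(\mathbf q_1)\ge B\}$, and the WGLRT is $N=\inf\{t:\hat\Lambda_t(\mathbf q_1)\ge B\text{ or }\hat\Lambda_t(\mathbf q_0)\le A^{-1}\}$, $d_N=\mathbf 1\{\hat\Lambda_N(\mathbf q_1)\ge B\}$. Conditions: (A1) $\mathsf E_i[(Z^i_1)^2]<\infty$ and $\mathsf E_0[(Z^i_1)^2]<\infty$ for all $1\le i\le K$. (A2) $\alpha,\beta\to0$ so that $|\log\alpha|/|\log\beta|\to k\in(0,\infty)$. (A3) for the test $T\in\{M,N\}$ under consideration, the thresholds $A,B$ (functions of $\alpha,\beta$) are chosen so that, as $\alpha,\beta\to0$, $k_0\alpha(1+o(1))\le\mathsf P_0(d_T=1)\le\alpha(1+o(1))$ and $k_1\beta(1+o(1))\le\max_{1\le i\le K}\mathsf P_i(d_T=0)\le\beta(1+o(1))$, with fixed constants $k_0,k_1\in(0,1]$. *)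

theory Defs
  imports "HOL-Probability.Probability"
begin

text \<open>Sample paths are omega :: nat => 'a, with X_{n+1} = omega n (0-based indexing).\<close>

definition obsF :: "nat \<Rightarrow> (nat \<Rightarrow> 'a::topological_space) measure" where
  "obsF t = vimage_algebra UNIV (\<lambda>\<omega>. restrict \<omega> {..<t}) (PiM {..<t} (\<lambda>_. borel))"

definition Pj :: "'a measure \<Rightarrow> (nat \<Rightarrow> 'a \<Rightarrow> real) \<Rightarrow> nat \<Rightarrow> (nat \<Rightarrow> 'a) measure" where
  "Pj \<nu> f j = PiM UNIV (\<lambda>_. density \<nu> (\<lambda>x. ennreal (f j x)))"

definition P1 :: "'a measure \<Rightarrow> (nat \<Rightarrow> 'a \<Rightarrow> real) \<Rightarrow> nat \<Rightarrow> 'a measure" where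
  "P1 \<nu> f j = density \<nu> (\<lambda>x. ennreal (f j x))"

definition llr :: "(nat \<Rightarrow> 'a \<Rightarrow> real) \<Rightarrow> nat \<Rightarrow> 'a \<Rightarrow> real" where
  "llr f i x = ln (f i x / f 0 x)"

definition LR :: "(nat \<Rightarrow> 'a \<Rightarrow> real) \<Rightarrow> nat \<Rightarrow> nat \<Rightarrow> (nat \<Rightarrow> 'a) \<Rightarrow> real" where
  "LR f i t \<omega> = (\<Prod>n<t. f i (\<omega> n) / f 0 (\<omega> n))"

definition mixLR :: "(nat \<Rightarrow> 'a \<Rightarrow> real) \<Rightarrow> nat \<Rightarrow> (nat \<Rightarrow> real) \<Rightarrow> nat \<Rightarrow> (nat \<Rightarrow> 'a) \<Rightarrow> real" where
  "mixLR f K q t \<omega> = (\<Sum>i=1..K. q i * LR f i t \<omega>)"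

definition maxLR :: "(nat \<Rightarrow> 'a \<Rightarrow> real) \<Rightarrow> nat \<Rightarrow> (nat \<Rightarrow> real) \<Rightarrow> nat \<Rightarrow> (nat \<Rightarrow> 'a) \<Rightarrow> real" where
  "maxLR f K q t \<omega> = Max ((\<lambda>i. q i * LR f i t \<omega>) ` {1..K})"

definition first_time :: "(nat \<Rightarrow> bool) \<Rightarrow> enat" where
  "first_time P = (if \<exists>t\<ge>1. P t then enat (LEAST t. t \<ge> 1 \<and> P t) else \<infinity>)"

definition MiLRT_time :: "(nat \<Rightarrow> 'a \<Rightarrow> real) \<Rightarrow> nat \<Rightarrow> (nat \<Rightarrow> real) \<Rightarrow> (nat \<Rightarrow> real) \<Rightarrow> real \<Rightarrow> real \<Rightarrow> (nat \<Rightarrow> 'a) \<Rightarrow> enat" where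
  "MiLRT_time f K q0 q1 A B \<omega> =
     first_time (\<lambda>t. mixLR f K q1 t \<omega> \<ge> B \<or> mixLR f K q0 t \<omega> \<le> 1 / A)"

definition MiLRT_dec :: "(nat \<Rightarrow> 'a \<Rightarrow> real) \<Rightarrow> nat \<Rightarrow> (nat \<Rightarrow> real) \<Rightarrow> (nat \<Rightarrow> real) \<Rightarrow> real \<Rightarrow> real \<Rightarrow> (nat \<Rightarrow> 'a) \<Rightarrow> bool" where
  "MiLRT_dec f K q0 q1 A B \<omega> = (mixLR f K q1 (the_enat (MiLRT_time f K q0 q1 A B \<omega>)) \<omega> \<ge> B)"

definition WGLRT_time :: "(nat \<Rightarrow> 'a \<Rightarrow> real) \<Rightarrow> nat \<Rightarrow> (nat \<Rightarrow> real) \<Rightarrow> (nat \<Rightarrow> real) \<Rightarrow> real \<Rightarrow> real \<Rightarrow> (nat \<Rightarrow> 'a) \<Rightarrow> enat" where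
  "WGLRT_time f K q0 q1 A B \<omega> =
     first_time (\<lambda>t. maxLR f K q1 t \<omega> \<ge> B \<or> maxLR f K q0 t \<omega> \<le> 1 / A)"

definition WGLRT_dec :: "(nat \<Rightarrow> 'a \<Rightarrow> real) \<Rightarrow> nat \<Rightarrow> (nat \<Rightarrow> real) \<Rightarrow> (nat \<Rightarrow> real) \<Rightarrow> real \<Rightarrow> real \<Rightarrow> (nat \<Rightarrow> 'a) \<Rightarrow> bool" where
  "WGLRT_dec f K q0 q1 A B \<omega> = (maxLR f K q1 (the_enat (WGLRT_time f K q0 q1 A B \<omega>)) \<omega> \<ge> B)"

text \<open>A sequential test (T, d_T): T a stopping time (possibly infinite) of the natural
  filtration, d an F_T-measurable decision (True = accept H_1).\<close>
definition is_seq_test :: "((nat \<Rightarrow> 'a::topological_space) \<Rightarrow> enat) \<Rightarrow> ((nat \<Rightarrow> 'a) \<Rightarrow> bool) \<Rightarrow> bool" where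
  "is_seq_test T d \<longleftrightarrow>
     (\<forall>t::nat. {\<omega>. T \<omega> = enat t} \<in> sets (obsF t)) \<and>
     (\<forall>t::nat. {\<omega>. T \<omega> = enat t \<and> d \<omega>} \<in> sets (obsF t))"

text \<open>P_j(d_T = 1) and P_j(d_T = 0), the decision being made on {T < infinity}.\<close>
definition prob_accept1 :: "(nat \<Rightarrow> 'a) measure \<Rightarrow> ((nat \<Rightarrow> 'a) \<Rightarrow> enat) \<Rightarrow> ((nat \<Rightarrow> 'a) \<Rightarrow> bool) \<Rightarrow> real" where
  "prob_accept1 P T d = measure P {\<omega>. T \<omega> \<noteq> \<infinity> \<and> d \<omega>}"

definition prob_accept0 :: "(nat \<Rightarrow> 'a) measure \<Rightarrow> ((nat \<Rightarrow> 'a) \<Rightarrow> enat) \<Rightarrow> ((nat \<Rightarrow> 'a) \<Rightarrow> bool) \<Rightarrow> real" where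
  "prob_accept0 P T d = measure P {\<omega>. T \<omega> \<noteq> \<infinity> \<and> \<not> d \<omega>}"

definition test_class :: "'a::topological_space measure \<Rightarrow> (nat \<Rightarrow> 'a \<Rightarrow> real) \<Rightarrow> nat \<Rightarrow> real \<Rightarrow> real
    \<Rightarrow> (((nat \<Rightarrow> 'a) \<Rightarrow> enat) \<times> ((nat \<Rightarrow> 'a) \<Rightarrow> bool)) set" where
  "test_class \<nu> f K \<alpha> \<beta> = {(T, d). is_seq_test T d \<and>
      prob_accept1 (Pj \<nu> f 0) T d \<le> \<alpha> \<and>
      (\<forall>i\<in>{1..K}. prob_accept0 (Pj \<nu> f i) T d \<le> \<beta>)}"

definition ESS :: "(nat \<Rightarrow> 'a) measure \<Rightarrow> ((nat \<Rightarrow> 'a) \<Rightarrow> enat) \<Rightarrow> ennreal" where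
  "ESS P T = (\<integral>\<^sup>+ \<omega>. ennreal_of_enat (T \<omega>) \<partial>P)"

definition non_arithmetic :: "'b measure \<Rightarrow> ('b \<Rightarrow> real) \<Rightarrow> bool" where
  "non_arithmetic M Y \<longleftrightarrow> \<not> (\<exists>h>0. AE x in M. \<exists>m::int. Y x = h * of_int m)"

end

theory Submission
  imports Defs
begin

text \<open>
  Lower bounds: for any test with \<open>P\<^sub>0(d = 1) \<le> \<alpha>\<close> and \<open>P\<^sub>i(d = 0) \<le> \<beta>\<close>, stopping the log-likelihood ratio
  \<open>Z\<close> at \<open>T\<close>, changing measure on each decision region and using \<open>z \<ge> 1 + ln c - c exp (-z)\<close> with
  \<open>c = 1 / \<alpha>\<close>, respectively \<open>c = 1\<close>, gives \<open>I E[T] \<ge> (1 - \<beta>) |ln \<alpha>| - 2\<close>; the error term \<open>\<beta> |ln \<alpha>|\<close> is bounded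
  by (A2). The same holds under \<open>P\<^sub>0\<close> with the roles exchanged.

  Upper bounds: a change of measure bounds the error probabilities by multiples of \<open>1 / B\<close> and \<open>1 / A\<close>, so (A3)
  forces \<open>ln B \<le> |ln \<alpha>| + O(1)\<close> and \<open>ln A \<le> |ln \<beta>| + O(1)\<close>. Before either test stops, \<open>Z\<^sup>i\<close> is below
  \<open>ln B + O(1)\<close> for every \<open>i\<close>, and \<open>-Z\<^sup>i\<close> is below \<open>ln A + O(1)\<close> for some \<open>i\<close>. Under \<open>P\<^sub>i\<close> it remains to bound
  the expected first passage time over \<open>b\<close> of a random walk with mean \<open>\<mu>\<close> and finite variance by \<open>b / \<mu> + O(1)\<close>.
  Under \<open>P\<^sub>0\<close> with \<open>r = 1\<close>, once \<open>-Z\<^sup>1\<close> is above the barrier some \<open>Z\<^sup>1 - Z\<^sup>i\<close> must still be nonpositive, although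
  it has positive drift; with \<open>r > 1\<close> one compares each \<open>-Z\<^sup>i\<close> with a line of slope slightly below \<open>I\<^sub>0\<close>. In both cases
  the expected number of exceptional times is finite.
\<close>

section \<open>Infinite i.i.d. sequences\<close>

text \<open>Stopping is expressed through the decreasing events \<open>T > n\<close>: each depends
  on the first \<open>n\<close> observations only, and their probabilities sum to the expected
  sample size, even if \<open>T\<close> may be infinite. Renewal theory for a single walk does not
  fit, because a test is not stopped by the walk whose drift governs it: under \<open>P_0\<close>
  the component that keeps it running may change from one time to the next. The survival bound for
  random walks therefore allows an arbitrary decreasing family of events and charges a fixed
  constant for each time at which the family survives although the walk has passed its barrier. An
  \<open>O(1)\<close> error then only needs a bound, uniform in the thresholds, on the expected
  number of those times. If several components attain the minimal information, the difference of two
  of their walks has drift 0 and this count is no longer controlled; the flatter line costs a factor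
  close to 1, hence a relative error. Second moments enter twice: they bound the concave correction
  of the drift function, and they make the expected number of nonpositive partial sums
  finite.\<close>

text \<open>For measurable events on the product space, \<open>determined n\<close> replaces membership in \<open>obsF n\<close>.\<close>

definition determined :: "nat \<Rightarrow> ((nat \<Rightarrow> 'a) \<Rightarrow> 'b) \<Rightarrow> bool" where
  "determined n g \<longleftrightarrow> (\<forall>\<omega> \<omega>'. (\<forall>i<n. \<omega> i = \<omega>' i) \<longrightarrow> g \<omega> = g \<omega>')"

lemma determinedD: "determined n g \<Longrightarrow> (\<And>i. i < n \<Longrightarrow> \<omega> i = \<omega>' i) \<Longrightarrow> g \<omega> = g \<omega>'"
  unfolding determined_def by blast

lemma determined_mono: "determined m g \<Longrightarrow> m \<le> n \<Longrightarrow> determined n g"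
  unfolding determined_def by (meson order_less_le_trans)

lemma determined_partial_sum: "determined n (\<lambda>\<omega>. \<Sum>k<n. X (\<omega> k))"
  unfolding determined_def by (auto intro!: sum.cong)

lemma determined_comp: "determined n g \<Longrightarrow> determined n (\<lambda>\<omega>. h (g \<omega>))"
  unfolding determined_def by metis

lemma determined_comp2: "determined n g \<Longrightarrow> determined n g' \<Longrightarrow> determined n (\<lambda>\<omega>. h (g \<omega>) (g' \<omega>))"
  unfolding determined_def by metis

lemma determined_indicator: "determined n (\<lambda>\<omega>. \<omega> \<in> E) \<Longrightarrow> determined n (indicator E)"
  using determined_comp[of n "\<lambda>\<omega>. \<omega> \<in> E" of_bool] by (simp add: indicator_def[abs_def] of_bool_def)

lemma sequence_spaceI: "prob_space M \<Longrightarrow> sequence_space M"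
  unfolding sequence_space_def by (rule product_prob_spaceI)

context sequence_space
begin

lemma nn_integral_iter:
  assumes [measurable]: "F \<in> borel_measurable S"
  shows "(\<integral>\<^sup>+\<omega>. F \<omega> \<partial>S) = (\<integral>\<^sup>+x. \<integral>\<^sup>+\<omega>. F (case_nat x \<omega>) \<partial>S \<partial>M)"
proof -
  have "(\<integral>\<^sup>+\<omega>. F \<omega> \<partial>S) = (\<integral>\<^sup>+\<omega>. F \<omega> \<partial>distr (M \<Otimes>\<^sub>M S) S (\<lambda>(s, \<omega>). case_nat s \<omega>))"
    by (simp add: PiM_iter)
  also have "\<dots> = (\<integral>\<^sup>+p. F (case_nat (fst p) (snd p)) \<partial>(M \<Otimes>\<^sub>M S))"
    by (subst nn_integral_distr) (auto simp: case_prod_beta)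
  also have "\<dots> = (\<integral>\<^sup>+x. \<integral>\<^sup>+\<omega>. F (case_nat x \<omega>) \<partial>S \<partial>M)"
    by (subst P.nn_integral_fst[symmetric]) auto
  finally show ?thesis .
qed

lemma nn_integral_coord:
  assumes [measurable]: "h \<in> borel_measurable M"
  shows "(\<integral>\<^sup>+\<omega>. h (\<omega> n) \<partial>S) = (\<integral>\<^sup>+x. h x \<partial>M)"
proof -
  have "(\<integral>\<^sup>+x. h x \<partial>M) = (\<integral>\<^sup>+x. h x \<partial>distr S M (\<lambda>\<omega>. \<omega> n))"
    by (subst distr_PiM_component[of UNIV "\<lambda>_. M" n]) (simp_all add: M.prob_space_axioms)
  also have "\<dots> = (\<integral>\<^sup>+\<omega>. h (\<omega> n) \<partial>S)"
    by (rule nn_integral_distr) simp_all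
  finally show ?thesis by simp
qed

text \<open>Splicing the first \<open>n\<close> coordinates of one path with an independent second
  path preserves the product measure. The spliced path keeps the past seen by \<open>G\<close>,
  while its coordinate \<open>n\<close> is coordinate 0 of the second path and can be integrated out
  separately.\<close>

lemma nn_integral_past_next:
  assumes G[measurable]: "(\<lambda>(\<omega>, x). G \<omega> x) \<in> borel_measurable (S \<Otimes>\<^sub>M M)"
    and dep: "\<And>x. determined n (\<lambda>\<omega>. G \<omega> x)"
  shows "(\<integral>\<^sup>+\<omega>. G \<omega> (\<omega> n) \<partial>S) = (\<integral>\<^sup>+\<omega>. \<integral>\<^sup>+x. G \<omega> x \<partial>M \<partial>S)"
proof -
  have comb: "(\<lambda>p. comb_seq n (fst p) (snd p)) \<in> S \<Otimes>\<^sub>M S \<rightarrow>\<^sub>M S"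
    by measurable
  have [measurable]: "(\<lambda>p. G (comb_seq n (fst p) (snd p)) (comb_seq n (fst p) (snd p) n))
      \<in> borel_measurable (S \<Otimes>\<^sub>M S)"
    using measurable_compose[OF measurable_Pair[OF comb measurable_compose[OF comb]] G,
        of "\<lambda>\<omega>. \<omega> n"] by simp
  have [measurable]: "(\<lambda>\<omega>. G \<omega> (\<omega> n)) \<in> borel_measurable S"
    using measurable_compose[OF measurable_Pair[OF measurable_ident] G, of "\<lambda>\<omega>. \<omega> n"]
    by (simp add: id_def)
  have "(\<integral>\<^sup>+\<omega>. G \<omega> (\<omega> n) \<partial>S)
      = (\<integral>\<^sup>+\<omega>. G \<omega> (\<omega> n) \<partial>distr (S \<Otimes>\<^sub>M S) S (\<lambda>(\<omega>, \<omega>'). comb_seq n \<omega> \<omega>'))"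
    by (simp add: PiM_comb_seq)
  also have "\<dots> = (\<integral>\<^sup>+p. G (comb_seq n (fst p) (snd p)) (comb_seq n (fst p) (snd p) n) \<partial>(S \<Otimes>\<^sub>M S))"
    by (subst nn_integral_distr) (auto simp: case_prod_beta)
  also have "\<dots> = (\<integral>\<^sup>+\<omega>. \<integral>\<^sup>+\<omega>'. G (comb_seq n \<omega> \<omega>') (comb_seq n \<omega> \<omega>' n) \<partial>S \<partial>S)"
    by (subst P.nn_integral_fst[symmetric]) auto
  also have "\<dots> = (\<integral>\<^sup>+\<omega>. \<integral>\<^sup>+\<omega>'. G \<omega> (\<omega>' 0) \<partial>S \<partial>S)"
  proof (intro nn_integral_cong)
    fix \<omega> \<omega>' :: "nat \<Rightarrow> 'a"
    have "comb_seq n \<omega> \<omega>' n = \<omega>' 0" by (simp add: comb_seq_def)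
    then show "G (comb_seq n \<omega> \<omega>') (comb_seq n \<omega> \<omega>' n) = G \<omega> (\<omega>' 0)"
      using determinedD[OF dep, of "comb_seq n \<omega> \<omega>'" \<omega>] by (simp add: comb_seq_less)
  qed
  also have "\<dots> = (\<integral>\<^sup>+\<omega>. \<integral>\<^sup>+x. G \<omega> x \<partial>M \<partial>S)"
  proof (intro nn_integral_cong nn_integral_coord)
    fix \<omega> assume "\<omega> \<in> space S"
    then show "G \<omega> \<in> borel_measurable M"
      using measurable_compose[OF measurable_Pair1' G, of \<omega>] by simp
  qed
  finally show ?thesis .
qed

text \<open>The step behind Wald's identity. Independence is used for nonnegative functions only
  (\<open>key\<close>); the signed case is assembled from positive part, negative part and
  norm.\<close>

lemma integral_past_next:
  assumes [measurable]: "E \<in> sets S" and dep: "determined n (\<lambda>\<omega>. \<omega> \<in> E)"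
    and z: "integrable M (z :: 'a \<Rightarrow> real)"
  shows "integrable S (\<lambda>\<omega>. indicator E \<omega> * z (\<omega> n))" (is ?A)
    and "(\<integral>\<omega>. indicator E \<omega> * z (\<omega> n) \<partial>S) = measure S E * (\<integral>x. z x \<partial>M)" (is ?B)
proof -
  have [measurable]: "z \<in> borel_measurable M" using z by (rule borel_measurable_integrable)
  have key: "(\<integral>\<^sup>+\<omega>. indicator E \<omega> * h (\<omega> n) \<partial>S) = emeasure S E * (\<integral>\<^sup>+x. h x \<partial>M)"
    if [measurable]: "h \<in> borel_measurable M" for h :: "'a \<Rightarrow> ennreal"
  proof -
    have "(\<integral>\<^sup>+\<omega>. indicator E \<omega> * h (\<omega> n) \<partial>S) = (\<integral>\<^sup>+\<omega>. \<integral>\<^sup>+x. indicator E \<omega> * h x \<partial>M \<partial>S)"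
    proof (rule nn_integral_past_next)
      show "determined n (\<lambda>\<omega>. indicator E \<omega> * h x)" for x
        using determined_comp[OF determined_indicator[OF dep], of "\<lambda>a. a * h x"] .
    next
      show "(\<lambda>(\<omega>, x). indicator E \<omega> * h x) \<in> borel_measurable (S \<Otimes>\<^sub>M M)"
        by measurable
    qed
    also have "\<dots> = (\<integral>\<^sup>+\<omega>. indicator E \<omega> * (\<integral>\<^sup>+x. h x \<partial>M) \<partial>S)"
      by (subst nn_integral_cmult) simp_all
    also have "\<dots> = emeasure S E * (\<integral>\<^sup>+x. h x \<partial>M)"
      by (subst nn_integral_multc) simp_all
    finally show ?thesis .
  qed
  have P: "(\<integral>\<^sup>+\<omega>. ennreal (indicator E \<omega> * z (\<omega> n)) \<partial>S) = emeasure S E * (\<integral>\<^sup>+x. ennreal (z x) \<partial>M)"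
    by (subst key[symmetric]) (auto intro!: nn_integral_cong simp: indicator_def)
  have N: "(\<integral>\<^sup>+\<omega>. ennreal (- (indicator E \<omega> * z (\<omega> n))) \<partial>S) = emeasure S E * (\<integral>\<^sup>+x. ennreal (- z x) \<partial>M)"
    by (subst key[symmetric]) (auto intro!: nn_integral_cong simp: indicator_def)
  have A: "(\<integral>\<^sup>+\<omega>. ennreal (norm (indicator E \<omega> * z (\<omega> n))) \<partial>S) = emeasure S E * (\<integral>\<^sup>+x. ennreal (norm (z x)) \<partial>M)"
    by (subst key[symmetric]) (auto intro!: nn_integral_cong simp: indicator_def)
  show ?A
    unfolding integrable_iff_bounded A
    using z
    by (intro conjI) (measurable, simp add: integrable_iff_bounded ennreal_mult_less_top P.emeasure_eq_measure)
  have "(\<integral>\<omega>. indicator E \<omega> * z (\<omega> n) \<partial>S)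
      = enn2real (emeasure S E * (\<integral>\<^sup>+x. ennreal (z x) \<partial>M)) - enn2real (emeasure S E * (\<integral>\<^sup>+x. ennreal (- z x) \<partial>M))"
    by (subst real_lebesgue_integral_def[OF \<open>?A\<close>]) (simp only: P N)
  also have "\<dots> = measure S E * (\<integral>x. z x \<partial>M)"
    by (subst real_lebesgue_integral_def[OF z]) (simp only: enn2real_mult measure_def right_diff_distrib)
  finally show ?B .
qed

end

section \<open>Random walks with positive drift\<close>

text \<open>With \<open>H = E[(X - u)\<^sup>+]\<close> the function \<open>u + G u\<close>, where \<open>G' = 2 H / E[X]\<close>, has drift at most
  \<open>-E[X]\<close> along the walk \<open>u \<mapsto> u - X\<close>: the concave correction \<open>G\<close> pays for the overshoot, and
  stays bounded because \<open>H\<close> is integrable when \<open>X\<close> has a second moment.\<close>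

lemma (in prob_space) drift_function:
  fixes X :: "'a \<Rightarrow> real"
  assumes X: "integrable M X" and X2: "integrable M (\<lambda>x. (X x)\<^sup>2)"
    and mu: "\<mu> = expectation X" "\<mu> > 0"
  obtains V c \<kappa> D where
    "V \<in> borel_measurable borel" "\<And>u::real. (0::real) \<le> V u" "\<And>u. V u \<le> max u 0 / \<mu> + D"
    "0 \<le> D" "0 \<le> c" "0 \<le> \<kappa>"
    "\<And>u. integrable M (\<lambda>x. V (u - X x))"
    "\<And>u. c \<le> u \<Longrightarrow> expectation (\<lambda>x. V (u - X x)) \<le> V u - 1"
    "\<And>u. expectation (\<lambda>x. V (u - X x)) \<le> V u + \<kappa>"
proof -
  define p where "p u x = max (X x - u) 0" for u x
  define h where "h u = expectation (p u)" for u
  define m2 where "m2 = expectation (\<lambda>x. (X x)\<^sup>2)"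
  \<comment> \<open>The integral of \<open>2 h / \<mu>\<close> from 0 to \<open>u\<close> in closed
    form, so that concavity can be proved pointwise in \<open>x\<close>.\<close>
  define G where "G u = expectation (\<lambda>x. (p 0 x)\<^sup>2 - (p u x)\<^sup>2) / \<mu>" for u
  define V where "V u = (max u 0 + G (max u 0)) / \<mu>" for u
  define D where "D = m2 / \<mu>\<^sup>2"
  \<comment> \<open>From \<open>c\<close> on, \<open>m2 / (4 * u) \<le> \<mu> / 2\<close>, which
    makes the slope of \<open>G\<close> at most 1; the added 1 keeps \<open>c\<close>
    positive.\<close>
  define c where "c = m2 / (2 * \<mu>) + 1"
  define \<kappa> where "\<kappa> = expectation (\<lambda>x. \<bar>X x\<bar>) / \<mu> + D"
  have [measurable]: "X \<in> borel_measurable M" using X by (rule borel_measurable_integrable)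
  have m2: "0 \<le> m2" unfolding m2_def by simp
  then have D: "0 \<le> D" and c: "0 < c" using mu(2) by (auto simp: D_def c_def add_nonneg_pos)
  have \<kappa>: "0 \<le> \<kappa>" using D mu(2) by (simp add: \<kappa>_def)
  have p_meas [measurable]: "p u \<in> borel_measurable M" for u
    unfolding p_def by measurable
  have p_int: "integrable M (p u)" for u
    unfolding p_def by (intro integrable_max Bochner_Integration.integrable_diff X integrable_const)
  have p_le: "0 \<le> p u x" "u \<ge> 0 \<Longrightarrow> p u x \<le> \<bar>X x\<bar>" "u \<ge> 0 \<Longrightarrow> p u x \<le> p 0 x" for u x
    unfolding p_def by auto
  have p2_int: "integrable M (\<lambda>x. (p u x)\<^sup>2)" if "u \<ge> 0" for u
  proof (rule Bochner_Integration.integrable_bound[OF X2])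
    show "AE x in M. norm ((p u x)\<^sup>2) \<le> norm ((X x)\<^sup>2)"
      using p_le(1)[of u] p_le(2)[OF that] by (auto intro!: AE_I2 simp: abs_le_square_iff[symmetric])
  qed measurable
  have G_nonneg: "0 \<le> G u" if "0 \<le> u" for u
    unfolding G_def using mu(2) p_le(1,3)[of u] that
    by (intro divide_nonneg_pos Bochner_Integration.integral_nonneg) (auto intro!: power_mono)
  have G_le: "G u \<le> m2 / \<mu>" if "0 \<le> u" for u
  proof -
    have "expectation (\<lambda>x. (p 0 x)\<^sup>2 - (p u x)\<^sup>2) \<le> m2"
      unfolding m2_def
    proof (rule integral_mono)
      show "integrable M (\<lambda>x. (p 0 x)\<^sup>2 - (p u x)\<^sup>2)"
        using that by (intro Bochner_Integration.integrable_diff p2_int) auto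
      fix x
      have "(p 0 x)\<^sup>2 \<le> (X x)\<^sup>2"
        using p_le(1)[of 0 x] p_le(2)[of 0 x] by (simp add: abs_le_square_iff[symmetric])
      then show "(p 0 x)\<^sup>2 - (p u x)\<^sup>2 \<le> (X x)\<^sup>2"
        using zero_le_power2[of "p u x"] by linarith
    qed (rule X2)
    then show ?thesis using mu(2) by (simp add: G_def divide_right_mono)
  qed
  \<comment> \<open>Concavity as a tangent inequality; it is applied at the random point
    \<open>v = max (u - X x) 0\<close>, where \<open>v - u = p u x - X x\<close>.\<close>
  have tangent: "G v \<le> G u + 2 * h u * (v - u) / \<mu>" if uv: "0 \<le> u" "0 \<le> v" for u v
  proof -
    have "expectation (\<lambda>x. (p 0 x)\<^sup>2 - (p v x)\<^sup>2)
        \<le> expectation (\<lambda>x. ((p 0 x)\<^sup>2 - (p u x)\<^sup>2) + 2 * (v - u) * p u x)"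
    proof (rule integral_mono)
      show "integrable M (\<lambda>x. (p 0 x)\<^sup>2 - (p v x)\<^sup>2)"
        "integrable M (\<lambda>x. ((p 0 x)\<^sup>2 - (p u x)\<^sup>2) + 2 * (v - u) * p u x)"
        using uv by (auto intro!: Bochner_Integration.integrable_diff Bochner_Integration.integrable_add
            p2_int integrable_mult_right p_int)
      fix x
      have "(p u x)\<^sup>2 - 2 * (v - u) * p u x \<le> (p v x)\<^sup>2"
      proof (cases "X x \<le> u")
        case True then show ?thesis by (simp add: p_def)
      next
        case a: False
        show ?thesis
        proof (cases "X x \<le> v")
          case True
          with a have "(X x - u) * ((X x - u) - 2 * (v - u)) \<le> 0"
            by (intro mult_nonneg_nonpos) auto
          then show ?thesis using a True by (simp add: p_def power2_eq_square algebra_simps)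
        next
          case False
          have "0 \<le> (v - u)\<^sup>2" by simp
          then show ?thesis using a False by (simp add: p_def power2_eq_square algebra_simps)
        qed
      qed
      then show "(p 0 x)\<^sup>2 - (p v x)\<^sup>2 \<le> (p 0 x)\<^sup>2 - (p u x)\<^sup>2 + 2 * (v - u) * p u x" by linarith
    qed
    also have "\<dots> = expectation (\<lambda>x. (p 0 x)\<^sup>2 - (p u x)\<^sup>2) + 2 * (v - u) * h u"
      unfolding h_def using uv
      by (subst Bochner_Integration.integral_add)
         (auto intro!: Bochner_Integration.integrable_diff p2_int integrable_mult_right p_int)
    finally have "expectation (\<lambda>x. (p 0 x)\<^sup>2 - (p v x)\<^sup>2) / \<mu>
        \<le> (expectation (\<lambda>x. (p 0 x)\<^sup>2 - (p u x)\<^sup>2) + 2 * (v - u) * h u) / \<mu>"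
      using mu(2) by (intro divide_right_mono) auto
    then show ?thesis
      by (simp add: G_def add_divide_distrib mult_ac)
  qed
  have h_nonneg: "0 \<le> h u" for u unfolding h_def using p_le(1) by simp
  have h_le: "h u \<le> \<mu> / 2" if "c \<le> u" for u
  proof -
    have u: "0 < u" using c that by simp
    have "h u \<le> expectation (\<lambda>x. (X x)\<^sup>2 / (4 * u))"
      unfolding h_def
    proof (rule integral_mono[OF p_int])
      fix x
      have "0 \<le> (X x - 2 * u)\<^sup>2" by simp
      then have "(X x - u) * (4 * u) \<le> (X x)\<^sup>2" by (simp add: power2_eq_square algebra_simps)
      then have "X x - u \<le> (X x)\<^sup>2 / (4 * u)" using u by (simp add: pos_le_divide_eq)
      then show "p u x \<le> (X x)\<^sup>2 / (4 * u)" using u by (simp add: p_def)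
    qed (use X2 in simp)
    also have "\<dots> = m2 / (4 * u)" by (simp add: m2_def)
    also have "\<dots> \<le> \<mu> / 2"
    proof -
      have "m2 / (2 * \<mu>) \<le> u" using that by (simp add: c_def)
      then have "m2 \<le> 2 * \<mu> * u" using mu(2) by (simp add: pos_divide_le_eq algebra_simps)
      then show ?thesis using u by (simp add: pos_divide_le_eq algebra_simps)
    qed
    finally show ?thesis .
  qed
  have G_meas: "G \<in> borel_measurable borel"
    unfolding G_def p_def by measurable
  have V_meas: "V \<in> borel_measurable borel"
    unfolding V_def using G_meas by measurable
  have V_lower: "max u 0 / \<mu> \<le> V u" for u
    using G_nonneg[of "max u 0"] mu(2) by (simp add: V_def divide_right_mono)
  have V_nonneg: "0 \<le> V u" for u
    using V_lower[of u] mu(2) by (meson divide_nonneg_pos max.cobounded2 order_trans)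
  have V_le: "V u \<le> max u 0 / \<mu> + D" for u
  proof -
    have "G (max u 0) / \<mu> \<le> m2 / \<mu> / \<mu>"
      using G_le[of "max u 0"] mu(2) by (intro divide_right_mono) auto
    then show ?thesis by (simp add: V_def D_def add_divide_distrib power2_eq_square)
  qed
  have V_step: "V (u - X x) \<le> max u 0 / \<mu> + \<bar>X x\<bar> / \<mu> + D" for u x
  proof -
    have "max (u - X x) 0 / \<mu> \<le> (max u 0 + \<bar>X x\<bar>) / \<mu>"
      using mu(2) by (intro divide_right_mono) auto
    then show ?thesis using V_le[of "u - X x"] by (simp add: add_divide_distrib)
  qed
  have V_int: "integrable M (\<lambda>x. V (u - X x))" for u
  proof (rule Bochner_Integration.integrable_bound)
    show "integrable M (\<lambda>x. max u 0 / \<mu> + \<bar>X x\<bar> / \<mu> + D)" using X by simp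
    show "(\<lambda>x. V (u - X x)) \<in> borel_measurable M" using V_meas by measurable
    show "AE x in M. norm (V (u - X x)) \<le> norm (max u 0 / \<mu> + \<bar>X x\<bar> / \<mu> + D)"
      using V_step V_nonneg by (auto intro!: AE_I2 intro: order_trans[OF V_step abs_ge_self])
  qed
  have kap: "expectation (\<lambda>x. V (u - X x)) \<le> V u + \<kappa>" for u
  proof -
    have "expectation (\<lambda>x. V (u - X x)) \<le> expectation (\<lambda>x. max u 0 / \<mu> + \<bar>X x\<bar> / \<mu> + D)"
      using X V_int V_step by (intro integral_mono) auto
    also have "\<dots> = max u 0 / \<mu> + \<kappa>"
      using X by (simp add: \<kappa>_def prob_space)
    finally show ?thesis using V_lower[of u] by simp
  qed
  have drift: "expectation (\<lambda>x. V (u - X x)) \<le> V u - 1" if "c \<le> u" for u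
  proof -
    have u: "0 < u" using c that by simp
    let ?b = "2 * h u / \<mu>"
    have "expectation (\<lambda>x. V (u - X x)) \<le> expectation (\<lambda>x. (u + G u + (1 + ?b) * (p u x - X x)) / \<mu>)"
    proof (rule integral_mono[OF V_int])
      show "integrable M (\<lambda>x. (u + G u + (1 + ?b) * (p u x - X x)) / \<mu>)"
        using X p_int by simp
      fix x
      define v where "v = max (u - X x) 0"
      have v: "v - u = p u x - X x" "0 \<le> v" by (auto simp: v_def p_def)
      have "G v \<le> G u + 2 * h u * (v - u) / \<mu>" using tangent[of u v] u v by simp
      then have "v + G v \<le> u + G u + (1 + ?b) * (p u x - X x)"
        by (simp add: v(1)[symmetric] algebra_simps)
      then show "V (u - X x) \<le> (u + G u + (1 + ?b) * (p u x - X x)) / \<mu>"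
        unfolding V_def v_def[symmetric] using mu(2) by (intro divide_right_mono) auto
    qed
    also have "\<dots> = (u + G u + (1 + ?b) * (h u - \<mu>)) / \<mu>"
      using X p_int by (simp add: h_def mu(1) prob_space)
    also have "\<dots> \<le> (u + G u - \<mu>) / \<mu>"
    proof (rule divide_right_mono)
      \<comment> \<open>The slope \<open>2 h / \<mu>\<close> earns \<open>2 h\<close> of drift: one
        \<open>h\<close> pays for the overshoot in \<open>max (u - X) 0\<close>, the other for
        \<open>?b * h u\<close>, since \<open>?b \<le> 1\<close>.\<close>
      have "2 * h u * h u \<le> \<mu> * h u"
        using h_le[OF that] h_nonneg[of u] by (intro mult_right_mono) auto
      then have "?b * h u \<le> h u" using mu(2) by (simp add: pos_divide_le_eq algebra_simps)
      moreover have "?b * \<mu> = 2 * h u" using mu(2) by simp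
      moreover have "(1 + b) * (h u - \<mu>) = h u - \<mu> + b * h u - b * \<mu>" for b
        by (simp add: algebra_simps)
      note this[of ?b]
      ultimately show "u + G u + (1 + ?b) * (h u - \<mu>) \<le> u + G u - \<mu>" by linarith
    qed (use mu(2) in simp)
    also have "\<dots> = V u - 1" using u mu(2) by (simp add: V_def diff_divide_distrib)
    finally show ?thesis .
  qed
  show thesis
    by (rule that[OF V_meas V_nonneg V_le D less_imp_le[OF c] \<kappa> V_int drift kap])
qed

text \<open>While the walk is short of \<open>b\<close>, the potential \<open>V\<close> of the
  remaining distance drops by at least 1 per step on average, so the time spent there is at most the
  initial potential; beyond \<open>b\<close> each surviving time costs a constant. \<open>E\<close>
  need not come from the crossing of \<open>b\<close>, and \<open>C\<close> depends on neither
  \<open>E\<close> nor \<open>b\<close>.\<close>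

lemma (in sequence_space) sum_survival_bound:
  fixes X :: "'a \<Rightarrow> real"
  assumes X: "integrable M X" and X2: "integrable M (\<lambda>x. (X x)\<^sup>2)"
    and mu: "\<mu> = (\<integral>x. X x \<partial>M)" "\<mu> > 0"
  obtains C where "0 \<le> C"
    "\<And>E b. (\<And>n. E n \<in> sets S) \<Longrightarrow> (\<And>n. determined n (\<lambda>\<omega>. \<omega> \<in> E n)) \<Longrightarrow> decseq E \<Longrightarrow> 0 \<le> b \<Longrightarrow>
      (\<Sum>n. emeasure S (E n)) \<le> ennreal (b / \<mu> + C)
        + ennreal C * (\<Sum>n. emeasure S {\<omega>\<in>E n. b \<le> (\<Sum>k<n. X (\<omega> k))})"
proof -
  obtain V c \<kappa> D where V [measurable]: "V \<in> borel_measurable borel" and V0: "\<And>u::real. (0::real) \<le> V u"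
    and Vle: "\<And>u. V u \<le> max u 0 / \<mu> + D" and D: "0 \<le> D" and c: "0 \<le> c" and \<kappa>: "0 \<le> \<kappa>"
    and Vint: "\<And>u. integrable M (\<lambda>x. V (u - X x))"
    and drift: "\<And>u. c \<le> u \<Longrightarrow> (\<integral>x. V (u - X x) \<partial>M) \<le> V u - 1"
    and kap: "\<And>u. (\<integral>x. V (u - X x) \<partial>M) \<le> V u + \<kappa>"
    by (rule M.drift_function[OF X X2 mu]) (rule that)
  have [measurable]: "X \<in> borel_measurable M" using X by (rule borel_measurable_integrable)
  \<comment> \<open>Distances are measured to \<open>b + c\<close> rather than \<open>b\<close>,
    because the drift of \<open>V\<close> is guaranteed only at distance at least
    \<open>c\<close>.\<close>
  have one_step: "ennreal (\<integral>x. V (b + c - s - X x) \<partial>M) + 1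
      \<le> ennreal (V (b + c - s)) + ennreal (\<kappa> + 1) * indicator {b..} s" for b s
  proof (cases "b \<le> s")
    case True
    have "ennreal (\<integral>x. V (b + c - s - X x) \<partial>M) + 1 = ennreal ((\<integral>x. V (b + c - s - X x) \<partial>M) + 1)"
      using V0 by (subst ennreal_plus) auto
    also have "\<dots> \<le> ennreal (V (b + c - s) + (\<kappa> + 1))"
      using kap[of "b + c - s"] by (intro ennreal_leI) simp
    also have "\<dots> = ennreal (V (b + c - s)) + ennreal (\<kappa> + 1)"
      using V0 \<kappa> by (intro ennreal_plus) auto
    finally show ?thesis using True by simp
  next
    case False
    have "ennreal (\<integral>x. V (b + c - s - X x) \<partial>M) + 1 = ennreal ((\<integral>x. V (b + c - s - X x) \<partial>M) + 1)"
      using V0 by (subst ennreal_plus) auto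
    also have "\<dots> \<le> ennreal (V (b + c - s))"
      using drift[of "b + c - s"] False by (intro ennreal_leI) simp
    finally show ?thesis using False by simp
  qed
  define C where "C = max (c / \<mu> + D) (\<kappa> + 1)"
  show thesis
  proof (rule that[of C])
    show "0 \<le> C" unfolding C_def using \<kappa> by simp
    fix E :: "nat \<Rightarrow> (nat \<Rightarrow> 'a) set" and b :: real
    assume E [measurable]: "\<And>n. E n \<in> sets S" and detE: "\<And>n. determined n (\<lambda>\<omega>. \<omega> \<in> E n)"
      and dec: "decseq E" and b: "0 \<le> b"
    define Y where "Y n \<omega> = (\<Sum>k<n. X (\<omega> k))" for n and \<omega> :: "nat \<Rightarrow> 'a"
    have [measurable]: "Y n \<in> borel_measurable S" for n unfolding Y_def by measurable
    have detY: "determined n (Y n)" for n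
      unfolding Y_def[abs_def] by (rule determined_partial_sum)
    define a where "a n = (\<integral>\<^sup>+\<omega>. indicator (E n) \<omega> * ennreal (V (b + c - Y n \<omega>)) \<partial>S)" for n
    define e where "e n = emeasure S {\<omega>\<in>E n. b \<le> Y n \<omega>}" for n
    have split: "{\<omega>\<in>E n. b \<le> Y n \<omega>} = E n \<inter> {\<omega>\<in>space S. b \<le> Y n \<omega>}" for n
      using sets.sets_into_space[OF E[of n]] by auto
    have [measurable]: "{\<omega>\<in>E n. b \<le> Y n \<omega>} \<in> sets S" for n unfolding split by measurable
    have step: "a (Suc n) + emeasure S (E n) \<le> a n + ennreal (\<kappa> + 1) * e n" for n
    proof -
      \<comment> \<open>Enlarging \<open>E (Suc n)\<close> to \<open>E n\<close> leaves an event
        decided before the increment \<open>X (\<omega> n)\<close> is drawn.\<close>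
      have "a (Suc n) \<le> (\<integral>\<^sup>+\<omega>. indicator (E n) \<omega> * ennreal (V (b + c - Y n \<omega> - X (\<omega> n))) \<partial>S)"
        unfolding a_def using decseq_SucD[OF dec, of n]
        by (intro nn_integral_mono mult_mono) (auto simp: Y_def indicator_def algebra_simps)
      also have "\<dots> = (\<integral>\<^sup>+\<omega>. \<integral>\<^sup>+x. indicator (E n) \<omega> * ennreal (V (b + c - Y n \<omega> - X x)) \<partial>M \<partial>S)"
      proof (rule nn_integral_past_next)
        show "determined n (\<lambda>\<omega>. indicator (E n) \<omega> * ennreal (V (b + c - Y n \<omega> - X x)))" for x
          using determined_comp2[OF determined_indicator[OF detE[of n]] detY[of n],
              of "\<lambda>i y. i * ennreal (V (b + c - y - X x))"] .
        show "(\<lambda>(\<omega>, x). indicator (E n) \<omega> * ennreal (V (b + c - Y n \<omega> - X x))) \<in> borel_measurable (S \<Otimes>\<^sub>M M)"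
          by measurable
      qed
      also have "\<dots> = (\<integral>\<^sup>+\<omega>. indicator (E n) \<omega> * ennreal (\<integral>x. V (b + c - Y n \<omega> - X x) \<partial>M) \<partial>S)"
      proof (intro nn_integral_cong)
        fix \<omega> :: "nat \<Rightarrow> 'a"
        have "(\<integral>\<^sup>+x. indicator (E n) \<omega> * ennreal (V (b + c - Y n \<omega> - X x)) \<partial>M)
            = indicator (E n) \<omega> * (\<integral>\<^sup>+x. ennreal (V (b + c - Y n \<omega> - X x)) \<partial>M)"
          by (intro nn_integral_cmult) measurable
        also have "(\<integral>\<^sup>+x. ennreal (V (b + c - Y n \<omega> - X x)) \<partial>M) = ennreal (\<integral>x. V (b + c - Y n \<omega> - X x) \<partial>M)"
          using V0 by (intro nn_integral_eq_integral Vint) auto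
        finally show "(\<integral>\<^sup>+x. indicator (E n) \<omega> * ennreal (V (b + c - Y n \<omega> - X x)) \<partial>M)
            = indicator (E n) \<omega> * ennreal (\<integral>x. V (b + c - Y n \<omega> - X x) \<partial>M)" .
      qed
      finally have 1: "a (Suc n) \<le> (\<integral>\<^sup>+\<omega>. indicator (E n) \<omega> * ennreal (\<integral>x. V (b + c - Y n \<omega> - X x) \<partial>M) \<partial>S)" .
      have "a (Suc n) + emeasure S (E n)
          \<le> (\<integral>\<^sup>+\<omega>. indicator (E n) \<omega> * ennreal (\<integral>x. V (b + c - Y n \<omega> - X x) \<partial>M) \<partial>S)
            + (\<integral>\<^sup>+\<omega>. indicator (E n) \<omega> \<partial>S)"
        by (intro add_mono 1) simp
      also have "\<dots> = (\<integral>\<^sup>+\<omega>. indicator (E n) \<omega> * ennreal (\<integral>x. V (b + c - Y n \<omega> - X x) \<partial>M)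
            + indicator (E n) \<omega> \<partial>S)"
        by (intro nn_integral_add[symmetric]) measurable
      also have "\<dots> \<le> (\<integral>\<^sup>+\<omega>. indicator (E n) \<omega> * ennreal (V (b + c - Y n \<omega>))
            + ennreal (\<kappa> + 1) * indicator {\<omega>\<in>E n. b \<le> Y n \<omega>} \<omega> \<partial>S)"
        using one_step[of b "Y n _"] by (intro nn_integral_mono) (auto simp: indicator_def)
      also have "\<dots> = a n + ennreal (\<kappa> + 1) * e n"
        unfolding a_def e_def
        by (subst nn_integral_add) (auto simp: nn_integral_cmult)
      finally show ?thesis .
    qed
    have partial: "a N + (\<Sum>n<N. emeasure S (E n)) \<le> a 0 + ennreal (\<kappa> + 1) * (\<Sum>n<N. e n)" for N
    proof (induction N)
      case (Suc N)
      have "a (Suc N) + (\<Sum>n<Suc N. emeasure S (E n)) = (a (Suc N) + emeasure S (E N)) + (\<Sum>n<N. emeasure S (E n))"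
        by (simp add: add_ac)
      also have "\<dots> \<le> (a N + ennreal (\<kappa> + 1) * e N) + (\<Sum>n<N. emeasure S (E n))"
        by (intro add_mono step order_refl)
      also have "\<dots> = (a N + (\<Sum>n<N. emeasure S (E n))) + ennreal (\<kappa> + 1) * e N"
        by (simp add: add_ac)
      also have "\<dots> \<le> (a 0 + ennreal (\<kappa> + 1) * (\<Sum>n<N. e n)) + ennreal (\<kappa> + 1) * e N"
        by (intro add_mono Suc order_refl)
      also have "\<dots> = a 0 + ennreal (\<kappa> + 1) * (\<Sum>n<Suc N. e n)"
        by (simp add: distrib_left add_ac)
      finally show ?case .
    qed simp
    have "a 0 \<le> (\<integral>\<^sup>+\<omega>. ennreal (V (b + c)) \<partial>S)"
      unfolding a_def by (intro nn_integral_mono) (auto simp: indicator_def Y_def)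
    also have "\<dots> = ennreal (V (b + c))" by (simp add: P.emeasure_space_1)
    also have "\<dots> \<le> ennreal (b / \<mu> + C)"
      using Vle[of "b + c"] b c by (intro ennreal_leI) (auto simp: C_def add_divide_distrib)
    finally have a0: "a 0 \<le> ennreal (b / \<mu> + C)" .
    have "(\<Sum>n. emeasure S (E n)) \<le> ennreal (b / \<mu> + C) + ennreal C * (\<Sum>n. e n)"
    proof (rule suminf_le_const)
      fix N
      have "(\<Sum>n<N. emeasure S (E n)) \<le> a N + (\<Sum>n<N. emeasure S (E n))" by simp
      also have "\<dots> \<le> a 0 + ennreal (\<kappa> + 1) * (\<Sum>n<N. e n)" by (rule partial)
      also have "\<dots> \<le> ennreal (b / \<mu> + C) + ennreal C * (\<Sum>n. e n)"
        by (intro add_mono a0 mult_mono sum_le_suminf ennreal_leI) (auto simp: C_def)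
      finally show "(\<Sum>n<N. emeasure S (E n)) \<le> ennreal (b / \<mu> + C) + ennreal C * (\<Sum>n. e n)" .
    qed simp
    then show "(\<Sum>n. emeasure S (E n)) \<le> ennreal (b / \<mu> + C)
        + ennreal C * (\<Sum>n. emeasure S {\<omega>\<in>E n. b \<le> (\<Sum>k<n. X (\<omega> k))})"
      by (simp add: e_def Y_def)
  qed
qed

text \<open>The maximum of the partial sums of length at most \<open>n\<close>. Recursing on the
  first coordinate instead of the last leaves the same functional of the shifted path, which is
  independent of \<open>Y (\<omega> 0)\<close>.\<close>

primrec running_max :: "('a \<Rightarrow> real) \<Rightarrow> nat \<Rightarrow> (nat \<Rightarrow> 'a) \<Rightarrow> real" where
  "running_max Y 0 \<omega> = 0"
| "running_max Y (Suc n) \<omega> = max 0 (Y (\<omega> 0) + running_max Y n (\<lambda>k. \<omega> (Suc k)))"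

lemma running_max_nonneg: "0 \<le> running_max Y n \<omega>"
  by (cases n) auto

lemma running_max_Suc_ge: "running_max Y n \<omega> \<le> running_max Y (Suc n) \<omega>"
proof (induction n arbitrary: \<omega>)
  case (Suc n)
  show ?case using Suc[of "\<lambda>k. \<omega> (Suc k)"] by auto
qed simp

lemma sum_le_running_max: "k \<le> n \<Longrightarrow> (\<Sum>j<k. Y (\<omega> j)) \<le> running_max Y n \<omega>"
proof (induction n arbitrary: k \<omega>)
  case (Suc n)
  show ?case
  proof (cases k)
    case (Suc k')
    have "(\<Sum>j<k'. Y (\<omega> (Suc j))) \<le> running_max Y n (\<lambda>k. \<omega> (Suc k))"
      using Suc.IH[of k' "\<lambda>k. \<omega> (Suc k)"] Suc.prems Suc by simp
    then show ?thesis unfolding Suc by (simp add: sum.lessThan_Suc_shift del: sum.lessThan_Suc)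
  qed simp
qed simp

context sequence_space
begin

lemma measurable_running_max:
  assumes [measurable]: "Y \<in> borel_measurable M"
  shows "running_max Y n \<in> borel_measurable S"
proof (induction n)
  case (Suc n)
  have shift: "(\<lambda>\<omega> k. \<omega> (Suc k)) \<in> S \<rightarrow>\<^sub>M S"
    by (rule measurable_PiM_single') (auto simp: space_PiM PiE_iff)
  have [measurable]: "(\<lambda>\<omega>. running_max Y n (\<lambda>k. \<omega> (Suc k))) \<in> borel_measurable S"
    by (rule measurable_compose[OF shift Suc])
  show ?case by (simp add: fun_eq_iff) measurable
qed simp

text \<open>Splitting off the first coordinate, \<open>R\<^sub>n\<^sub>+\<^sub>1 \<ge> R\<^sub>n\<close> and \<open>R\<^sub>n\<^sub>+\<^sub>1 = (Y + R\<^sub>n')\<^sup>+\<close> with \<open>R\<^sub>n'\<close> an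
  independent copy of \<open>R\<^sub>n\<close> give \<open>0 \<le> E[R\<^sub>n\<^sub>+\<^sub>1\<^sup>2] - E[R\<^sub>n\<^sup>2] \<le> E[Y\<^sup>2] + 2 E[Y] E[R\<^sub>n]\<close>.\<close>

lemma running_max_moments:
  assumes Y: "integrable M Y" and Y2: "integrable M (\<lambda>x. (Y x)\<^sup>2)"
  shows "integrable S (\<lambda>\<omega>. (running_max Y n \<omega>)\<^sup>2)"
    and "integrable S (running_max Y n)"
    and "0 \<le> (\<integral>x. (Y x)\<^sup>2 \<partial>M) + 2 * (\<integral>x. Y x \<partial>M) * (\<integral>\<omega>. running_max Y n \<omega> \<partial>S)"
proof -
  interpret MS: pair_sigma_finite M S
    by (rule pair_sigma_finite.intro) unfold_locales
  have [measurable]: "Y \<in> borel_measurable M" using Y by (rule borel_measurable_integrable)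
  note [measurable] = measurable_running_max[OF \<open>Y \<in> borel_measurable M\<close>]
  have step: "integrable S (\<lambda>\<omega>. (running_max Y (Suc n) \<omega>)\<^sup>2)
      \<and> 0 \<le> (\<integral>x. (Y x)\<^sup>2 \<partial>M) + 2 * (\<integral>x. Y x \<partial>M) * (\<integral>\<omega>. running_max Y n \<omega> \<partial>S)"
    if R2: "integrable S (\<lambda>\<omega>. (running_max Y n \<omega>)\<^sup>2)" for n
  proof -
    let ?R = "running_max Y n" and ?R' = "running_max Y (Suc n)"
    have R: "integrable S ?R" by (rule P.square_integrable_imp_integrable[OF _ R2]) measurable
    \<comment> \<open>The square without the positive part: it dominates the square of
      \<open>?R'\<close> and has an explicit integral.\<close>
    define f where "f = (\<lambda>p. (Y (fst p) + ?R (snd p))\<^sup>2)"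
    have inner: "integrable S (\<lambda>\<omega>. (Y x + ?R \<omega>)\<^sup>2)"
      "(\<integral>\<omega>. (Y x + ?R \<omega>)\<^sup>2 \<partial>S) = (Y x)\<^sup>2 + 2 * Y x * (\<integral>\<omega>. ?R \<omega> \<partial>S) + (\<integral>\<omega>. (?R \<omega>)\<^sup>2 \<partial>S)" for x
      using R R2 by (simp_all add: power2_sum P.prob_space)
    have f_int: "integrable (M \<Otimes>\<^sub>M S) f"
    proof (rule MS.Fubini_integrable)
      show "f \<in> borel_measurable (M \<Otimes>\<^sub>M S)" unfolding f_def by measurable
      show "integrable M (\<lambda>x. \<integral>\<omega>. norm (f (x, \<omega>)) \<partial>S)"
        using Y Y2 by (simp add: f_def inner)
      show "AE x in M. integrable S (\<lambda>\<omega>. f (x, \<omega>))" by (simp add: f_def inner)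
    qed
    have f_eq: "(\<integral>p. f p \<partial>(M \<Otimes>\<^sub>M S))
        = (\<integral>x. (Y x)\<^sup>2 \<partial>M) + 2 * (\<integral>x. Y x \<partial>M) * (\<integral>\<omega>. ?R \<omega> \<partial>S) + (\<integral>\<omega>. (?R \<omega>)\<^sup>2 \<partial>S)"
      using Y Y2 by (subst MS.integral_fst'[OF f_int, symmetric]) (simp add: f_def inner M.prob_space)
    have cn: "(\<lambda>(s, \<omega>). case_nat s \<omega>) \<in> M \<Otimes>\<^sub>M S \<rightarrow>\<^sub>M S" by measurable
    have g_le: "(?R' (case_nat (fst p) (snd p)))\<^sup>2 \<le> f p" for p
      by (auto simp: f_def max_def)
    have g_int: "integrable (M \<Otimes>\<^sub>M S) (\<lambda>p. (?R' (case_nat (fst p) (snd p)))\<^sup>2)"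
    proof (rule Bochner_Integration.integrable_bound[OF f_int])
      show "(\<lambda>p. (?R' (case_nat (fst p) (snd p)))\<^sup>2) \<in> borel_measurable (M \<Otimes>\<^sub>M S)" by measurable
      show "AE p in M \<Otimes>\<^sub>M S. norm ((?R' (case_nat (fst p) (snd p)))\<^sup>2) \<le> norm (f p)"
        using order_trans[OF g_le abs_ge_self]
        by (intro AE_I2) (simp only: real_norm_def power2_abs abs_power2)
    qed
    have R'2: "integrable S (\<lambda>\<omega>. (?R' \<omega>)\<^sup>2)"
    proof -
      have "integrable (distr (M \<Otimes>\<^sub>M S) S (\<lambda>(s, \<omega>). case_nat s \<omega>)) (\<lambda>\<omega>. (?R' \<omega>)\<^sup>2)"
        by (subst integrable_distr_eq[OF cn]) (use g_int in \<open>simp_all add: case_prod_unfold del: running_max.simps\<close>)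
      then show ?thesis by (simp add: PiM_iter del: running_max.simps)
    qed
    have "(\<integral>\<omega>. (?R \<omega>)\<^sup>2 \<partial>S) \<le> (\<integral>\<omega>. (?R' \<omega>)\<^sup>2 \<partial>S)"
      using running_max_Suc_ge[of Y n] running_max_nonneg[of Y n]
      by (intro integral_mono R2 R'2 power_mono) (auto simp del: running_max.simps)
    also have "\<dots> = (\<integral>\<omega>. (?R' \<omega>)\<^sup>2 \<partial>distr (M \<Otimes>\<^sub>M S) S (\<lambda>(s, \<omega>). case_nat s \<omega>))"
      by (simp add: PiM_iter)
    also have "\<dots> = (\<integral>p. (?R' (case_nat (fst p) (snd p)))\<^sup>2 \<partial>(M \<Otimes>\<^sub>M S))"
      by (subst integral_distr[OF cn]) (simp_all add: case_prod_unfold del: running_max.simps)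
    also have "\<dots> \<le> (\<integral>p. f p \<partial>(M \<Otimes>\<^sub>M S))"
      by (intro integral_mono g_int f_int g_le)
    finally show ?thesis unfolding f_eq using R'2 by simp
  qed
  show R2: "integrable S (\<lambda>\<omega>. (running_max Y n \<omega>)\<^sup>2)" for n
  proof (induction n)
    case (Suc n) then show ?case using step[of n] by blast
  qed simp
  show "integrable S (running_max Y n)"
    by (rule P.square_integrable_imp_integrable[OF _ R2]) measurable
  show "0 \<le> (\<integral>x. (Y x)\<^sup>2 \<partial>M) + 2 * (\<integral>x. Y x \<partial>M) * (\<integral>\<omega>. running_max Y n \<omega> \<partial>S)"
    using step[OF R2] by blast
qed

text \<open>Tilting by half the drift: a nonpositive partial sum at time \<open>n\<close> lifts the
  sum of \<open>Y = \<gamma> / 2 - X\<close> to at least \<open>n \<gamma> / 2\<close>. So the last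
  such time is at most \<open>2 / \<gamma>\<close> times the running maximum of a walk with negative
  drift, whose mean is bounded by second moments alone.\<close>

lemma sum_prob_nonpos_finite:
  fixes X :: "'a \<Rightarrow> real"
  assumes X: "integrable M X" and X2: "integrable M (\<lambda>x. (X x)\<^sup>2)" and pos: "0 < (\<integral>x. X x \<partial>M)"
  shows "(\<Sum>n. emeasure S {\<omega>\<in>space S. (\<Sum>k<n. X (\<omega> k)) \<le> 0}) < \<infinity>"
proof -
  define \<gamma> where "\<gamma> = (\<integral>x. X x \<partial>M)"
  define Y where "Y x = \<gamma> / 2 - X x" for x
  define v where "v = (\<integral>x. (Y x)\<^sup>2 \<partial>M)"
  have \<gamma>: "0 < \<gamma>" using pos by (simp add: \<gamma>_def)
  have [measurable]: "X \<in> borel_measurable M" using X by (rule borel_measurable_integrable)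
  have Y: "integrable M Y" and Y2: "integrable M (\<lambda>x. (Y x)\<^sup>2)"
    unfolding Y_def using X X2 by (simp_all add: power2_diff)
  have EY: "(\<integral>x. Y x \<partial>M) = - \<gamma> / 2"
    unfolding Y_def using X by (simp add: \<gamma>_def M.prob_space)
  note mom = running_max_moments[OF Y Y2]
  \<comment> \<open>With \<open>E[Y] = - \<gamma> / 2\<close> the moment inequality reads
    \<open>0 \<le> v - \<gamma> * E[R]\<close>, uniformly in \<open>n\<close>.\<close>
  have ER: "(\<integral>\<omega>. running_max Y n \<omega> \<partial>S) \<le> v / \<gamma>" for n
    using mom(3)[of n] \<gamma> by (simp add: EY v_def pos_le_divide_eq algebra_simps)
  define Z where "Z n = {\<omega>\<in>space S. (\<Sum>k<n. X (\<omega> k)) \<le> 0}" for n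
  have [measurable]: "Z n \<in> sets S" for n unfolding Z_def by measurable
  \<comment> \<open>The extra 1 counts time 0, whose empty sum always qualifies.\<close>
  have count: "(\<Sum>n<N. indicator (Z n) \<omega>) \<le> ennreal (1 + 2 / \<gamma> * running_max Y N \<omega>)" for N \<omega>
  proof -
    let ?R = "running_max Y N \<omega>"
    have "{n. n < N \<and> \<omega> \<in> Z n} \<subseteq> {..nat \<lfloor>2 / \<gamma> * ?R\<rfloor>}"
    proof
      fix n assume "n \<in> {n. n < N \<and> \<omega> \<in> Z n}"
      then have n: "n < N" "(\<Sum>k<n. X (\<omega> k)) \<le> 0" by (auto simp: Z_def)
      have "real n * \<gamma> / 2 \<le> (\<Sum>k<n. Y (\<omega> k))"
        using n(2) by (simp add: Y_def sum_subtractf)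
      also have "\<dots> \<le> ?R" using n(1) by (intro sum_le_running_max) simp
      finally have "real n \<le> 2 / \<gamma> * ?R" using \<gamma> by (simp add: field_simps)
      then show "n \<in> {..nat \<lfloor>2 / \<gamma> * ?R\<rfloor>}" by (simp add: le_nat_floor)
    qed
    then have "card {n. n < N \<and> \<omega> \<in> Z n} \<le> Suc (nat \<lfloor>2 / \<gamma> * ?R\<rfloor>)"
      using card_mono[OF finite_atMost] by fastforce
    moreover have "real (nat \<lfloor>2 / \<gamma> * ?R\<rfloor>) \<le> 2 / \<gamma> * ?R"
      using running_max_nonneg[of Y N \<omega>] \<gamma> by simp
    ultimately have "real (card {n. n < N \<and> \<omega> \<in> Z n}) \<le> 1 + 2 / \<gamma> * ?R" by linarith
    moreover have "(\<Sum>n<N. indicator (Z n) \<omega> :: ennreal) = of_nat (card {n. n < N \<and> \<omega> \<in> Z n})"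
    proof -
      have "(\<Sum>n<N. indicator (Z n) \<omega> :: ennreal) = (\<Sum>n\<in>{n. n < N \<and> \<omega> \<in> Z n}. 1)"
        by (rule sum.mono_neutral_cong_right) (auto simp: indicator_def)
      then show ?thesis by simp
    qed
    ultimately show ?thesis by (simp add: ennreal_of_nat_eq_real_of_nat ennreal_leI)
  qed
  have "(\<Sum>n. emeasure S (Z n)) \<le> ennreal (1 + 2 / \<gamma> * (v / \<gamma>))"
  proof (rule suminf_le_const)
    fix N
    have "(\<Sum>n<N. emeasure S (Z n)) = (\<integral>\<^sup>+\<omega>. (\<Sum>n<N. indicator (Z n) \<omega>) \<partial>S)"
      by (subst nn_integral_sum) auto
    also have "\<dots> \<le> (\<integral>\<^sup>+\<omega>. ennreal (1 + 2 / \<gamma> * running_max Y N \<omega>) \<partial>S)"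
      by (intro nn_integral_mono count)
    also have "\<dots> = ennreal (\<integral>\<omega>. 1 + 2 / \<gamma> * running_max Y N \<omega> \<partial>S)"
      using mom(2)[of N] \<gamma> running_max_nonneg[of Y N]
      by (intro nn_integral_eq_integral) auto
    also have "\<dots> = ennreal (1 + 2 / \<gamma> * (\<integral>\<omega>. running_max Y N \<omega> \<partial>S))"
      using mom(2)[of N] by (simp add: P.prob_space)
    also have "\<dots> \<le> ennreal (1 + 2 / \<gamma> * (v / \<gamma>))"
      using ER[of N] \<gamma> by (intro ennreal_leI add_left_mono mult_left_mono) auto
    finally show "(\<Sum>n<N. emeasure S (Z n)) \<le> ennreal (1 + 2 / \<gamma> * (v / \<gamma>))" .
  qed simp
  then show ?thesis unfolding Z_def by (rule order_le_less_trans) simp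
qed

end

section \<open>Change of measure and the lower bound\<close>

text \<open>Restricting to finitely many coordinates is essential, since the two infinite products
  may be mutually singular. Peeling off the first coordinate keeps the induction on sequence spaces:
  the section \<open>G (case_nat x \<omega>)\<close> looks at one coordinate less.\<close>

lemma nn_integral_PiM_density:
  fixes \<rho> :: "'a \<Rightarrow> real" and G :: "(nat \<Rightarrow> 'a) \<Rightarrow> ennreal"
  assumes M: "prob_space M" and N: "prob_space (density M (\<lambda>x. ennreal (\<rho> x)))"
    and \<rho>[measurable]: "\<rho> \<in> borel_measurable M" and \<rho>0: "\<And>x. 0 \<le> \<rho> x"
    and G: "G \<in> borel_measurable (PiM UNIV (\<lambda>_. M))" and det: "determined t G"
  shows "(\<integral>\<^sup>+\<omega>. G \<omega> \<partial>PiM UNIV (\<lambda>_. density M (\<lambda>x. ennreal (\<rho> x))))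
    = (\<integral>\<^sup>+\<omega>. G \<omega> * ennreal (\<Prod>k<t. \<rho> (\<omega> k)) \<partial>PiM UNIV (\<lambda>_. M))"
proof -
  interpret M: sequence_space M by (rule sequence_spaceI[OF M])
  let ?N = "density M (\<lambda>x. ennreal (\<rho> x))"
  interpret N: sequence_space ?N by (rule sequence_spaceI[OF N])
  have sets_N: "sets N.S = sets M.S"
    by (intro sets_PiM_cong) auto
  have meas_N: "borel_measurable N.S = (borel_measurable M.S :: ((nat \<Rightarrow> 'a) \<Rightarrow> ennreal) set)"
    by (rule measurable_cong_sets[OF sets_N refl])
  show ?thesis
    using G det
  proof (induction t arbitrary: G)
    case 0
    then have "G = (\<lambda>_. G undefined)" by (auto simp: determined_def)
    then obtain c where "G = (\<lambda>_. c)" by blast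
    then show ?case by (simp add: N.P.emeasure_space_1 M.P.emeasure_space_1)
  next
    case (Suc t)
    note [measurable] = Suc.prems(1)
    have "(\<integral>\<^sup>+\<omega>. G \<omega> \<partial>N.S) = (\<integral>\<^sup>+x. \<integral>\<^sup>+\<omega>. G (case_nat x \<omega>) \<partial>N.S \<partial>?N)"
      using Suc.prems(1) by (intro N.nn_integral_iter) (simp add: meas_N)
    also have "\<dots> = (\<integral>\<^sup>+x. (\<integral>\<^sup>+\<omega>. G (case_nat x \<omega>) * ennreal (\<Prod>k<t. \<rho> (\<omega> k)) \<partial>M.S) \<partial>?N)"
    proof (rule nn_integral_cong)
      fix x assume "x \<in> space ?N"
      then have x: "x \<in> space M" by simp
      show "(\<integral>\<^sup>+\<omega>. G (case_nat x \<omega>) \<partial>N.S) = (\<integral>\<^sup>+\<omega>. G (case_nat x \<omega>) * ennreal (\<Prod>k<t. \<rho> (\<omega> k)) \<partial>M.S)"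
      proof (rule Suc.IH)
        show "(\<lambda>\<omega>. G (case_nat x \<omega>)) \<in> borel_measurable M.S" using x by measurable
        show "determined t (\<lambda>\<omega>. G (case_nat x \<omega>))"
          unfolding determined_def
        proof (intro allI impI)
          fix \<omega> \<omega>' :: "nat \<Rightarrow> 'a" assume "\<forall>i<t. \<omega> i = \<omega>' i"
          then show "G (case_nat x \<omega>) = G (case_nat x \<omega>')"
            by (intro determinedD[OF Suc.prems(2)]) (auto split: nat.split)
        qed
      qed
    qed
    also have "\<dots> = (\<integral>\<^sup>+x. ennreal (\<rho> x) * (\<integral>\<^sup>+\<omega>. G (case_nat x \<omega>) * ennreal (\<Prod>k<t. \<rho> (\<omega> k)) \<partial>M.S) \<partial>M)"
      by (rule nn_integral_density) measurable
    also have "\<dots> = (\<integral>\<^sup>+x. (\<integral>\<^sup>+\<omega>. G (case_nat x \<omega>) * ennreal (\<Prod>k<Suc t. \<rho> (case_nat x \<omega> k)) \<partial>M.S) \<partial>M)"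
    proof (rule nn_integral_cong)
      fix x assume x: "x \<in> space M"
      have "ennreal (\<rho> x) * (\<integral>\<^sup>+\<omega>. G (case_nat x \<omega>) * ennreal (\<Prod>k<t. \<rho> (\<omega> k)) \<partial>M.S)
          = (\<integral>\<^sup>+\<omega>. ennreal (\<rho> x) * (G (case_nat x \<omega>) * ennreal (\<Prod>k<t. \<rho> (\<omega> k))) \<partial>M.S)"
        using x by (intro nn_integral_cmult[symmetric]) measurable
      also have "\<dots> = (\<integral>\<^sup>+\<omega>. G (case_nat x \<omega>) * ennreal (\<Prod>k<Suc t. \<rho> (case_nat x \<omega> k)) \<partial>M.S)"
        using \<rho>0 by (intro nn_integral_cong)
          (simp add: prod.lessThan_Suc_shift ennreal_mult prod_nonneg mult_ac del: prod.lessThan_Suc)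
      finally show "ennreal (\<rho> x) * (\<integral>\<^sup>+\<omega>. G (case_nat x \<omega>) * ennreal (\<Prod>k<t. \<rho> (\<omega> k)) \<partial>M.S)
          = (\<integral>\<^sup>+\<omega>. G (case_nat x \<omega>) * ennreal (\<Prod>k<Suc t. \<rho> (case_nat x \<omega> k)) \<partial>M.S)" .
    qed
    also have "\<dots> = (\<integral>\<^sup>+\<omega>. G \<omega> * ennreal (\<Prod>k<Suc t. \<rho> (\<omega> k)) \<partial>M.S)"
      by (rule M.nn_integral_iter[symmetric]) measurable
    finally show ?case .
  qed
qed

corollary emeasure_PiM_density:
  fixes \<rho> :: "'a \<Rightarrow> real"
  assumes M: "prob_space M" and N: "prob_space (density M (\<lambda>x. ennreal (\<rho> x)))"
    and \<rho>: "\<rho> \<in> borel_measurable M" "\<And>x. 0 \<le> \<rho> x"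
    and E: "E \<in> sets (PiM UNIV (\<lambda>_. M))" and det: "determined t (\<lambda>\<omega>. \<omega> \<in> E)"
  shows "emeasure (PiM UNIV (\<lambda>_. density M (\<lambda>x. ennreal (\<rho> x)))) E
    = (\<integral>\<^sup>+\<omega>. indicator E \<omega> * ennreal (\<Prod>k<t. \<rho> (\<omega> k)) \<partial>PiM UNIV (\<lambda>_. M))"
proof -
  have "sets (PiM (UNIV :: nat set) (\<lambda>_. density M (\<lambda>x. ennreal (\<rho> x)))) = sets (PiM UNIV (\<lambda>_. M))"
    by (intro sets_PiM_cong) auto
  then have "emeasure (PiM UNIV (\<lambda>_. density M (\<lambda>x. ennreal (\<rho> x)))) E
      = (\<integral>\<^sup>+\<omega>. indicator E \<omega> \<partial>PiM UNIV (\<lambda>_. density M (\<lambda>x. ennreal (\<rho> x))))"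
    using E by simp
  also have "\<dots> = (\<integral>\<^sup>+\<omega>. indicator E \<omega> * ennreal (\<Prod>k<t. \<rho> (\<omega> k)) \<partial>PiM UNIV (\<lambda>_. M))"
    using E by (intro nn_integral_PiM_density M N \<rho> determined_indicator det) simp
  finally show ?thesis .
qed

section \<open>Sequential tests as events on the product space\<close>

definition adapted_test :: "(nat \<Rightarrow> 'a) measure \<Rightarrow> ((nat \<Rightarrow> 'a) \<Rightarrow> enat) \<Rightarrow> ((nat \<Rightarrow> 'a) \<Rightarrow> bool) \<Rightarrow> bool" where
  "adapted_test P T d \<longleftrightarrow> (\<forall>t.
     {\<omega>. T \<omega> = enat t} \<in> sets P \<and> {\<omega>. T \<omega> = enat t \<and> d \<omega>} \<in> sets P \<and>
     determined t (\<lambda>\<omega>. T \<omega> = enat t) \<and> determined t (\<lambda>\<omega>. T \<omega> = enat t \<and> d \<omega>))"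

lemma adapted_testD:
  assumes "adapted_test P T d"
  shows "{\<omega>. T \<omega> = enat t} \<in> sets P" "{\<omega>. T \<omega> = enat t \<and> d \<omega>} \<in> sets P"
    "determined t (\<lambda>\<omega>. T \<omega> = enat t)" "determined t (\<lambda>\<omega>. T \<omega> = enat t \<and> d \<omega>)"
  using assms unfolding adapted_test_def by blast+

text \<open>All hypotheses share one product sigma-algebra, so a test checked once is usable under
  every \<open>P_j\<close>.\<close>

lemma adapted_test_cong_sets: "sets P = sets Q \<Longrightarrow> adapted_test P T d \<longleftrightarrow> adapted_test Q T d"
  unfolding adapted_test_def by simp

lemma adapted_test_not:
  assumes "adapted_test P T d"
  shows "adapted_test P T (\<lambda>\<omega>. \<not> d \<omega>)"
proof -
  note a = adapted_testD[OF assms]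
  have "{\<omega>. T \<omega> = enat t \<and> \<not> d \<omega>} = {\<omega>. T \<omega> = enat t} - {\<omega>. T \<omega> = enat t \<and> d \<omega>}" for t
    by auto
  then have "{\<omega>. T \<omega> = enat t \<and> \<not> d \<omega>} \<in> sets P" for t
    using a(1,2)[of t] by simp
  moreover have "determined t (\<lambda>\<omega>. T \<omega> = enat t \<and> \<not> d \<omega>)" for t
  proof -
    have "(\<lambda>\<omega>. T \<omega> = enat t \<and> \<not> d \<omega>) = (\<lambda>\<omega>. T \<omega> = enat t \<and> \<not> (T \<omega> = enat t \<and> d \<omega>))" by auto
    then show ?thesis using determined_comp2[OF a(3,4)[of t], of "\<lambda>x y. x \<and> \<not> y"] by simp
  qed
  ultimately show ?thesis using a unfolding adapted_test_def by blast
qed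

lemma adapted_test_survival:
  assumes "adapted_test P T d" and sp: "space P = UNIV"
  shows "{\<omega>. enat n < T \<omega>} \<in> sets P" "determined n (\<lambda>\<omega>. enat n < T \<omega>)"
    "decseq (\<lambda>n. {\<omega>. enat n < T \<omega>})"
proof -
  note a = adapted_testD[OF assms(1)]
  have iff: "enat n < T \<omega> \<longleftrightarrow> (\<forall>t\<le>n. T \<omega> \<noteq> enat t)" for \<omega>
  proof (cases "T \<omega>")
    case (enat m)
    have "n < m \<longleftrightarrow> (\<forall>t\<le>n. m \<noteq> t)" by (metis not_le)
    with enat show ?thesis by simp
  qed simp
  have "{\<omega>. enat n < T \<omega>} = space P - (\<Union>t\<le>n. {\<omega>. T \<omega> = enat t})"
    by (auto simp: iff sp)
  then show "{\<omega>. enat n < T \<omega>} \<in> sets P" using a(1) by auto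
  have "determined n (\<lambda>\<omega>. T \<omega> = enat t)" if "t \<le> n" for t
    by (rule determined_mono[OF a(3) that])
  then show "determined n (\<lambda>\<omega>. enat n < T \<omega>)"
    unfolding iff determined_def by metis
  show "decseq (\<lambda>n. {\<omega>. enat n < T \<omega>})"
    by (auto simp: decseq_def) (meson enat_ord_simps(1) order_le_less_trans)
qed

lemma emeasure_decided:
  assumes "adapted_test P T d"
  shows "{\<omega>. T \<omega> \<noteq> \<infinity> \<and> d \<omega>} \<in> sets P"
    and "emeasure P {\<omega>. T \<omega> \<noteq> \<infinity> \<and> d \<omega>} = (\<Sum>t. emeasure P {\<omega>. T \<omega> = enat t \<and> d \<omega>})"
proof -
  have eq: "{\<omega>. T \<omega> \<noteq> \<infinity> \<and> d \<omega>} = (\<Union>t. {\<omega>. T \<omega> = enat t \<and> d \<omega>})" by auto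
  have "range (\<lambda>t. {\<omega>. T \<omega> = enat t \<and> d \<omega>}) \<subseteq> sets P" using adapted_testD(2)[OF assms] by blast
  then show "{\<omega>. T \<omega> \<noteq> \<infinity> \<and> d \<omega>} \<in> sets P"
    "emeasure P {\<omega>. T \<omega> \<noteq> \<infinity> \<and> d \<omega>} = (\<Sum>t. emeasure P {\<omega>. T \<omega> = enat t \<and> d \<omega>})"
    unfolding eq by (auto intro!: suminf_emeasure[symmetric] simp: disjoint_family_on_def)
qed

text \<open>The tail sum is the form to which the survival bounds apply; it also diverges, as it
  should, when \<open>T = \<infinity>\<close> has positive probability.\<close>

lemma ESS_eq_suminf:
  assumes "adapted_test P T d" and sp: "space P = UNIV"
  shows "ESS P T = (\<Sum>n. emeasure P {\<omega>. enat n < T \<omega>})"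
proof -
  have "T \<in> measurable P (count_space UNIV)"
  proof (subst measurable_count_space_eq2_countable, safe)
    fix s :: enat
    show "T -` {s} \<inter> space P \<in> sets P"
    proof (cases s)
      case (enat t)
      then show ?thesis using adapted_testD(1)[OF assms(1), of t] sp by (simp add: vimage_def)
    next
      case infinity
      have "T -` {s} \<inter> space P = space P - (\<Union>t. {\<omega>. T \<omega> = enat t})"
        unfolding infinity by (auto simp: sp)
      then show ?thesis using adapted_testD(1)[OF assms(1)] by auto
    qed
  qed auto
  from nn_integral_enat_function[OF this] show ?thesis by (simp add: ESS_def sp)
qed

text \<open>\<open>M\<close> is the true law and \<open>I\<close> its relative entropy with respect
  to the other one. Optional stopping at \<open>T\<close> itself is avoided: the walk is stopped at
  \<open>min T n\<close>, the exponential inequality is integrated over \<open>D1\<close>,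
  \<open>D0\<close> and the paths still running, and \<open>n\<close> tends to infinity afterwards.
  If \<open>ESS\<close> is infinite nothing is to be shown.\<close>

lemma expected_time_lower_bound:
  fixes \<rho> :: "'a \<Rightarrow> real"
  assumes M: "prob_space M" and N: "prob_space (density M (\<lambda>x. ennreal (\<rho> x)))"
    and sp: "space M = UNIV"
    and \<rho>[measurable]: "\<rho> \<in> borel_measurable M" and \<rho>0: "\<And>x. 0 \<le> \<rho> x"
    and \<rho>pos: "AE x in M. 0 < \<rho> x"
    and z: "integrable M (\<lambda>x. - ln (\<rho> x))" and I: "I = (\<integral>x. - ln (\<rho> x) \<partial>M)" "0 < I"
    and T: "adapted_test (PiM UNIV (\<lambda>_. M)) T d"
    and \<alpha>: "0 < \<alpha>" "\<alpha> < 1"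
    and err1: "measure (PiM UNIV (\<lambda>_. density M (\<lambda>x. ennreal (\<rho> x)))) {\<omega>. T \<omega> \<noteq> \<infinity> \<and> d \<omega>} \<le> \<alpha>"
    and err2: "measure (PiM UNIV (\<lambda>_. M)) {\<omega>. T \<omega> \<noteq> \<infinity> \<and> \<not> d \<omega>} \<le> \<beta>"
  shows "ennreal (((1 - \<beta>) * ln (1 / \<alpha>) - 2) / I) \<le> ESS (PiM UNIV (\<lambda>_. M)) T"
proof (cases "ESS (PiM UNIV (\<lambda>_. M)) T = \<infinity>")
  case finite: False
  interpret M: sequence_space M by (rule sequence_spaceI[OF M])
  let ?N = "density M (\<lambda>x. ennreal (\<rho> x))"
  interpret N: sequence_space ?N by (rule sequence_spaceI[OF N])
  have sets_N: "sets N.S = sets M.S" by (intro sets_PiM_cong) auto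
  have spS: "space M.S = UNIV" using sp by (auto simp: space_PiM)
  have spN: "space N.S = UNIV" using sp by (auto simp: space_PiM)
  define L where "L = ln (1 / \<alpha>)"
  have L: "0 < L" "exp L = 1 / \<alpha>" using \<alpha> by (simp_all add: L_def)
  define D1 where "D1 t = {\<omega>. T \<omega> = enat t \<and> d \<omega>}" for t
  define D0 where "D0 t = {\<omega>. T \<omega> = enat t \<and> \<not> d \<omega>}" for t
  define W where "W n = {\<omega>. enat n < T \<omega>}" for n
  define R where "R t \<omega> = (\<Prod>k<t. \<rho> (\<omega> k))" for t and \<omega> :: "nat \<Rightarrow> 'a"
  define p where "p E = measure M.S E" for E
  define q where "q E = measure N.S E" for E
  note a1 = adapted_testD[OF T] and a0 = adapted_testD[OF adapted_test_not[OF T]]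
  note aW = adapted_test_survival[OF T spS]
  have D1[measurable]: "D1 t \<in> sets M.S" and D1': "determined t (\<lambda>\<omega>. \<omega> \<in> D1 t)" for t
    using a1(2,4) by (simp_all add: D1_def)
  have D0[measurable]: "D0 t \<in> sets M.S" and D0': "determined t (\<lambda>\<omega>. \<omega> \<in> D0 t)" for t
    using a0(2,4) by (simp_all add: D0_def)
  have W[measurable]: "W n \<in> sets M.S" and W': "determined n (\<lambda>\<omega>. \<omega> \<in> W n)" for n
    using aW by (simp_all add: W_def)
  have [measurable]: "R t \<in> borel_measurable M.S" for t unfolding R_def by measurable
  have R0: "0 \<le> R t \<omega>" for t \<omega> unfolding R_def using \<rho>0 by (intro prod_nonneg) auto
  have R_int: "integrable M.S (\<lambda>\<omega>. indicator E \<omega> * R t \<omega>)" (is ?i)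
    and R_eq: "(\<integral>\<omega>. indicator E \<omega> * R t \<omega> \<partial>M.S) = q E" (is ?e)
    if [measurable]: "E \<in> sets M.S" and "determined t (\<lambda>\<omega>. \<omega> \<in> E)" for t E
  proof -
    have eq: "(\<integral>\<^sup>+\<omega>. ennreal (indicator E \<omega> * R t \<omega>) \<partial>M.S) = ennreal (q E)"
      using emeasure_PiM_density[OF M N \<rho> \<rho>0 that]
      by (simp add: q_def N.P.emeasure_eq_measure R_def indicator_mult_ennreal mult.commute
          ennreal_indicator[symmetric] ennreal_mult' del: ennreal_indicator)
    show ?i
      by (rule integrableI_bounded) (measurable, simp add: R0 eq)
    show ?e
      by (subst integral_eq_nn_integral) (measurable, simp_all add: R0 eq q_def)
  qed
  have ind_int: "integrable M.S (indicator E :: _ \<Rightarrow> real)" if "E \<in> sets M.S" for E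
    using that by (simp add: M.P.emeasure_eq_measure)
  \<comment> \<open>A pointwise lower bound for the stopped walk: \<open>c = 1 / \<alpha>\<close> is
    used on \<open>D1\<close>, and \<open>c = 1\<close>, with its constant 1 dropped, on
    \<open>D0\<close> and on the paths still running.\<close>
  define Q where "Q n \<omega> = (\<Sum>t\<le>n. (1 + L) * indicator (D1 t) \<omega> - (1 / \<alpha>) * (indicator (D1 t) \<omega> * R t \<omega>)
      - indicator (D0 t) \<omega> * R t \<omega>) - indicator (W n) \<omega> * R n \<omega>" for n \<omega>
  have Q_int: "integrable M.S (Q n)" for n
    unfolding Q_def[abs_def]
    by (intro Bochner_Integration.integrable_sum Bochner_Integration.integrable_diff
        integrable_mult_right R_int ind_int D1 D0 W D1' D0' W')
  have p_cup: "(\<Sum>t\<le>n. p (D1 t)) = p (\<Union>t\<le>n. D1 t)" for n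
    unfolding p_def by (subst M.P.finite_measure_finite_Union) (auto simp: disjoint_family_on_def D1_def[symmetric], auto simp: D1_def)
  have q_cup: "(\<Sum>t\<le>n. q (D1 t)) \<le> \<alpha>" for n
  proof -
    have "(\<Sum>t\<le>n. q (D1 t)) = q (\<Union>t\<le>n. D1 t)"
      unfolding q_def by (subst N.P.finite_measure_finite_Union) (use D1 sets_N in \<open>auto simp: disjoint_family_on_def D1_def\<close>)
    also have "\<dots> \<le> q {\<omega>. T \<omega> \<noteq> \<infinity> \<and> d \<omega>}"
      unfolding q_def using emeasure_decided(1)[OF T] sets_N
      by (intro N.P.finite_measure_mono) (auto simp: D1_def)
    finally show ?thesis using err1 by (simp add: q_def)
  qed
  have q_rest: "(\<Sum>t\<le>n. q (D0 t)) + q (W n) \<le> 1" for n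
  proof -
    have "(\<Sum>t\<le>n. q (D0 t)) = q (\<Union>t\<le>n. D0 t)"
      unfolding q_def by (subst N.P.finite_measure_finite_Union) (use D0 sets_N in \<open>auto simp: disjoint_family_on_def D0_def\<close>)
    also have "\<dots> + q (W n) = q ((\<Union>t\<le>n. D0 t) \<union> W n)"
      unfolding q_def
      by (subst N.P.finite_measure_Union) (use D0 W sets_N in \<open>auto simp: D0_def W_def\<close>)
    also have "\<dots> \<le> 1" unfolding q_def by (rule N.P.prob_le_1)
    finally show ?thesis .
  qed
  \<comment> \<open>The loss of 2: under \<open>q\<close> the sets \<open>D1 t\<close> have mass at
    most \<open>\<alpha>\<close>, hence 1 after division by \<open>\<alpha>\<close>, and the
    remaining regions together have mass at most 1.\<close>
  have EQ: "L * p (\<Union>t\<le>n. D1 t) - 2 \<le> (\<integral>\<omega>. Q n \<omega> \<partial>M.S)" for n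
  proof -
    have "(\<integral>\<omega>. Q n \<omega> \<partial>M.S) = (\<Sum>t\<le>n. (1 + L) * p (D1 t) - (1 / \<alpha>) * q (D1 t) - q (D0 t)) - q (W n)"
      unfolding Q_def p_def
      using R_int[OF D1 D1'] R_int[OF D0 D0'] R_int[OF W W'] ind_int[OF D1]
      by (simp add: R_eq[OF D1 D1'] R_eq[OF D0 D0'] R_eq[OF W W'])
    also have "\<dots> = (1 + L) * p (\<Union>t\<le>n. D1 t) - (1 / \<alpha>) * (\<Sum>t\<le>n. q (D1 t)) - ((\<Sum>t\<le>n. q (D0 t)) + q (W n))"
      by (simp add: sum_subtractf sum_distrib_left[symmetric] sum_divide_distrib[symmetric] p_cup)
    also have "\<dots> \<ge> (1 + L) * p (\<Union>t\<le>n. D1 t) - 1 - 1"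
    proof -
      have "(1 / \<alpha>) * (\<Sum>t\<le>n. q (D1 t)) \<le> 1"
        using q_cup[of n] \<alpha> by (simp add: pos_divide_le_eq)
      then show ?thesis using q_rest[of n] by linarith
    qed
    also have "(1 + L) * p (\<Union>t\<le>n. D1 t) - 1 - 1 \<ge> L * p (\<Union>t\<le>n. D1 t) - 2"
      by (simp add: algebra_simps p_def)
    finally show ?thesis .
  qed
  \<comment> \<open>The walk stopped at \<open>min T n\<close>, written with the indicators of
    \<open>T > m\<close>, which are decided before increment \<open>m\<close>; its mean follows term
    by term.\<close>
  define \<tau> where "\<tau> n \<omega> = (\<Sum>m<n. indicator (W m) \<omega> * (- ln (\<rho> (\<omega> m))))" for n \<omega>
  have \<tau>_int: "integrable M.S (\<tau> n)" for n
    unfolding \<tau>_def[abs_def]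
    by (intro Bochner_Integration.integrable_sum M.integral_past_next(1) W W' z)
  have E\<tau>: "(\<integral>\<omega>. \<tau> n \<omega> \<partial>M.S) = I * (\<Sum>m<n. p (W m))" for n
  proof -
    have "(\<integral>\<omega>. \<tau> n \<omega> \<partial>M.S) = (\<Sum>m<n. \<integral>\<omega>. indicator (W m) \<omega> * (- ln (\<rho> (\<omega> m))) \<partial>M.S)"
      unfolding \<tau>_def by (intro Bochner_Integration.integral_sum M.integral_past_next(1) W W' z)
    also have "\<dots> = (\<Sum>m<n. p (W m) * I)"
      by (simp only: M.integral_past_next(2)[OF W W' z] p_def I(1))
    also have "\<dots> = I * (\<Sum>m<n. p (W m))"
      unfolding sum_distrib_left by (intro sum.cong refl mult.commute)
    finally show ?thesis .
  qed
  have AEpos: "AE \<omega> in M.S. \<forall>k. 0 < \<rho> (\<omega> k)"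
    unfolding AE_all_countable
    by (intro allI AE_PiM_component M.M.prob_space_axioms \<rho>pos) simp_all
  have point: "Q n \<omega> \<le> \<tau> n \<omega>" if pos: "\<forall>k. 0 < \<rho> (\<omega> k)" for n \<omega>
  proof -
    have R_exp: "R t \<omega> = exp (- (\<Sum>k<t. - ln (\<rho> (\<omega> k))))" for t
      using pos by (simp add: R_def sum_negf exp_sum)
    have ineq: "1 + L - (1 / \<alpha>) * R t \<omega> \<le> (\<Sum>k<t. - ln (\<rho> (\<omega> k)))" for t
    proof -
      have "(1 / \<alpha>) * R t \<omega> = exp (L - (\<Sum>k<t. - ln (\<rho> (\<omega> k))))"
        by (simp only: R_exp L(2)[symmetric] mult_exp_exp) simp
      then show ?thesis
        using exp_ge_add_one_self[of "L - (\<Sum>k<t. - ln (\<rho> (\<omega> k)))"] by linarith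
    qed
    have ineq1: "- R t \<omega> \<le> (\<Sum>k<t. - ln (\<rho> (\<omega> k)))" for t
      using exp_ge_add_one_self[of "- (\<Sum>k<t. - ln (\<rho> (\<omega> k)))"] by (simp add: R_exp)
    show ?thesis
    proof (cases "enat n < T \<omega>")
      case True
      then have D: "\<omega> \<notin> D1 t" "\<omega> \<notin> D0 t" if "t \<le> n" for t using that by (auto simp: D1_def D0_def)
      have "\<omega> \<in> W m" if "m < n" for m
        using True that by (auto simp: W_def intro: less_trans[of "enat m" "enat n"])
      then have "\<tau> n \<omega> = (\<Sum>k<n. - ln (\<rho> (\<omega> k)))" by (simp add: \<tau>_def)
      moreover have "Q n \<omega> = - R n \<omega>"
        unfolding Q_def using True D by (simp add: W_def)
      ultimately show ?thesis using ineq1[of n] by simp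
    next
      case False
      then obtain s where s: "T \<omega> = enat s" "s \<le> n" by (cases "T \<omega>") auto
      have "\<tau> n \<omega> = (\<Sum>k<s. - ln (\<rho> (\<omega> k)))"
        unfolding \<tau>_def using s by (intro sum.mono_neutral_cong_right) (auto simp: W_def)
      moreover have "Q n \<omega> = (\<Sum>t\<in>{s}. (1 + L) * indicator (D1 t) \<omega> - (1 / \<alpha>) * (indicator (D1 t) \<omega> * R t \<omega>)
          - indicator (D0 t) \<omega> * R t \<omega>)"
      proof -
        have "\<omega> \<notin> W n" using False by (simp add: W_def)
        then have "Q n \<omega> = (\<Sum>t\<le>n. (1 + L) * indicator (D1 t) \<omega> - (1 / \<alpha>) * (indicator (D1 t) \<omega> * R t \<omega>)
          - indicator (D0 t) \<omega> * R t \<omega>)"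
          by (simp add: Q_def)
        also have "\<dots> = (\<Sum>t\<in>{s}. (1 + L) * indicator (D1 t) \<omega> - (1 / \<alpha>) * (indicator (D1 t) \<omega> * R t \<omega>)
          - indicator (D0 t) \<omega> * R t \<omega>)"
          by (rule sum.mono_neutral_right) (use s in \<open>auto simp: D1_def D0_def\<close>)
        finally show ?thesis .
      qed
      ultimately show ?thesis
        using ineq[of s] ineq1[of s] s by (cases "d \<omega>") (auto simp: D1_def D0_def)
    qed
  qed
  have main: "L * p (\<Union>t\<le>n. D1 t) - 2 \<le> I * (\<Sum>m<n. p (W m))" for n
  proof -
    have "(\<integral>\<omega>. Q n \<omega> \<partial>M.S) \<le> (\<integral>\<omega>. \<tau> n \<omega> \<partial>M.S)"
      using AEpos by (intro integral_mono_AE Q_int \<tau>_int) (auto elim!: eventually_mono intro: point)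
    then show ?thesis using EQ[of n] E\<tau>[of n] by linarith
  qed
  define e where "e = enn2real (ESS M.S T)"
  have ESS: "ESS M.S T = ennreal e" using finite by (simp add: e_def less_top)
  have e0: "0 \<le> e" by (simp add: e_def)
  have W_sum: "(\<Sum>m<n. p (W m)) \<le> e" for n
  proof -
    have "ennreal (\<Sum>m<n. p (W m)) = (\<Sum>m<n. emeasure M.S (W m))"
      by (simp add: p_def M.P.emeasure_eq_measure sum_nonneg)
    also have "\<dots> \<le> (\<Sum>m. emeasure M.S (W m))" by (intro sum_le_suminf) auto
    also have "\<dots> = ennreal e" using ESS_eq_suminf[OF T spS] by (simp add: W_def ESS)
    finally show ?thesis using e0 by simp
  qed
  have "(\<lambda>n. p (\<Union>t\<le>n. D1 t)) \<longlonglongrightarrow> p (\<Union>n. \<Union>t\<le>n. D1 t)"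
    unfolding p_def by (intro M.P.finite_Lim_measure_incseq) (auto simp: incseq_def intro: order_trans)
  moreover have U: "(\<Union>n. \<Union>t\<le>n. D1 t) = {\<omega>. T \<omega> \<noteq> \<infinity> \<and> d \<omega>}" by (auto simp: D1_def)
  ultimately have "(\<lambda>n. L * p (\<Union>t\<le>n. D1 t) - 2) \<longlonglongrightarrow> L * p {\<omega>. T \<omega> \<noteq> \<infinity> \<and> d \<omega>} - 2"
    by (intro tendsto_intros) simp
  moreover have "\<forall>n\<ge>0. L * p (\<Union>t\<le>n. D1 t) - 2 \<le> I * e"
    using main W_sum I(2) by (meson mult_left_mono less_imp_le order_trans)
  ultimately have bound: "L * p {\<omega>. T \<omega> \<noteq> \<infinity> \<and> d \<omega>} - 2 \<le> I * e"
    by (rule LIMSEQ_le_const2[OF _ exI])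
  \<comment> \<open>Only an infinite \<open>T\<close> escapes both decisions, and a finite expected
    sample size makes that event null.\<close>
  have "1 - \<beta> \<le> p {\<omega>. T \<omega> \<noteq> \<infinity> \<and> d \<omega>}"
  proof -
    have Inf: "{\<omega>. T \<omega> = \<infinity>} = (\<Inter>n. W n)"
    proof -
      have "x = \<infinity>" if "\<forall>n. enat n < x" for x using that by (cases x) auto
      then show ?thesis by (auto simp: W_def)
    qed
    have Inf_sets: "{\<omega>. T \<omega> = \<infinity>} \<in> sets M.S" unfolding Inf by measurable
    have "p {\<omega>. T \<omega> = \<infinity>} = 0"
    proof (rule ccontr)
      assume "p {\<omega>. T \<omega> = \<infinity>} \<noteq> 0"
      then have pp: "0 < p {\<omega>. T \<omega> = \<infinity>}" unfolding p_def by (simp add: zero_less_measure_iff)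
      have "real n * p {\<omega>. T \<omega> = \<infinity>} \<le> e" for n
      proof -
        have "real n * p {\<omega>. T \<omega> = \<infinity>} = (\<Sum>m<n. p {\<omega>. T \<omega> = \<infinity>})" by simp
        also have "\<dots> \<le> (\<Sum>m<n. p (W m))"
          unfolding p_def by (intro sum_mono M.P.finite_measure_mono) (auto simp: Inf)
        finally show ?thesis using W_sum[of n] by simp
      qed
      then show False using reals_Archimedean3[OF pp] by (meson not_le)
    qed
    moreover have "1 = p ({\<omega>. T \<omega> \<noteq> \<infinity> \<and> d \<omega>} \<union> ({\<omega>. T \<omega> \<noteq> \<infinity> \<and> \<not> d \<omega>} \<union> {\<omega>. T \<omega> = \<infinity>}))"
    proof -
      have "{\<omega>. T \<omega> \<noteq> \<infinity> \<and> d \<omega>} \<union> ({\<omega>. T \<omega> \<noteq> \<infinity> \<and> \<not> d \<omega>} \<union> {\<omega>. T \<omega> = \<infinity>}) = space M.S"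
        by (auto simp: spS)
      then show ?thesis by (simp only: p_def M.P.prob_space)
    qed
    moreover have "\<dots> \<le> p {\<omega>. T \<omega> \<noteq> \<infinity> \<and> d \<omega>} + (p {\<omega>. T \<omega> \<noteq> \<infinity> \<and> \<not> d \<omega>} + p {\<omega>. T \<omega> = \<infinity>})"
      unfolding p_def
      using emeasure_decided(1)[OF T] emeasure_decided(1)[OF adapted_test_not[OF T]] Inf_sets
      by (intro order_trans[OF measure_Un_le] add_left_mono measure_Un_le) auto
    ultimately show ?thesis using err2 by (simp add: p_def)
  qed
  then have "L * (1 - \<beta>) \<le> L * p {\<omega>. T \<omega> \<noteq> \<infinity> \<and> d \<omega>}"
    using L(1) by (intro mult_left_mono) auto
  with bound have "(1 - \<beta>) * L - 2 \<le> I * e"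
    by (subst mult.commute) linarith
  then have "((1 - \<beta>) * L - 2) / I \<le> e"
    using I(2) by (simp add: pos_divide_le_eq mult.commute)
  then show ?thesis unfolding ESS L_def by (rule ennreal_leI)
qed simp

section \<open>Likelihood ratios\<close>

text \<open>A set of the natural filtration is a preimage under restriction to
  \<open>{..<t}\<close>, hence blind to later coordinates.\<close>

lemma obsF_determined:
  assumes "A \<in> sets (obsF t)"
  shows "A \<in> sets (PiM UNIV (\<lambda>_. borel))" "determined t (\<lambda>\<omega>. \<omega> \<in> A)"
proof -
  have "(\<lambda>\<omega>. restrict \<omega> {..<t}) \<in> UNIV \<rightarrow> space (PiM {..<t} (\<lambda>_. borel :: 'a measure))"
    by (auto simp: space_PiM)
  from sets_vimage_algebra2[OF this] assms
  obtain B where B: "B \<in> sets (PiM {..<t} (\<lambda>_. borel :: 'a measure))"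
    and A: "A = (\<lambda>\<omega>. restrict \<omega> {..<t}) -` B \<inter> UNIV"
    unfolding obsF_def by auto
  have "(\<lambda>\<omega>. restrict \<omega> {..<t}) \<in> PiM UNIV (\<lambda>_. borel :: 'a measure) \<rightarrow>\<^sub>M PiM {..<t} (\<lambda>_. borel)"
    by (rule measurable_restrict_subset) simp
  from measurable_sets[OF this B] show "A \<in> sets (PiM UNIV (\<lambda>_. borel))"
    by (simp add: A space_PiM)
  have "restrict \<omega> {..<t} = restrict \<omega>' {..<t}" if "\<forall>i<t. \<omega> i = \<omega>' i" for \<omega> \<omega>' :: "nat \<Rightarrow> 'a"
    using that by (auto simp: restrict_def)
  then show "determined t (\<lambda>\<omega>. \<omega> \<in> A)"
    unfolding A determined_def by (metis Int_UNIV_right vimage_eq)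
qed

lemma is_seq_test_adapted:
  "is_seq_test T d \<Longrightarrow> adapted_test (PiM UNIV (\<lambda>_. borel)) T d"
  using obsF_determined[of "{\<omega>. T \<omega> = enat t}" t for t] obsF_determined[of "{\<omega>. T \<omega> = enat t \<and> d \<omega>}" t for t]
  unfolding is_seq_test_def adapted_test_def by simp

text \<open>Integrate \<open>\<rho> - 1 - ln \<rho> \<ge> 0\<close>: as \<open>\<rho>\<close> has
  mean 1, the integral is the entropy, and it vanishes only if \<open>\<rho> = 1\<close> almost
  everywhere.\<close>

lemma relative_entropy_pos:
  fixes \<rho> :: "'a \<Rightarrow> real"
  assumes M: "prob_space M" and N: "prob_space (density M (\<lambda>x. ennreal (\<rho> x)))"
    and \<rho>[measurable]: "\<rho> \<in> borel_measurable M" and \<rho>0: "\<And>x. 0 \<le> \<rho> x"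
    and \<rho>pos: "AE x in M. 0 < \<rho> x" and z: "integrable M (\<lambda>x. - ln (\<rho> x))"
    and ne: "\<not> (AE x in M. \<rho> x = 1)"
  shows "0 < (\<integral>x. - ln (\<rho> x) \<partial>M)"
proof (rule ccontr)
  interpret M: prob_space M by fact
  interpret N: prob_space "density M (\<lambda>x. ennreal (\<rho> x))" by fact
  assume "\<not> ?thesis"
  have one: "(\<integral>\<^sup>+x. ennreal (\<rho> x) \<partial>M) = 1"
    using N.emeasure_space_1 by (subst (asm) emeasure_density) (auto cong: nn_integral_cong)
  have \<rho>_int: "integrable M \<rho>"
    by (rule integrableI_bounded) (use one \<rho>0 in simp_all)
  have \<rho>_eq: "(\<integral>x. \<rho> x \<partial>M) = 1"
    by (subst integral_eq_nn_integral) (use one \<rho>0 in simp_all)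
  let ?g = "\<lambda>x. \<rho> x - 1 + - ln (\<rho> x)"
  have g: "integrable M ?g" using \<rho>_int z by (intro Bochner_Integration.integrable_add) simp_all
  have g0: "AE x in M. 0 \<le> ?g x"
    using \<rho>pos by eventually_elim (use ln_le_minus_one in force)
  have "(\<integral>x. ?g x \<partial>M) = (\<integral>x. - ln (\<rho> x) \<partial>M)"
    by (subst Bochner_Integration.integral_add) (use \<rho>_int z \<rho>_eq M.prob_space in simp_all)
  with \<open>\<not> ?thesis\<close> integral_nonneg_AE[OF g0] have "(\<integral>x. ?g x \<partial>M) = 0" by simp
  then have "AE x in M. ?g x = 0"
    using integral_nonneg_eq_0_iff_AE[OF g g0] by simp
  with \<rho>pos have "AE x in M. \<rho> x = 1"
    by eventually_elim (simp add: ln_eq_minus_one)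
  with ne show False by simp
qed

section \<open>The statistical model and its likelihood ratios\<close>

locale lr_model =
  fixes \<nu> :: "'a::euclidean_space measure" and f :: "nat \<Rightarrow> 'a \<Rightarrow> real" and K :: nat
    and q0 q1 :: "nat \<Rightarrow> real"
  assumes sets_nu: "sets \<nu> = sets borel"
    and K_pos: "K \<ge> 1"
    and f_meas: "\<And>j. j \<le> K \<Longrightarrow> f j \<in> borel_measurable borel"
    and f_nonneg: "\<And>j x. j \<le> K \<Longrightarrow> f j x \<ge> 0"
    and f_dens: "\<And>j. j \<le> K \<Longrightarrow> (\<integral>\<^sup>+ x. ennreal (f j x) \<partial>\<nu>) = 1"
    and f_support: "\<And>j. j \<le> K \<Longrightarrow> {x. f j x > 0} = {x. f 0 x > 0}"
    and nonarith0: "\<And>i. i \<in> {1..K} \<Longrightarrow> non_arithmetic (P1 \<nu> f 0) (llr f i)"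
    and nonarith1: "\<And>i. i \<in> {1..K} \<Longrightarrow> non_arithmetic (P1 \<nu> f i) (llr f i)"
    and I_fin: "\<And>i. i \<in> {1..K} \<Longrightarrow> integrable (P1 \<nu> f i) (llr f i)"
    and I0_fin: "\<And>i. i \<in> {1..K} \<Longrightarrow> integrable (P1 \<nu> f 0) (llr f i)"
    and q0_pos: "\<And>i. i \<in> {1..K} \<Longrightarrow> q0 i > 0"
    and q1_pos: "\<And>i. i \<in> {1..K} \<Longrightarrow> q1 i > 0"
    and A1_i: "\<And>i. i \<in> {1..K} \<Longrightarrow> integrable (P1 \<nu> f i) (\<lambda>x. (llr f i x)\<^sup>2)"
    and A1_0: "\<And>i. i \<in> {1..K} \<Longrightarrow> integrable (P1 \<nu> f 0) (\<lambda>x. (llr f i x)\<^sup>2)"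
begin

lemma sets_P1: "sets (P1 \<nu> f j) = sets borel"
  by (simp add: P1_def sets_nu)

lemma space_P1: "space (P1 \<nu> f j) = UNIV"
  using sets_eq_imp_space_eq[OF sets_P1] by simp

lemma f_meas_P1: "j \<le> K \<Longrightarrow> f j \<in> borel_measurable (P1 \<nu> f k)"
  using f_meas measurable_cong_sets[OF sets_P1 refl] by blast

lemma f_meas_nu: "j \<le> K \<Longrightarrow> f j \<in> borel_measurable \<nu>"
  using f_meas measurable_cong_sets[OF sets_nu refl] by blast

lemma prob_P1: assumes "j \<le> K" shows "prob_space (P1 \<nu> f j)"
proof (rule prob_spaceI)
  show "emeasure (P1 \<nu> f j) (space (P1 \<nu> f j)) = 1"
    unfolding P1_def using f_meas_nu[OF assms] f_dens[OF assms]
    by (subst emeasure_density) (auto cong: nn_integral_cong)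
qed

lemma Pj_eq: "Pj \<nu> f j = PiM UNIV (\<lambda>_. P1 \<nu> f j)"
  by (simp add: Pj_def P1_def)

lemma sets_Pj: "sets (Pj \<nu> f j) = sets (PiM UNIV (\<lambda>_. borel))"
  unfolding Pj_eq by (intro sets_PiM_cong sets_P1 refl)

lemma space_Pj: "space (Pj \<nu> f j) = UNIV"
  by (auto simp: Pj_eq space_PiM space_P1)

lemma prob_Pj: assumes "j \<le> K" shows "prob_space (Pj \<nu> f j)"
  unfolding Pj_eq using prob_P1[OF assms] by (intro prob_space_PiM)

lemma seq_P1: "j \<le> K \<Longrightarrow> sequence_space (P1 \<nu> f j)"
  by (intro sequence_spaceI prob_P1)

lemma support_iff: "j \<le> K \<Longrightarrow> k \<le> K \<Longrightarrow> 0 < f j x \<longleftrightarrow> 0 < f k x"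
  using f_support by blast

lemma support_zero_iff: "j \<le> K \<Longrightarrow> k \<le> K \<Longrightarrow> f j x = 0 \<longleftrightarrow> f k x = 0"
  using support_iff[of j k x] f_nonneg[of j x] f_nonneg[of k x] by linarith

lemma ratio_meas: "j \<le> K \<Longrightarrow> k \<le> K \<Longrightarrow> (\<lambda>x. f k x / f j x) \<in> borel_measurable (P1 \<nu> f l)"
  using f_meas_P1 by (intro borel_measurable_divide)

text \<open>The common support makes \<open>f j * (f k / f j) = f k\<close> true at every point,
  also where the quotient divides by 0.\<close>

lemma density_ratio:
  assumes "j \<le> K" "k \<le> K"
  shows "density (P1 \<nu> f j) (\<lambda>x. ennreal (f k x / f j x)) = P1 \<nu> f k"
proof -
  have "density (P1 \<nu> f j) (\<lambda>x. ennreal (f k x / f j x))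
      = density \<nu> (\<lambda>x. ennreal (f j x) * ennreal (f k x / f j x))"
    unfolding P1_def using assms f_meas_nu by (intro density_density_eq) simp_all
  also have "\<dots> = P1 \<nu> f k"
    unfolding P1_def
  proof (rule arg_cong[of _ _ "density \<nu>"], rule ext)
    fix x
    show "ennreal (f j x) * ennreal (f k x / f j x) = ennreal (f k x)"
      using support_zero_iff[OF assms, of x] f_nonneg[OF assms(1), of x]
      by (cases "f j x = 0") (simp_all add: ennreal_mult'[symmetric])
  qed
  finally show ?thesis .
qed

lemma AE_pos: assumes "j \<le> K" shows "AE x in P1 \<nu> f j. \<forall>k\<le>K. 0 < f k x"
  unfolding P1_def using f_meas_nu[OF assms] support_iff[OF assms]
  by (subst AE_density) auto

lemma AE_ratio_pos:
  assumes "j \<le> K" "k \<le> K" shows "AE x in P1 \<nu> f j. 0 < f k x / f j x"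
  using AE_pos[OF assms(1)] by eventually_elim (use assms in simp)

text \<open>Valid off the support too, where both quotients are 0 and \<open>ln 0 = 0\<close>. It
  presents the walk in the form the lower bound expects under \<open>P_i\<close>.\<close>

lemma llr_swap: assumes "i \<le> K" shows "llr f i x = - ln (f 0 x / f i x)"
  using support_zero_iff[of i 0 x] support_iff[of i 0 x] f_nonneg[of i x] assms
  by (cases "f 0 x = 0") (auto simp: llr_def ln_div less_le)

lemma llr_swap_fun: "i \<le> K \<Longrightarrow> llr f i = (\<lambda>x. - ln (f 0 x / f i x))"
  using llr_swap by blast

text \<open>A ratio equal to 1 almost everywhere makes the log-likelihood ratio vanish, which is
  arithmetic with span 1.\<close>

lemma ratio_not_one:
  assumes "non_arithmetic M (llr f i)"
  shows "\<not> (AE x in M. f i x / f 0 x = 1)" "\<not> (AE x in M. f 0 x / f i x = 1)"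
proof -
  have nz: "\<not> (AE x in M. llr f i x = 0)"
  proof
    assume "AE x in M. llr f i x = 0"
    then have "AE x in M. \<exists>m::int. llr f i x = 1 * of_int m" by eventually_elim auto
    then show False using assms unfolding non_arithmetic_def by (metis zero_less_one)
  qed
  show "\<not> (AE x in M. f i x / f 0 x = 1)"
  proof
    assume "AE x in M. f i x / f 0 x = 1"
    then have "AE x in M. llr f i x = 0" by eventually_elim (simp only: llr_def ln_one)
    with nz show False ..
  qed
  show "\<not> (AE x in M. f 0 x / f i x = 1)"
  proof
    assume "AE x in M. f 0 x / f i x = 1"
    then have "AE x in M. llr f i x = 0" by eventually_elim (auto simp: llr_def divide_eq_1_iff)
    with nz show False ..
  qed
qed

text \<open>The Kullback-Leibler divergences between \<open>f i\<close> and \<open>f 0\<close> in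
  either order; they are the drifts of the walk under \<open>P_i\<close> and of its negative under
  \<open>P_0\<close>.\<close>

definition "I1 i = (\<integral>x. llr f i x \<partial>P1 \<nu> f i)"
definition "I0 i = (\<integral>x. - llr f i x \<partial>P1 \<nu> f 0)"

lemma I1_eq: "i \<in> {1..K} \<Longrightarrow> I1 i = (\<integral>x. - ln (f 0 x / f i x) \<partial>P1 \<nu> f i)"
  unfolding I1_def using llr_swap_fun[of i] by simp

lemma I1_pos: assumes i: "i \<in> {1..K}" shows "0 < I1 i"
  unfolding I1_eq[OF i]
proof (rule relative_entropy_pos)
  show "prob_space (density (P1 \<nu> f i) (\<lambda>x. ennreal (f 0 x / f i x)))"
    using i by (simp add: density_ratio prob_P1)
  show "integrable (P1 \<nu> f i) (\<lambda>x. - ln (f 0 x / f i x))"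
    using I_fin[OF i] llr_swap_fun[of i] i by simp
qed (use i ratio_not_one[OF nonarith1[OF i]] in \<open>simp_all add: prob_P1 AE_ratio_pos ratio_meas f_nonneg\<close>)

lemma I0_pos: assumes i: "i \<in> {1..K}" shows "0 < I0 i"
  unfolding I0_def llr_def
proof (rule relative_entropy_pos)
  show "prob_space (density (P1 \<nu> f 0) (\<lambda>x. ennreal (f i x / f 0 x)))"
    using i by (simp add: density_ratio prob_P1)
  show "integrable (P1 \<nu> f 0) (\<lambda>x. - ln (f i x / f 0 x))"
    using I0_fin[OF i] by (simp add: llr_def[abs_def])
qed (use i ratio_not_one[OF nonarith0[OF i]] in \<open>simp_all add: prob_P1 AE_ratio_pos ratio_meas f_nonneg\<close>)

lemma LR_nonneg: "i \<in> {1..K} \<Longrightarrow> 0 \<le> LR f i t \<omega>"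
  unfolding LR_def by (intro prod_nonneg) (simp add: f_nonneg)

text \<open>Only almost sure: off the support a factor of \<open>LR\<close> is 0, while
  \<open>exp (llr f i x) = exp 0 = 1\<close>.\<close>

lemma LR_exp:
  assumes j: "j \<le> K"
  shows "AE \<omega> in Pj \<nu> f j. \<forall>i\<in>{1..K}. \<forall>n. LR f i n \<omega> = exp (\<Sum>k<n. llr f i (\<omega> k))"
proof -
  have "AE \<omega> in Pj \<nu> f j. \<forall>m. \<forall>k\<le>K. 0 < f k (\<omega> m)"
    unfolding Pj_eq
  proof (subst AE_all_countable, rule allI)
    fix m :: nat
    show "AE \<omega> in PiM UNIV (\<lambda>_. P1 \<nu> f j). \<forall>k\<le>K. 0 < f k (\<omega> m)"
      by (rule AE_PiM_component[where M = "\<lambda>_. P1 \<nu> f j" and P = "\<lambda>x. \<forall>k\<le>K. 0 < f k x"])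
         (simp_all only: UNIV_I prob_P1[OF j] AE_pos[OF j])
  qed
  then show ?thesis
    by eventually_elim (auto simp: LR_def llr_def exp_sum)
qed

lemma class_adapted:
  assumes "(T, d) \<in> test_class \<nu> f K \<alpha> \<beta>"
  shows "adapted_test (Pj \<nu> f j) T d"
  using assms is_seq_test_adapted[of T d] adapted_test_cong_sets[OF sets_Pj]
  by (auto simp: test_class_def)

lemma lower_bound_1:
  assumes i: "i \<in> {1..K}" and \<alpha>: "0 < \<alpha>" "\<alpha> < 1"
  shows "ennreal (((1 - \<beta>) * ln (1 / \<alpha>) - 2) / I1 i)
    \<le> (INF \<delta>\<in>test_class \<nu> f K \<alpha> \<beta>. ESS (Pj \<nu> f i) (fst \<delta>))"
proof (rule INF_greatest)
  fix \<delta> assume \<delta>: "\<delta> \<in> test_class \<nu> f K \<alpha> \<beta>"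
  obtain T d where Td: "\<delta> = (T, d)" by force
  note cl = \<delta>[unfolded Td]
  have "ennreal (((1 - \<beta>) * ln (1 / \<alpha>) - 2) / I1 i) \<le> ESS (PiM UNIV (\<lambda>_. P1 \<nu> f i)) T"
  proof (rule expected_time_lower_bound[where \<rho> = "\<lambda>x. f 0 x / f i x"])
    show "prob_space (density (P1 \<nu> f i) (\<lambda>x. ennreal (f 0 x / f i x)))"
      using i by (simp add: density_ratio prob_P1)
    show "integrable (P1 \<nu> f i) (\<lambda>x. - ln (f 0 x / f i x))"
      using I_fin[OF i] llr_swap_fun[of i] i by simp
    show "adapted_test (PiM UNIV (\<lambda>_. P1 \<nu> f i)) T d"
      using class_adapted[OF cl] by (simp add: Pj_eq)
    show "measure (PiM UNIV (\<lambda>_. density (P1 \<nu> f i) (\<lambda>x. ennreal (f 0 x / f i x)))) {\<omega>. T \<omega> \<noteq> \<infinity> \<and> d \<omega>} \<le> \<alpha>"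
      using cl i by (simp add: density_ratio test_class_def prob_accept1_def Pj_eq)
    show "measure (PiM UNIV (\<lambda>_. P1 \<nu> f i)) {\<omega>. T \<omega> \<noteq> \<infinity> \<and> \<not> d \<omega>} \<le> \<beta>"
      using cl i by (simp add: test_class_def prob_accept0_def Pj_eq)
    show "I1 i = (\<integral>x. - ln (f 0 x / f i x) \<partial>P1 \<nu> f i)" by (rule I1_eq[OF i])
  qed (use i \<alpha> I1_pos[OF i] in \<open>simp_all add: prob_P1 AE_ratio_pos ratio_meas f_nonneg space_P1\<close>)
  then show "ennreal (((1 - \<beta>) * ln (1 / \<alpha>) - 2) / I1 i) \<le> ESS (Pj \<nu> f i) (fst \<delta>)"
    by (simp add: Td Pj_eq)
qed

text \<open>Negating the decision makes \<open>\<beta>\<close> the small error level. Every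
  \<open>i\<close> gives a bound, the sharpest where \<open>I0 i\<close> is smallest, hence the
  later choice \<open>i = 1\<close>.\<close>

lemma lower_bound_0:
  assumes i: "i \<in> {1..K}" and \<beta>: "0 < \<beta>" "\<beta> < 1"
  shows "ennreal (((1 - \<alpha>) * ln (1 / \<beta>) - 2) / I0 i)
    \<le> (INF \<delta>\<in>test_class \<nu> f K \<alpha> \<beta>. ESS (Pj \<nu> f 0) (fst \<delta>))"
proof (rule INF_greatest)
  fix \<delta> assume \<delta>: "\<delta> \<in> test_class \<nu> f K \<alpha> \<beta>"
  obtain T d where Td: "\<delta> = (T, d)" by force
  note cl = \<delta>[unfolded Td]
  have "ennreal (((1 - \<alpha>) * ln (1 / \<beta>) - 2) / I0 i) \<le> ESS (PiM UNIV (\<lambda>_. P1 \<nu> f 0)) T"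
  proof (rule expected_time_lower_bound[where \<rho> = "\<lambda>x. f i x / f 0 x" and d = "\<lambda>\<omega>. \<not> d \<omega>"])
    show "prob_space (density (P1 \<nu> f 0) (\<lambda>x. ennreal (f i x / f 0 x)))"
      using i by (simp add: density_ratio prob_P1)
    show "integrable (P1 \<nu> f 0) (\<lambda>x. - ln (f i x / f 0 x))"
      using I0_fin[OF i] i by (simp add: llr_def[abs_def])
    show "adapted_test (PiM UNIV (\<lambda>_. P1 \<nu> f 0)) T (\<lambda>\<omega>. \<not> d \<omega>)"
      using adapted_test_not[OF class_adapted[OF cl]] by (simp add: Pj_eq)
    show "measure (PiM UNIV (\<lambda>_. density (P1 \<nu> f 0) (\<lambda>x. ennreal (f i x / f 0 x)))) {\<omega>. T \<omega> \<noteq> \<infinity> \<and> \<not> d \<omega>} \<le> \<beta>"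
      using cl i by (simp add: density_ratio test_class_def prob_accept0_def Pj_eq)
    show "measure (PiM UNIV (\<lambda>_. P1 \<nu> f 0)) {\<omega>. T \<omega> \<noteq> \<infinity> \<and> \<not> \<not> d \<omega>} \<le> \<alpha>"
      using cl i by (simp add: test_class_def prob_accept1_def Pj_eq)
    show "I0 i = (\<integral>x. - ln (f i x / f 0 x) \<partial>P1 \<nu> f 0)" by (simp add: I0_def llr_def)
  qed (use i \<beta> I0_pos[OF i] in \<open>simp_all add: prob_P1 AE_ratio_pos ratio_meas f_nonneg space_P1\<close>)
  then show "ennreal (((1 - \<alpha>) * ln (1 / \<beta>) - 2) / I0 i) \<le> ESS (Pj \<nu> f 0) (fst \<delta>)"
    by (simp add: Td Pj_eq)
qed

end

section \<open>Threshold tests\<close>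

context lr_model
begin

text \<open>What the MiLRT and the WGLRT have in common; nothing else about them is used.\<close>

definition threshold_test :: "((nat \<Rightarrow> 'a) \<Rightarrow> enat) \<Rightarrow> ((nat \<Rightarrow> 'a) \<Rightarrow> bool) \<Rightarrow> real \<Rightarrow> real \<Rightarrow> bool" where
  "threshold_test T d A B \<longleftrightarrow> adapted_test (PiM UNIV (\<lambda>_. borel)) T d \<and>
     (\<forall>\<omega> t. T \<omega> = enat t \<and> d \<omega> \<longrightarrow> B \<le> mixLR f K q1 t \<omega>) \<and>
     (\<forall>\<omega> t. T \<omega> = enat t \<and> \<not> d \<omega> \<longrightarrow> (\<forall>i\<in>{1..K}. q0 i * LR f i t \<omega> \<le> 1 / A)) \<and>
     (\<forall>\<omega> t. 1 \<le> t \<and> enat t < T \<omega> \<longrightarrow> (\<forall>i\<in>{1..K}. q1 i * LR f i t \<omega> < B)) \<and>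
     (\<forall>\<omega> t. 1 \<le> t \<and> enat t < T \<omega> \<longrightarrow> (\<exists>i\<in>{1..K}. 1 / (A * K) < q0 i * LR f i t \<omega>))"

lemma threshold_test_adapted: "threshold_test T d A B \<Longrightarrow> adapted_test (Pj \<nu> f j) T d"
  using adapted_test_cong_sets[OF sets_Pj] unfolding threshold_test_def by blast

lemma threshold_test_continue:
  assumes "threshold_test T d A B" "n \<noteq> 0" "enat n < T \<omega>"
  shows "i \<in> {1..K} \<Longrightarrow> q1 i * LR f i n \<omega> < B"
    and "\<exists>i\<in>{1..K}. 1 / (A * K) < q0 i * LR f i n \<omega>"
proof -
  have "1 \<le> n" using assms(2) by simp
  then show "i \<in> {1..K} \<Longrightarrow> q1 i * LR f i n \<omega> < B"
    and "\<exists>i\<in>{1..K}. 1 / (A * K) < q0 i * LR f i n \<omega>"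
    using assms(1,3) unfolding threshold_test_def by blast+
qed

section \<open>Error probabilities by change of measure\<close>

lemma LR_meas: assumes "i \<in> {1..K}" shows "LR f i t \<in> borel_measurable (Pj \<nu> f 0)"
proof -
  have [measurable]: "(\<lambda>x. f i x / f 0 x) \<in> borel_measurable (P1 \<nu> f 0)"
    using assms by (intro ratio_meas) auto
  show ?thesis unfolding LR_def[abs_def] Pj_eq by measurable
qed

lemma emeasure_decision:
  assumes ad: "adapted_test (Pj \<nu> f 0) T d" and i: "i \<in> {1..K}"
  shows "emeasure (Pj \<nu> f i) {\<omega>. T \<omega> = enat t \<and> d \<omega>}
    = (\<integral>\<^sup>+\<omega>. indicator {\<omega>. T \<omega> = enat t \<and> d \<omega>} \<omega> * ennreal (LR f i t \<omega>) \<partial>Pj \<nu> f 0)"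
proof -
  have i': "i \<le> K" "0 \<le> K" using i by auto
  have "emeasure (PiM UNIV (\<lambda>_. density (P1 \<nu> f 0) (\<lambda>x. ennreal (f i x / f 0 x)))) {\<omega>. T \<omega> = enat t \<and> d \<omega>}
    = (\<integral>\<^sup>+\<omega>. indicator {\<omega>. T \<omega> = enat t \<and> d \<omega>} \<omega> * ennreal (\<Prod>k<t. f i (\<omega> k) / f 0 (\<omega> k)) \<partial>PiM UNIV (\<lambda>_. P1 \<nu> f 0))"
    using adapted_testD(2,4)[OF ad, of t] i'
    by (intro emeasure_PiM_density ratio_meas) (simp_all add: prob_P1 density_ratio f_nonneg Pj_eq)
  then show ?thesis using i' by (simp add: density_ratio Pj_eq LR_def)
qed

text \<open>Where \<open>H_1\<close> is accepted the mixture of likelihood ratios is at least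
  \<open>B\<close>; integrated under \<open>P_0\<close> it becomes a mixture of probabilities under
  the \<open>P_i\<close>, with total weight the sum of \<open>q1\<close>.\<close>

lemma error_1_le:
  assumes tt: "threshold_test T d A B" and B: "0 < B"
  shows "prob_accept1 (Pj \<nu> f 0) T d \<le> (\<Sum>i=1..K. q1 i) / B"
proof -
  interpret P0: prob_space "Pj \<nu> f 0" by (rule prob_Pj) simp
  let ?D = "\<lambda>t. {\<omega>. T \<omega> = enat t \<and> d \<omega>}" and ?U = "{\<omega>. T \<omega> \<noteq> \<infinity> \<and> d \<omega>}"
  note ad = threshold_test_adapted[OF tt]
  have [measurable]: "?D t \<in> sets (Pj \<nu> f 0)" for t using adapted_testD(2)[OF ad] .
  note [measurable] = LR_meas
  have step: "ennreal B * emeasure (Pj \<nu> f 0) (?D t) \<le> (\<Sum>i=1..K. ennreal (q1 i) * emeasure (Pj \<nu> f i) (?D t))" for t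
  proof -
    have "ennreal B * emeasure (Pj \<nu> f 0) (?D t) = (\<integral>\<^sup>+\<omega>. ennreal B * indicator (?D t) \<omega> \<partial>Pj \<nu> f 0)"
      by (simp add: nn_integral_cmult)
    also have "\<dots> \<le> (\<integral>\<^sup>+\<omega>. (\<Sum>i=1..K. ennreal (q1 i) * (indicator (?D t) \<omega> * ennreal (LR f i t \<omega>))) \<partial>Pj \<nu> f 0)"
    proof (rule nn_integral_mono)
      fix \<omega>
      show "ennreal B * indicator (?D t) \<omega> \<le> (\<Sum>i=1..K. ennreal (q1 i) * (indicator (?D t) \<omega> * ennreal (LR f i t \<omega>)))"
      proof (cases "\<omega> \<in> ?D t")
        case True
        then have "B \<le> mixLR f K q1 t \<omega>" using tt unfolding threshold_test_def by blast
        then have "ennreal B \<le> ennreal (\<Sum>i=1..K. q1 i * LR f i t \<omega>)"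
          unfolding mixLR_def by (rule ennreal_leI)
        also have "\<dots> = (\<Sum>i=1..K. ennreal (q1 i * LR f i t \<omega>))"
          using LR_nonneg q1_pos by (intro sum_ennreal[symmetric] mult_nonneg_nonneg) (auto intro: less_imp_le)
        also have "\<dots> = (\<Sum>i=1..K. ennreal (q1 i) * ennreal (LR f i t \<omega>))"
          using LR_nonneg q1_pos by (intro sum.cong ennreal_mult) (auto intro: less_imp_le)
        finally show ?thesis using True by simp
      qed simp
    qed
    also have "\<dots> = (\<Sum>i=1..K. \<integral>\<^sup>+\<omega>. ennreal (q1 i) * (indicator (?D t) \<omega> * ennreal (LR f i t \<omega>)) \<partial>Pj \<nu> f 0)"
      by (rule nn_integral_sum) measurable
    also have "\<dots> = (\<Sum>i=1..K. ennreal (q1 i) * emeasure (Pj \<nu> f i) (?D t))"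
    proof (rule sum.cong[OF refl])
      fix i assume i: "i \<in> {1..K}"
      note [measurable] = LR_meas[OF i]
      show "(\<integral>\<^sup>+\<omega>. ennreal (q1 i) * (indicator (?D t) \<omega> * ennreal (LR f i t \<omega>)) \<partial>Pj \<nu> f 0)
          = ennreal (q1 i) * emeasure (Pj \<nu> f i) (?D t)"
        unfolding emeasure_decision[OF ad i] by (rule nn_integral_cmult) measurable
    qed
    finally show ?thesis .
  qed
  have "ennreal B * emeasure (Pj \<nu> f 0) ?U = (\<Sum>t. ennreal B * emeasure (Pj \<nu> f 0) (?D t))"
    unfolding emeasure_decided(2)[OF ad] by simp
  also have "\<dots> \<le> (\<Sum>t. \<Sum>i=1..K. ennreal (q1 i) * emeasure (Pj \<nu> f i) (?D t))"
    by (intro suminf_le step) auto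
  also have "\<dots> = (\<Sum>i=1..K. \<Sum>t. ennreal (q1 i) * emeasure (Pj \<nu> f i) (?D t))"
    by (rule suminf_sum) auto
  also have "\<dots> = (\<Sum>i=1..K. ennreal (q1 i) * emeasure (Pj \<nu> f i) ?U)"
    unfolding emeasure_decided(2)[OF threshold_test_adapted[OF tt]] by simp
  also have "\<dots> \<le> (\<Sum>i=1..K. ennreal (q1 i) * 1)"
    using prob_Pj by (intro sum_mono mult_left_mono prob_space.emeasure_le_1) auto
  also have "\<dots> = ennreal (\<Sum>i=1..K. q1 i)"
    by (simp only: mult_1_right) (intro sum_ennreal less_imp_le q1_pos)
  finally have "ennreal (B * P0.prob ?U) \<le> ennreal (\<Sum>i=1..K. q1 i)"
    using B by (simp add: P0.emeasure_eq_measure ennreal_mult)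
  then have "B * P0.prob ?U \<le> (\<Sum>i=1..K. q1 i)"
    by (subst (asm) ennreal_le_iff) (intro sum_nonneg less_imp_le q1_pos)
  then show ?thesis using B by (simp add: prob_accept1_def pos_le_divide_eq mult.commute)
qed

text \<open>Where \<open>H_0\<close> is accepted every single component is small, so there
  \<open>P_i\<close> is at most \<open>1 / (A * q0 i)\<close> times \<open>P_0\<close>.\<close>

lemma error_0_le:
  assumes tt: "threshold_test T d A B" and A: "0 < A" and i: "i \<in> {1..K}"
  shows "prob_accept0 (Pj \<nu> f i) T d \<le> 1 / (A * q0 i)"
proof -
  interpret P0: prob_space "Pj \<nu> f 0" by (rule prob_Pj) simp
  interpret Pi: prob_space "Pj \<nu> f i" by (rule prob_Pj) (use i in simp)
  let ?D = "\<lambda>t. {\<omega>. T \<omega> = enat t \<and> \<not> d \<omega>}" and ?U = "{\<omega>. T \<omega> \<noteq> \<infinity> \<and> \<not> d \<omega>}"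
  note ad = adapted_test_not[OF threshold_test_adapted[OF tt]]
  have [measurable]: "?D t \<in> sets (Pj \<nu> f 0)" for t using adapted_testD(2)[OF ad] .
  let ?c = "1 / (A * q0 i)"
  have q: "0 < q0 i" using q0_pos[OF i] .
  have step: "emeasure (Pj \<nu> f i) (?D t) \<le> ennreal ?c * emeasure (Pj \<nu> f 0) (?D t)" for t
  proof -
    have "emeasure (Pj \<nu> f i) (?D t) \<le> (\<integral>\<^sup>+\<omega>. ennreal ?c * indicator (?D t) \<omega> \<partial>Pj \<nu> f 0)"
      unfolding emeasure_decision[OF ad i]
    proof (rule nn_integral_mono)
      fix \<omega>
      show "indicator (?D t) \<omega> * ennreal (LR f i t \<omega>) \<le> ennreal ?c * indicator (?D t) \<omega>"
      proof (cases "\<omega> \<in> ?D t")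
        case True
        then have "q0 i * LR f i t \<omega> \<le> 1 / A" using tt i unfolding threshold_test_def by blast
        then have "LR f i t \<omega> \<le> ?c" using A q by (simp add: field_simps)
        then show ?thesis using True by (simp add: ennreal_leI)
      qed simp
    qed
    then show ?thesis by (simp add: nn_integral_cmult)
  qed
  have "emeasure (Pj \<nu> f i) ?U = (\<Sum>t. emeasure (Pj \<nu> f i) (?D t))"
    by (rule emeasure_decided(2)[OF adapted_test_not[OF threshold_test_adapted[OF tt]]])
  also have "\<dots> \<le> (\<Sum>t. ennreal ?c * emeasure (Pj \<nu> f 0) (?D t))"
    by (intro suminf_le step) auto
  also have "\<dots> = ennreal ?c * emeasure (Pj \<nu> f 0) ?U"
    unfolding emeasure_decided(2)[OF ad] by simp
  also have "\<dots> \<le> ennreal ?c * 1" by (intro mult_left_mono P0.emeasure_le_1) simp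
  finally have "ennreal (Pi.prob ?U) \<le> ennreal ?c" by (simp add: Pi.emeasure_eq_measure)
  then show ?thesis using A q by (subst (asm) ennreal_le_iff) (auto simp: prob_accept0_def)
qed

text \<open>While the test runs, the walk of the true component stays below its barrier, so the
  penalty in the survival bound is 0. \<open>C\<close> is fixed before the test and the thresholds,
  as an \<open>O(1)\<close> statement requires.\<close>

lemma ESS_upper_1:
  assumes i: "i \<in> {1..K}"
  shows "\<exists>C. \<forall>T d A B. threshold_test T d A B \<longrightarrow> 0 < B \<longrightarrow>
    ESS (Pj \<nu> f i) T \<le> ennreal (max 1 (ln (B / q1 i)) / I1 i + C)"
proof -
  have iK: "i \<le> K" using i by simp
  interpret sequence_space "P1 \<nu> f i" by (rule seq_P1[OF iK])
  obtain C where C: "0 \<le> C" and bound: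
    "\<And>E b. (\<And>n. E n \<in> sets S) \<Longrightarrow> (\<And>n. determined n (\<lambda>\<omega>. \<omega> \<in> E n)) \<Longrightarrow> decseq E \<Longrightarrow> 0 \<le> b \<Longrightarrow>
      (\<Sum>n. emeasure S (E n)) \<le> ennreal (b / I1 i + C)
        + ennreal C * (\<Sum>n. emeasure S {\<omega>\<in>E n. b \<le> (\<Sum>k<n. llr f i (\<omega> k))})"
    using sum_survival_bound[OF I_fin[OF i] A1_i[OF i] I1_def I1_pos[OF i]] by blast
  show ?thesis
  proof (intro exI[of _ C] allI impI)
    fix T d and A B :: real
    assume tt: "threshold_test T d A B" and B: "0 < B"
    \<comment> \<open>The maximum with 1 covers time 0: there the stopping conditions say nothing,
      and the walk, being at 0, must lie strictly below the barrier.\<close>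
    let ?b = "max 1 (ln (B / q1 i))" and ?E = "\<lambda>n. {\<omega>. enat n < T \<omega>}"
    note ad = threshold_test_adapted[OF tt, of i]
    note sv = adapted_test_survival[OF ad space_Pj]
    have "AE \<omega> in Pj \<nu> f i. \<forall>n. \<not> (\<omega> \<in> ?E n \<and> ?b \<le> (\<Sum>k<n. llr f i (\<omega> k)))"
      using LR_exp[OF iK]
    proof eventually_elim
      case (elim \<omega>)
      have "(\<Sum>k<n. llr f i (\<omega> k)) < ?b" if n: "enat n < T \<omega>" for n
      proof (cases "n = 0")
        case False
        then have "q1 i * exp (\<Sum>k<n. llr f i (\<omega> k)) < B"
          using threshold_test_continue(1)[OF tt False n i] elim i by simp
        then have "exp (\<Sum>k<n. llr f i (\<omega> k)) < exp (ln (B / q1 i))"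
          using q1_pos[OF i] B by (simp add: field_simps)
        then show ?thesis by (simp only: exp_less_cancel_iff less_max_iff_disj simp_thms)
      qed simp
      then show ?case by (meson mem_Collect_eq not_le)
    qed
    then have "AE \<omega> in Pj \<nu> f i. \<not> (\<omega> \<in> ?E n \<and> ?b \<le> (\<Sum>k<n. llr f i (\<omega> k)))" for n
      by (rule eventually_mono) blast
    from emeasure_eq_0_AE[OF this]
    have "emeasure S {\<omega>\<in>?E n. ?b \<le> (\<Sum>k<n. llr f i (\<omega> k))} = 0" for n
      by (simp add: space_Pj Pj_eq[symmetric])
    then have "(\<Sum>n. emeasure S (?E n)) \<le> ennreal (?b / I1 i + C)"
      using bound[of ?E ?b] sv by (simp add: Pj_eq)
    then show "ESS (Pj \<nu> f i) T \<le> ennreal (?b / I1 i + C)"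
      using ESS_eq_suminf[OF ad space_Pj] by (simp add: Pj_eq)
  qed
qed

text \<open>Collects the factor \<open>K\<close> lost in passing from the mixture to one component
  and a common bound for the weights, so that one barrier \<open>ln (A * \<kappa>)\<close> serves
  all components.\<close>

definition "\<kappa> = real K * (\<Sum>i=1..K. q0 i)"

lemma \<kappa>_pos: "0 < \<kappa>"
  unfolding \<kappa>_def using K_pos q0_pos by (intro mult_pos_pos sum_pos) auto

text \<open>The index \<open>i\<close> may change with \<open>n\<close>, so no single walk is kept
  below the barrier.\<close>

lemma survive_0:
  assumes tt: "threshold_test T d A B" and A: "0 < A"
  shows "AE \<omega> in Pj \<nu> f 0. \<forall>n. enat n < T \<omega> \<longrightarrow>
    (\<exists>i\<in>{1..K}. (\<Sum>k<n. - llr f i (\<omega> k)) < max 1 (ln (A * \<kappa>)))"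
  using LR_exp[OF le0]
proof eventually_elim
  case (elim \<omega>)
  show ?case
  proof (intro allI impI)
    fix n assume n: "enat n < T \<omega>"
    show "\<exists>i\<in>{1..K}. (\<Sum>k<n. - llr f i (\<omega> k)) < max 1 (ln (A * \<kappa>))"
    proof (cases "n = 0")
      case True
      then show ?thesis using K_pos by (intro bexI[of _ 1]) auto
    next
      case False
      then obtain i where i: "i \<in> {1..K}" and lt: "1 / (A * K) < q0 i * LR f i n \<omega>"
        using threshold_test_continue(2)[OF tt False n] by blast
      define s where "s = (\<Sum>k<n. llr f i (\<omega> k))"
      have "q0 i \<le> (\<Sum>i=1..K. q0 i)"
        using i q0_pos by (intro member_le_sum) (auto intro: less_imp_le)
      then have "q0 i * exp s \<le> (\<Sum>i=1..K. q0 i) * exp s" by (intro mult_right_mono) auto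
      moreover have "LR f i n \<omega> = exp s" using elim i by (simp add: s_def)
      ultimately have "1 / (A * K) < (\<Sum>i=1..K. q0 i) * exp s"
        using lt by (simp only:)
      then have "1 < A * \<kappa> * exp s"
        using A K_pos by (simp add: \<kappa>_def divide_less_eq algebra_simps)
      then have "exp (- s) < A * \<kappa>" by (simp add: exp_minus field_simps)
      also have "\<dots> = exp (ln (A * \<kappa>))" using A \<kappa>_pos by simp
      finally have "- s < ln (A * \<kappa>)" by (simp only: exp_less_cancel_iff)
      then show ?thesis using i by (intro bexI[of _ i]) (auto simp: s_def sum_negf)
    qed
  qed
qed

text \<open>The walk of component 1 is above the barrier and that of some other \<open>i\<close>
  below it; in their difference the barrier cancels. What remains is a nonpositive sum of a walk
  with drift \<open>I0 i - I0 1\<close>, so the bound \<open>H\<close> on the expected number of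
  exceptional times is free of \<open>A\<close> and of the test.\<close>

lemma ESS_upper_0_unique:
  assumes gap: "\<And>i. i \<in> {2..K} \<Longrightarrow> I0 1 < I0 i"
  shows "\<exists>C. \<forall>T d A B. threshold_test T d A B \<longrightarrow> 0 < A \<longrightarrow>
    ESS (Pj \<nu> f 0) T \<le> ennreal (max 1 (ln (A * \<kappa>)) / I0 1 + C)"
proof -
  interpret sequence_space "P1 \<nu> f 0" by (rule seq_P1) simp
  have one: "1 \<in> {1..K}" using K_pos by simp
  let ?X = "\<lambda>x. - llr f 1 x"
  have X: "integrable (P1 \<nu> f 0) ?X" "integrable (P1 \<nu> f 0) (\<lambda>x. (?X x)\<^sup>2)"
    using I0_fin[OF one] A1_0[OF one] by simp_all
  obtain C where C: "0 \<le> C" and bound: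
    "\<And>E b. (\<And>n. E n \<in> sets S) \<Longrightarrow> (\<And>n. determined n (\<lambda>\<omega>. \<omega> \<in> E n)) \<Longrightarrow> decseq E \<Longrightarrow> 0 \<le> b \<Longrightarrow>
      (\<Sum>n. emeasure S (E n)) \<le> ennreal (b / I0 1 + C)
        + ennreal C * (\<Sum>n. emeasure S {\<omega>\<in>E n. b \<le> (\<Sum>k<n. - llr f 1 (\<omega> k))})"
    using sum_survival_bound[OF X I0_def I0_pos[OF one]] by blast
  define F where "F i n = {\<omega>\<in>space S. (\<Sum>k<n. llr f 1 (\<omega> k) - llr f i (\<omega> k)) \<le> 0}" for i n
  have llr_meas: "llr f i \<in> borel_measurable (P1 \<nu> f 0)" if "i \<in> {1..K}" for i
    using I0_fin[OF that] by (rule borel_measurable_integrable)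
  have F_meas: "F i n \<in> sets S" if "i \<in> {2..K}" for i n
  proof -
    have [measurable]: "llr f 1 \<in> borel_measurable (P1 \<nu> f 0)" "llr f i \<in> borel_measurable (P1 \<nu> f 0)"
      using that by (auto intro!: llr_meas)
    show ?thesis unfolding F_def by measurable
  qed
  have F_fin: "(\<Sum>n. emeasure S (F i n)) < \<infinity>" if i: "i \<in> {2..K}" for i
  proof -
    have i1: "i \<in> {1..K}" using i by auto
    \<comment> \<open>The mixed term in the second moment of the difference.\<close>
    have prod: "integrable (P1 \<nu> f 0) (\<lambda>x. llr f 1 x * llr f i x)"
    proof (rule Bochner_Integration.integrable_bound)
      show "integrable (P1 \<nu> f 0) (\<lambda>x. (llr f 1 x)\<^sup>2 + (llr f i x)\<^sup>2)"
        using A1_0[OF one] A1_0[OF i1] by simp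
      show "(\<lambda>x. llr f 1 x * llr f i x) \<in> borel_measurable (P1 \<nu> f 0)"
        using llr_meas[OF one] llr_meas[OF i1] by simp
      show "AE x in P1 \<nu> f 0. norm (llr f 1 x * llr f i x) \<le> norm ((llr f 1 x)\<^sup>2 + (llr f i x)\<^sup>2)"
      proof (rule AE_I2)
        fix x
        have "0 \<le> (\<bar>llr f 1 x\<bar> - \<bar>llr f i x\<bar>)\<^sup>2" by simp
        then have "2 * (\<bar>llr f 1 x\<bar> * \<bar>llr f i x\<bar>) \<le> (llr f 1 x)\<^sup>2 + (llr f i x)\<^sup>2"
          by (simp add: power2_diff)
        moreover have "0 \<le> \<bar>llr f 1 x\<bar> * \<bar>llr f i x\<bar>" by simp
        ultimately show "norm (llr f 1 x * llr f i x) \<le> norm ((llr f 1 x)\<^sup>2 + (llr f i x)\<^sup>2)"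
          by (simp only: real_norm_def abs_mult)
      qed
    qed
    show ?thesis
      unfolding F_def
    proof (rule sum_prob_nonpos_finite)
      show "integrable (P1 \<nu> f 0) (\<lambda>x. llr f 1 x - llr f i x)"
        using I0_fin[OF one] I0_fin[OF i1] by simp
      show "integrable (P1 \<nu> f 0) (\<lambda>x. (llr f 1 x - llr f i x)\<^sup>2)"
        using A1_0[OF one] A1_0[OF i1] prod by (simp add: power2_diff mult.assoc)
      show "0 < (\<integral>x. llr f 1 x - llr f i x \<partial>P1 \<nu> f 0)"
        using gap[OF i] I0_fin[OF one] I0_fin[OF i1] by (simp add: I0_def)
    qed
  qed
  define H where "H = (\<Sum>i\<in>{2..K}. \<Sum>n. emeasure S (F i n))"
  have H: "H < \<infinity>" unfolding H_def using F_fin by (simp add: less_top[symmetric])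
  show ?thesis
  proof (intro exI[of _ "C + C * enn2real H"] allI impI)
    fix T d and A B :: real
    assume tt: "threshold_test T d A B" and A: "0 < A"
    let ?b = "max 1 (ln (A * \<kappa>))" and ?E = "\<lambda>n. {\<omega>. enat n < T \<omega>}"
    note ad = threshold_test_adapted[OF tt, of 0]
    note sv = adapted_test_survival[OF ad space_Pj]
    have AE: "AE \<omega> in S. \<forall>n. \<omega> \<in> ?E n \<and> ?b \<le> (\<Sum>k<n. - llr f 1 (\<omega> k)) \<longrightarrow> \<omega> \<in> (\<Union>i\<in>{2..K}. F i n)"
      using survive_0[OF tt A] unfolding Pj_eq
    proof eventually_elim
      case (elim \<omega>)
      show ?case
      proof (intro allI impI)
        fix n assume n: "\<omega> \<in> ?E n \<and> ?b \<le> (\<Sum>k<n. - llr f 1 (\<omega> k))"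
        then obtain i where i: "i \<in> {1..K}" and lt: "(\<Sum>k<n. - llr f i (\<omega> k)) < ?b"
          using elim by blast
        have "i \<noteq> 1" using lt n by (auto simp: not_less)
        with i have "i \<in> {2..K}" by auto
        moreover have "\<omega> \<in> F i n"
          using lt n space_Pj[of 0] unfolding F_def Pj_eq by (auto simp: sum_subtractf sum_negf)
        ultimately show "\<omega> \<in> (\<Union>i\<in>{2..K}. F i n)" by blast
      qed
    qed
    have "emeasure S {\<omega>\<in>?E n. ?b \<le> (\<Sum>k<n. - llr f 1 (\<omega> k))} \<le> (\<Sum>i\<in>{2..K}. emeasure S (F i n))" for n
    proof -
      have "emeasure S {\<omega>\<in>?E n. ?b \<le> (\<Sum>k<n. - llr f 1 (\<omega> k))} \<le> emeasure S (\<Union>i\<in>{2..K}. F i n)"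
        using AE F_meas by (intro emeasure_mono_AE sets.finite_UN) (auto elim!: eventually_mono)
      also have "\<dots> \<le> (\<Sum>i\<in>{2..K}. emeasure S (F i n))"
        using F_meas by (intro emeasure_subadditive_finite) auto
      finally show ?thesis .
    qed
    then have "(\<Sum>n. emeasure S {\<omega>\<in>?E n. ?b \<le> (\<Sum>k<n. - llr f 1 (\<omega> k))}) \<le> (\<Sum>n. \<Sum>i\<in>{2..K}. emeasure S (F i n))"
      by (intro suminf_le) auto
    also have "\<dots> = H" unfolding H_def by (rule suminf_sum) auto
    finally have bad: "(\<Sum>n. emeasure S {\<omega>\<in>?E n. ?b \<le> (\<Sum>k<n. - llr f 1 (\<omega> k))}) \<le> H" .
    have "ESS (Pj \<nu> f 0) T = (\<Sum>n. emeasure S (?E n))"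
      using ESS_eq_suminf[OF ad space_Pj] by (simp add: Pj_eq)
    also have "\<dots> \<le> ennreal (?b / I0 1 + C) + ennreal C * (\<Sum>n. emeasure S {\<omega>\<in>?E n. ?b \<le> (\<Sum>k<n. - llr f 1 (\<omega> k))})"
      using sv by (intro bound) (auto simp: Pj_eq)
    also have "\<dots> \<le> ennreal (?b / I0 1 + C) + ennreal C * ennreal (enn2real H)"
      using bad H by (intro add_left_mono mult_left_mono) (simp_all add: less_top)
    also have "\<dots> = ennreal (?b / I0 1 + C + C * enn2real H)"
    proof -
      have "ennreal C * ennreal (enn2real H) = ennreal (C * enn2real H)"
        using C by (simp add: ennreal_mult)
      moreover have "0 \<le> ?b / I0 1" using I0_pos[OF one] by (intro divide_nonneg_pos) auto
      moreover from this have "ennreal (?b / I0 1 + C + C * enn2real H)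
          = ennreal (?b / I0 1 + C) + ennreal (C * enn2real H)"
        using C by (intro ennreal_plus) auto
      ultimately show ?thesis by simp
    qed
    finally show "ESS (Pj \<nu> f 0) T \<le> ennreal (?b / I0 1 + (C + C * enn2real H))"
      by (simp add: add.assoc)
  qed
qed

text \<open>Once the line of slope \<open>c\<close> is above the barrier, survival puts some walk
  under the line although its drift is at least \<open>m > c\<close>. Each component is compared
  with the line and not with another component, so equal drifts do no harm.\<close>

lemma ESS_upper_0:
  assumes m: "0 < m" "\<And>i. i \<in> {1..K} \<Longrightarrow> m \<le> I0 i" and \<epsilon>: "0 < \<epsilon>" "\<epsilon> < 1"
  shows "\<exists>C. \<forall>T d A B. threshold_test T d A B \<longrightarrow> 0 < A \<longrightarrow>
    ESS (Pj \<nu> f 0) T \<le> ennreal (max 1 (ln (A * \<kappa>)) / ((1 - \<epsilon>) * m) + C)"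
proof -
  interpret sequence_space "P1 \<nu> f 0" by (rule seq_P1) simp
  define c where "c = (1 - \<epsilon>) * m"
  have c: "0 < c" "c < m" using m \<epsilon> by (auto simp: c_def)
  define F where "F i n = {\<omega>\<in>space S. (\<Sum>k<n. - llr f i (\<omega> k) - c) \<le> 0}" for i n
  have F_meas: "F i n \<in> sets S" if "i \<in> {1..K}" for i n
  proof -
    have [measurable]: "llr f i \<in> borel_measurable (P1 \<nu> f 0)"
      using I0_fin[OF that] by (rule borel_measurable_integrable)
    show ?thesis unfolding F_def by measurable
  qed
  have F_fin: "(\<Sum>n. emeasure S (F i n)) < \<infinity>" if i: "i \<in> {1..K}" for i
    unfolding F_def
  proof (rule sum_prob_nonpos_finite)
    show "integrable (P1 \<nu> f 0) (\<lambda>x. - llr f i x - c)"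
      using I0_fin[OF i] by simp
    show "integrable (P1 \<nu> f 0) (\<lambda>x. (- llr f i x - c)\<^sup>2)"
      using A1_0[OF i] I0_fin[OF i] by (simp add: power2_diff)
    show "0 < (\<integral>x. - llr f i x - c \<partial>P1 \<nu> f 0)"
      using m(2)[OF i] c I0_fin[OF i] by (simp add: I0_def M.prob_space)
  qed
  define H where "H = (\<Sum>i\<in>{1..K}. \<Sum>n. emeasure S (F i n))"
  have H: "H < \<infinity>" unfolding H_def using F_fin by (simp add: less_top[symmetric])
  show ?thesis
    unfolding c_def[symmetric]
  proof (intro exI[of _ "1 + enn2real H"] allI impI)
    fix T d and A B :: real
    assume tt: "threshold_test T d A B" and A: "0 < A"
    let ?b = "max 1 (ln (A * \<kappa>))" and ?E = "\<lambda>n. {\<omega>. enat n < T \<omega>}"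
    note ad = threshold_test_adapted[OF tt, of 0]
    note sv = adapted_test_survival[OF ad space_Pj]
    \<comment> \<open>From this index on the line has reached the barrier; earlier survival
      probabilities are bounded by 1.\<close>
    define m0 where "m0 = nat \<lceil>?b / c\<rceil>"
    have b0: "0 \<le> ?b / c" using c by simp
    have m0: "?b \<le> real n * c" if "\<not> n < m0" for n
    proof -
      have "?b / c \<le> real n" using that unfolding m0_def by linarith
      then show ?thesis using c by (simp add: pos_divide_le_eq)
    qed
    have m0_le: "real m0 \<le> ?b / c + 1" using b0 unfolding m0_def by linarith
    have AE: "AE \<omega> in S. \<forall>n. \<omega> \<in> ?E n \<and> \<not> n < m0 \<longrightarrow> \<omega> \<in> (\<Union>i\<in>{1..K}. F i n)"
      using survive_0[OF tt A] unfolding Pj_eq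
    proof eventually_elim
      case (elim \<omega>)
      show ?case
      proof (intro allI impI)
        fix n assume n: "\<omega> \<in> ?E n \<and> \<not> n < m0"
        then obtain i where i: "i \<in> {1..K}" and lt: "(\<Sum>k<n. - llr f i (\<omega> k)) < ?b"
          using elim by blast
        then have "(\<Sum>k<n. - llr f i (\<omega> k)) \<le> real n * c" using m0[of n] n by linarith
        then have "\<omega> \<in> F i n"
          using space_Pj[of 0] unfolding F_def Pj_eq by (auto simp: sum_subtractf)
        with i show "\<omega> \<in> (\<Union>i\<in>{1..K}. F i n)" by blast
      qed
    qed
    have "emeasure S (?E n) \<le> (if n < m0 then 1 else 0) + (\<Sum>i\<in>{1..K}. emeasure S (F i n))" for n
    proof (cases "n < m0")
      case True
      then show ?thesis using P.emeasure_le_1[of "?E n"] by (simp add: add_increasing2)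
    next
      case False
      have "emeasure S (?E n) \<le> emeasure S (\<Union>i\<in>{1..K}. F i n)"
        using AE F_meas False by (intro emeasure_mono_AE sets.finite_UN) (auto elim!: eventually_mono)
      also have "\<dots> \<le> (\<Sum>i\<in>{1..K}. emeasure S (F i n))"
        using F_meas by (intro emeasure_subadditive_finite) auto
      finally show ?thesis using False by simp
    qed
    then have "(\<Sum>n. emeasure S (?E n)) \<le> (\<Sum>n. (if n < m0 then 1 else 0) + (\<Sum>i\<in>{1..K}. emeasure S (F i n)))"
      by (intro suminf_le) auto
    also have "\<dots> = (\<Sum>n. if n < m0 then 1 else 0) + (\<Sum>n. \<Sum>i\<in>{1..K}. emeasure S (F i n))"
      by (rule suminf_add[symmetric]) auto
    also have "(\<Sum>n. if n < m0 then 1 else 0 :: ennreal) = of_nat m0"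
      by (subst suminf_finite[of "{..<m0}"]) auto
    also have "(\<Sum>n. \<Sum>i\<in>{1..K}. emeasure S (F i n)) = H"
      unfolding H_def by (rule suminf_sum) auto
    also have "of_nat m0 + H \<le> ennreal (?b / c + 1) + ennreal (enn2real H)"
      using m0_le H by (intro add_mono) (simp_all add: ennreal_of_nat_eq_real_of_nat ennreal_leI less_top)
    also have "\<dots> = ennreal (?b / c + (1 + enn2real H))"
      using b0 by (simp add: ennreal_plus[symmetric] add.assoc del: ennreal_plus)
    finally show "ESS (Pj \<nu> f 0) T \<le> ennreal (?b / c + (1 + enn2real H))"
      using ESS_eq_suminf[OF ad space_Pj] by (simp add: Pj_eq)
  qed
qed

end

section \<open>Asymptotics\<close>

text \<open>Covers negative \<open>x\<close>, truncated to 0 by \<open>ennreal\<close>: the lower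
  bounds may be negative while the error levels are not yet small.\<close>

lemma ennreal_plus_le: "0 \<le> c \<Longrightarrow> ennreal (x + c) \<le> ennreal x + ennreal c"
proof (cases "0 \<le> x")
  case False
  assume "0 \<le> c"
  with False have "ennreal (x + c) \<le> ennreal c" by (intro ennreal_leI) simp
  also have "\<dots> \<le> ennreal x + ennreal c" by simp
  finally show ?thesis .
qed (simp add: ennreal_plus)

lemma additive_gap:
  fixes U V :: "nat \<Rightarrow> ennreal" and L b :: "nat \<Rightarrow> real"
  assumes I: "0 < I" and lower: "\<And>n. ennreal (((1 - b n) * L n - 2) / I) \<le> V n"
    and upper: "eventually (\<lambda>n. U n \<le> ennreal (L n / I + c)) sequentially"
    and bL: "eventually (\<lambda>n. b n * L n \<le> c') sequentially"
  shows "\<exists>C::real. eventually (\<lambda>n. U n < \<infinity> \<and> U n \<le> V n + ennreal C) sequentially"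
proof
  \<comment> \<open>The upper bound exceeds the lower one by
    \<open>(b n * L n + 2) / I + c\<close>.\<close>
  define C where "C = max 0 ((c' + 2) / I + c)"
  show "eventually (\<lambda>n. U n < \<infinity> \<and> U n \<le> V n + ennreal C) sequentially"
    using upper bL
  proof eventually_elim
    case (elim n)
    define x where "x = ((1 - b n) * L n - 2) / I"
    have "x = L n / I - (b n * L n + 2) / I"
      using I by (simp add: x_def diff_divide_distrib[symmetric] algebra_simps)
    moreover have "(b n * L n + 2) / I \<le> (c' + 2) / I"
      using elim(2) I by (intro divide_right_mono) auto
    ultimately have "L n / I + c \<le> x + C" by (simp add: C_def max_def)
    then have "U n \<le> ennreal (x + C)" using elim(1) by (meson ennreal_leI order_trans)
    also have "\<dots> \<le> ennreal x + ennreal C" by (rule ennreal_plus_le) (simp add: C_def)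
    also have "\<dots> \<le> V n + ennreal C" using lower[of n] by (intro add_right_mono) (simp add: x_def)
    finally have "U n \<le> V n + ennreal C" .
    moreover have "U n < \<infinity>" using elim(1) by (rule order_le_less_trans) simp
    ultimately show ?case by simp
  qed
qed

text \<open>Half of \<open>\<epsilon>\<close> is used up by the slope of the upper bound; the other
  half of \<open>\<epsilon> * L n\<close> eventually absorbs all constants because \<open>L\<close>
  diverges.\<close>

lemma multiplicative_gap:
  fixes U V :: "nat \<Rightarrow> ennreal" and L b :: "nat \<Rightarrow> real"
  assumes I: "0 < I" and \<epsilon>: "0 < \<epsilon>"
    and lower: "\<And>n. ennreal (((1 - b n) * L n - 2) / I) \<le> V n"
    and upper: "eventually (\<lambda>n. U n \<le> ennreal (L n * (1 + \<epsilon> / 2) / I + c)) sequentially"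
    and bL: "eventually (\<lambda>n. b n * L n \<le> c') sequentially"
    and L: "filterlim L at_top sequentially"
  shows "eventually (\<lambda>n. U n < \<infinity> \<and> U n \<le> ennreal (1 + \<epsilon>) * V n) sequentially"
proof -
  have "eventually (\<lambda>n. 2 / \<epsilon> * (c * I + (1 + \<epsilon>) * (c' + 2)) \<le> L n) sequentially"
    using L by (simp add: filterlim_at_top)
  with upper bL show ?thesis
  proof eventually_elim
    case (elim n)
    define x where "x = ((1 - b n) * L n - 2) / I"
    have "c * I + (1 + \<epsilon>) * (c' + 2) \<le> L n * \<epsilon> / 2"
      using elim(3) \<epsilon> by (simp add: field_simps)
    moreover have "(1 + \<epsilon>) * (b n * L n + 2) \<le> (1 + \<epsilon>) * (c' + 2)"
      using elim(2) \<epsilon> by (intro mult_left_mono) auto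
    ultimately have "L n * (1 + \<epsilon> / 2) + c * I \<le> (1 + \<epsilon>) * ((1 - b n) * L n - 2)"
      by (simp add: algebra_simps)
    then have "(L n * (1 + \<epsilon> / 2) + c * I) / I \<le> (1 + \<epsilon>) * ((1 - b n) * L n - 2) / I"
      using I by (intro divide_right_mono) auto
    then have "L n * (1 + \<epsilon> / 2) / I + c \<le> (1 + \<epsilon>) * x"
      using I by (simp add: x_def add_divide_distrib)
    then have "U n \<le> ennreal ((1 + \<epsilon>) * x)" using elim(1) by (meson ennreal_leI order_trans)
    also have "\<dots> = ennreal (1 + \<epsilon>) * ennreal x" using \<epsilon> by (intro ennreal_mult') simp
    also have "\<dots> \<le> ennreal (1 + \<epsilon>) * V n" using lower[of n] by (intro mult_left_mono) (simp_all add: x_def)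
    finally have "U n \<le> ennreal (1 + \<epsilon>) * V n" .
    moreover have "U n < \<infinity>" using elim(1) by (rule order_le_less_trans) simp
    ultimately show ?case by simp
  qed
qed

lemma self_log_le_one:
  fixes x :: real
  assumes "0 < x" shows "x * ln (1 / x) \<le> 1"
proof -
  have "ln (1 / x) \<le> 1 / x - 1" using assms by (intro ln_le_minus_one) simp
  then have "x * ln (1 / x) \<le> x * (1 / x - 1)" using assms by (intro mult_left_mono) auto
  also have "\<dots> \<le> 1" using assms by (simp add: right_diff_distrib)
  finally show ?thesis .
qed

text \<open>Each product is \<open>x * ln (1 / x) \<le> 1\<close> times a ratio of the two
  logarithms, eventually below \<open>k + 1\<close> in one order and below \<open>2 / k\<close> in
  the other.\<close>

lemma cross_log_bounded:
  fixes \<alpha> \<beta> :: "nat \<Rightarrow> real"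
  assumes range: "\<And>n. 0 < \<alpha> n \<and> \<alpha> n < 1 \<and> 0 < \<beta> n \<and> \<beta> n < 1"
    and k: "0 < k" and lim: "(\<lambda>n. \<bar>ln (\<alpha> n)\<bar> / \<bar>ln (\<beta> n)\<bar>) \<longlonglongrightarrow> k"
  shows "eventually (\<lambda>n. \<beta> n * ln (1 / \<alpha> n) \<le> k + 1) sequentially"
    and "eventually (\<lambda>n. \<alpha> n * ln (1 / \<beta> n) \<le> 2 / k) sequentially"
proof -
  define a where "a n = ln (1 / \<alpha> n)" for n
  define b where "b n = ln (1 / \<beta> n)" for n
  have ab: "0 < a n" "0 < b n" for n
    using range[of n] by (simp_all add: a_def b_def)
  have abs: "\<bar>ln (\<alpha> n)\<bar> = a n" "\<bar>ln (\<beta> n)\<bar> = b n" for n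
    using range[of n] by (simp_all add: a_def b_def ln_div)
  have lim': "(\<lambda>n. a n / b n) \<longlonglongrightarrow> k" using lim by (simp add: abs)
  have up: "eventually (\<lambda>n. a n / b n < k + 1) sequentially"
    using lim' by (rule order_tendstoD) simp
  have lo: "eventually (\<lambda>n. k / 2 < a n / b n) sequentially"
    using lim' by (rule order_tendstoD) (use k in simp)
  show "eventually (\<lambda>n. \<beta> n * ln (1 / \<alpha> n) \<le> k + 1) sequentially"
    using up
  proof eventually_elim
    case (elim n)
    have "\<beta> n * a n \<le> \<beta> n * ((k + 1) * b n)"
      using elim ab[of n] range[of n] by (intro mult_left_mono) (auto simp: pos_divide_less_eq less_imp_le)
    also have "\<dots> = (k + 1) * (\<beta> n * b n)" by (simp only: mult.left_commute)
    also have "\<dots> \<le> (k + 1) * 1"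
      using self_log_le_one[of "\<beta> n"] range[of n] k by (intro mult_left_mono) (auto simp: b_def)
    finally show ?case by (simp add: a_def)
  qed
  show "eventually (\<lambda>n. \<alpha> n * ln (1 / \<beta> n) \<le> 2 / k) sequentially"
    using lo
  proof eventually_elim
    case (elim n)
    have "b n \<le> 2 / k * a n" using elim ab[of n] k by (simp add: field_simps)
    then have "\<alpha> n * b n \<le> \<alpha> n * (2 / k * a n)"
      using range[of n] by (intro mult_left_mono) auto
    also have "\<dots> = 2 / k * (\<alpha> n * a n)" by (simp only: mult.left_commute)
    also have "\<dots> \<le> 2 / k * 1"
      using self_log_le_one[of "\<alpha> n"] range[of n] k by (intro mult_left_mono) (auto simp: a_def)
    finally show ?case by (simp add: b_def)
  qed
qed

section \<open>First passage times and the two concrete tests\<close>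

lemma first_time_eq_enat:
  assumes "first_time P = enat t"
  shows "P t"
proof -
  have ex: "\<exists>t\<ge>1. P t" and t: "t = (LEAST t. 1 \<le> t \<and> P t)"
    using assms by (auto simp: first_time_def split: if_splits)
  from ex obtain s where "1 \<le> s \<and> P s" by blast
  from LeastI[of "\<lambda>t. 1 \<le> t \<and> P t", OF this] t show "P t" by auto
qed

lemma less_first_time:
  assumes "1 \<le> t" "enat t < first_time P"
  shows "\<not> P t"
proof
  assume "P t"
  then have "first_time P = enat (LEAST t. 1 \<le> t \<and> P t)"
    using assms(1) by (auto simp: first_time_def)
  moreover have "(LEAST t. 1 \<le> t \<and> P t) \<le> t"
    using \<open>P t\<close> assms(1) by (intro Least_le) simp
  ultimately show False using assms(2) by simp
qed

context lr_model
begin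

lemma mixLR_ge:
  assumes "i \<in> {1..K}" "\<And>i. i \<in> {1..K} \<Longrightarrow> 0 < q i"
  shows "q i * LR f i t \<omega> \<le> mixLR f K q t \<omega>"
  unfolding mixLR_def
  using assms LR_nonneg by (intro member_le_sum) (auto intro!: mult_nonneg_nonneg simp: less_imp_le)

lemma maxLR_ge: "i \<in> {1..K} \<Longrightarrow> q i * LR f i t \<omega> \<le> maxLR f K q t \<omega>"
  unfolding maxLR_def by (intro Max_ge) auto

lemma maxLR_attained: "\<exists>i\<in>{1..K}. maxLR f K q t \<omega> = q i * LR f i t \<omega>"
proof -
  have "maxLR f K q t \<omega> \<in> (\<lambda>i. q i * LR f i t \<omega>) ` {1..K}"
    unfolding maxLR_def using K_pos by (intro Max_in) auto
  then show ?thesis by blast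
qed

text \<open>The mixture dominates each component, which gives the two upper bounds on components.
  For the last property: \<open>K\<close> components all at most \<open>1 / (A * K)\<close> would
  keep the mixture at or below \<open>1 / A\<close> and stop the test.\<close>

lemma MiLRT_threshold_test:
  assumes "(MiLRT_time f K q0 q1 A B, MiLRT_dec f K q0 q1 A B) \<in> test_class \<nu> f K a b" and A: "0 < A"
  shows "threshold_test (MiLRT_time f K q0 q1 A B) (MiLRT_dec f K q0 q1 A B) A B"
  unfolding threshold_test_def
proof (intro conjI allI impI ballI)
  show "adapted_test (PiM UNIV (\<lambda>_. borel)) (MiLRT_time f K q0 q1 A B) (MiLRT_dec f K q0 q1 A B)"
    using assms by (auto simp: test_class_def intro: is_seq_test_adapted)
next
  fix \<omega> t assume "MiLRT_time f K q0 q1 A B \<omega> = enat t \<and> MiLRT_dec f K q0 q1 A B \<omega>"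
  then show "B \<le> mixLR f K q1 t \<omega>" by (auto simp: MiLRT_dec_def)
next
  fix \<omega> t i assume T: "MiLRT_time f K q0 q1 A B \<omega> = enat t \<and> \<not> MiLRT_dec f K q0 q1 A B \<omega>" and i: "i \<in> {1..K}"
  then have "mixLR f K q0 t \<omega> \<le> 1 / A"
    using first_time_eq_enat[of _ t] unfolding MiLRT_time_def MiLRT_dec_def by fastforce
  then show "q0 i * LR f i t \<omega> \<le> 1 / A" using mixLR_ge[OF i, of q0] q0_pos by (meson order_trans)
next
  fix \<omega> t i assume "1 \<le> t \<and> enat t < MiLRT_time f K q0 q1 A B \<omega>" and i: "i \<in> {1..K}"
  then have "mixLR f K q1 t \<omega> < B" using less_first_time unfolding MiLRT_time_def by fastforce
  then show "q1 i * LR f i t \<omega> < B" using mixLR_ge[OF i, of q1] q1_pos by (meson order_le_less_trans)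
next
  fix \<omega> t assume "1 \<le> t \<and> enat t < MiLRT_time f K q0 q1 A B \<omega>"
  then have gt: "1 / A < mixLR f K q0 t \<omega>" using less_first_time unfolding MiLRT_time_def by fastforce
  show "\<exists>i\<in>{1..K}. 1 / (A * K) < q0 i * LR f i t \<omega>"
  proof (rule ccontr)
    assume "\<not> ?thesis"
    then have "mixLR f K q0 t \<omega> \<le> of_nat (card {1..K}) * (1 / (A * K))"
      unfolding mixLR_def by (intro sum_bounded_above) (auto simp: not_less)
    also have "\<dots> = 1 / A" using K_pos by simp
    finally show False using gt by simp
  qed
qed

text \<open>The largest component is at most the mixture, so reaching \<open>B\<close> carries over;
  it is itself the witness above \<open>1 / A\<close>, and the factor \<open>K\<close> is given away
  to share one form with the mixture.\<close>

lemma WGLRT_threshold_test: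
  assumes "(WGLRT_time f K q0 q1 A B, WGLRT_dec f K q0 q1 A B) \<in> test_class \<nu> f K a b" and A: "0 < A"
  shows "threshold_test (WGLRT_time f K q0 q1 A B) (WGLRT_dec f K q0 q1 A B) A B"
  unfolding threshold_test_def
proof (intro conjI allI impI ballI)
  show "adapted_test (PiM UNIV (\<lambda>_. borel)) (WGLRT_time f K q0 q1 A B) (WGLRT_dec f K q0 q1 A B)"
    using assms by (auto simp: test_class_def intro: is_seq_test_adapted)
next
  fix \<omega> t assume "WGLRT_time f K q0 q1 A B \<omega> = enat t \<and> WGLRT_dec f K q0 q1 A B \<omega>"
  then have "B \<le> maxLR f K q1 t \<omega>" by (auto simp: WGLRT_dec_def)
  moreover obtain i where "i \<in> {1..K}" "maxLR f K q1 t \<omega> = q1 i * LR f i t \<omega>"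
    using maxLR_attained by blast
  ultimately show "B \<le> mixLR f K q1 t \<omega>" using mixLR_ge[of i q1] q1_pos by (metis order_trans)
next
  fix \<omega> t i assume T: "WGLRT_time f K q0 q1 A B \<omega> = enat t \<and> \<not> WGLRT_dec f K q0 q1 A B \<omega>" and i: "i \<in> {1..K}"
  then have "maxLR f K q0 t \<omega> \<le> 1 / A"
    using first_time_eq_enat[of _ t] unfolding WGLRT_time_def WGLRT_dec_def by fastforce
  then show "q0 i * LR f i t \<omega> \<le> 1 / A" using maxLR_ge[OF i, of q0] by (meson order_trans)
next
  fix \<omega> t i assume "1 \<le> t \<and> enat t < WGLRT_time f K q0 q1 A B \<omega>" and i: "i \<in> {1..K}"
  then have "maxLR f K q1 t \<omega> < B" using less_first_time unfolding WGLRT_time_def by fastforce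
  then show "q1 i * LR f i t \<omega> < B" using maxLR_ge[OF i, of q1] by (meson order_le_less_trans)
next
  fix \<omega> t assume "1 \<le> t \<and> enat t < WGLRT_time f K q0 q1 A B \<omega>"
  then have gt: "1 / A < maxLR f K q0 t \<omega>" using less_first_time unfolding WGLRT_time_def by fastforce
  have "A * 1 \<le> A * real K" using A K_pos by (intro mult_left_mono) auto
  then have "1 / (A * K) \<le> 1 / A" using A by (intro divide_left_mono) auto
  with gt maxLR_attained[of q0 t \<omega>] show "\<exists>i\<in>{1..K}. 1 / (A * K) < q0 i * LR f i t \<omega>"
    by (metis order_le_less_trans)
qed

end

section \<open>Asymptotics along a sequence of error levels\<close>

locale test_family = lr_model +
  fixes \<alpha> \<beta> A B :: "nat \<Rightarrow> real" and T :: "nat \<Rightarrow> (nat \<Rightarrow> 'a) \<Rightarrow> enat" and d :: "nat \<Rightarrow> (nat \<Rightarrow> 'a) \<Rightarrow> bool"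
  assumes ab_range: "\<And>n. 0 < \<alpha> n \<and> \<alpha> n < 1 \<and> 0 < \<beta> n \<and> \<beta> n < 1"
    and beta_lim: "\<beta> \<longlonglongrightarrow> 0"
    and A2: "\<exists>k>0. (\<lambda>n. \<bar>ln (\<alpha> n)\<bar> / \<bar>ln (\<beta> n)\<bar>) \<longlonglongrightarrow> k"
    and AB_pos: "\<And>n. 0 < A n" "\<And>n. 0 < B n"
    and in_class: "\<And>n. (T n, d n) \<in> test_class \<nu> f K (\<alpha> n) (\<beta> n)"
    and tt: "\<And>n. threshold_test (T n) (d n) (A n) (B n)"
    and A3: "\<exists>k0\<in>{0<..1}. \<exists>k1\<in>{0<..1}. \<forall>\<epsilon>>0. eventually (\<lambda>n.
        k0 * \<alpha> n * (1 - \<epsilon>) \<le> prob_accept1 (Pj \<nu> f 0) (T n) (d n)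
      \<and> prob_accept1 (Pj \<nu> f 0) (T n) (d n) \<le> \<alpha> n * (1 + \<epsilon>)
      \<and> k1 * \<beta> n * (1 - \<epsilon>) \<le> Max ((\<lambda>i. prob_accept0 (Pj \<nu> f i) (T n) (d n)) ` {1..K})
      \<and> Max ((\<lambda>i. prob_accept0 (Pj \<nu> f i) (T n) (d n)) ` {1..K}) \<le> \<beta> n * (1 + \<epsilon>))
      sequentially"
begin

abbreviation "La n \<equiv> ln (1 / \<alpha> n)"
abbreviation "Lb n \<equiv> ln (1 / \<beta> n)"

lemma La_pos: "0 < La n" and Lb_pos: "0 < Lb n"
  using ab_range[of n] by simp_all

lemma error_lower_bounds:
  "\<exists>k0>0. eventually (\<lambda>n. k0 * \<alpha> n \<le> prob_accept1 (Pj \<nu> f 0) (T n) (d n)) sequentially"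
  "\<exists>k1>0. eventually (\<lambda>n. k1 * \<beta> n \<le> Max ((\<lambda>i. prob_accept0 (Pj \<nu> f i) (T n) (d n)) ` {1..K})) sequentially"
proof -
  obtain k0 k1 where k: "k0 \<in> {0<..1}" "k1 \<in> {0<..1}" and ev: "\<forall>\<epsilon>>0. eventually (\<lambda>n.
        k0 * \<alpha> n * (1 - \<epsilon>) \<le> prob_accept1 (Pj \<nu> f 0) (T n) (d n)
      \<and> prob_accept1 (Pj \<nu> f 0) (T n) (d n) \<le> \<alpha> n * (1 + \<epsilon>)
      \<and> k1 * \<beta> n * (1 - \<epsilon>) \<le> Max ((\<lambda>i. prob_accept0 (Pj \<nu> f i) (T n) (d n)) ` {1..K})
      \<and> Max ((\<lambda>i. prob_accept0 (Pj \<nu> f i) (T n) (d n)) ` {1..K}) \<le> \<beta> n * (1 + \<epsilon>))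
      sequentially"
    using A3 by blast
  \<comment> \<open>Any fixed \<open>\<epsilon> < 1\<close> keeps a positive multiple of the error
    levels; \<open>1 / 2\<close> halves the constants.\<close>
  from ev[rule_format, of "1 / 2"]
  have "eventually (\<lambda>n. k0 / 2 * \<alpha> n \<le> prob_accept1 (Pj \<nu> f 0) (T n) (d n)) sequentially"
    "eventually (\<lambda>n. k1 / 2 * \<beta> n \<le> Max ((\<lambda>i. prob_accept0 (Pj \<nu> f i) (T n) (d n)) ` {1..K})) sequentially"
    by (auto elim!: eventually_mono)
  then show "\<exists>k0>0. eventually (\<lambda>n. k0 * \<alpha> n \<le> prob_accept1 (Pj \<nu> f 0) (T n) (d n)) sequentially"
    "\<exists>k1>0. eventually (\<lambda>n. k1 * \<beta> n \<le> Max ((\<lambda>i. prob_accept0 (Pj \<nu> f i) (T n) (d n)) ` {1..K})) sequentially"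
    using k by (intro exI[of _ "k0 / 2"] exI[of _ "k1 / 2"], simp)+
qed

text \<open>A threshold that is too high would push the error below what (A3) guarantees:
  \<open>k0 * \<alpha> n \<le> s / B n\<close>. The maximum with 1 is absorbed since
  \<open>La n\<close> is positive.\<close>

lemma log_B_le:
  assumes q: "0 < q"
  shows "\<exists>c. eventually (\<lambda>n. max 1 (ln (B n / q)) \<le> La n + c) sequentially"
proof -
  obtain k0 where k: "0 < k0"
    and ev: "eventually (\<lambda>n. k0 * \<alpha> n \<le> prob_accept1 (Pj \<nu> f 0) (T n) (d n)) sequentially"
    using error_lower_bounds(1) by blast
  define s where "s = (\<Sum>i=1..K. q1 i)"
  have s: "0 < s" unfolding s_def using q1_pos K_pos by (intro sum_pos) auto
  let ?c = "s / (k0 * q)"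
  have "eventually (\<lambda>n. max 1 (ln (B n / q)) \<le> La n + max 1 (ln ?c)) sequentially"
    using ev
  proof eventually_elim
    case (elim n)
    have "k0 * \<alpha> n \<le> s / B n"
      using elim error_1_le[OF tt AB_pos(2), of n] by (simp add: s_def)
    then have "B n / q \<le> ?c * (1 / \<alpha> n)"
      using AB_pos(2)[of n] ab_range[of n] k q by (simp add: field_simps)
    then have "ln (B n / q) \<le> ln (?c * (1 / \<alpha> n))"
      using AB_pos(2)[of n] q by (intro ln_mono) auto
    also have "\<dots> = ln ?c + La n"
      using s k q ab_range[of n] by (intro ln_mult_pos) auto
    finally show ?case using La_pos[of n] by auto
  qed
  then show ?thesis by blast
qed

lemma log_A_le: "\<exists>c. eventually (\<lambda>n. max 1 (ln (A n * \<kappa>)) \<le> Lb n + c) sequentially"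
proof -
  obtain k1 where k: "0 < k1"
    and ev: "eventually (\<lambda>n. k1 * \<beta> n \<le> Max ((\<lambda>i. prob_accept0 (Pj \<nu> f i) (T n) (d n)) ` {1..K})) sequentially"
    using error_lower_bounds(2) by blast
  \<comment> \<open>(A3) bounds only the largest error from below, attained at an unknown component;
    \<open>s\<close> majorizes every \<open>1 / q0 i\<close>.\<close>
  define s where "s = (\<Sum>i=1..K. 1 / q0 i)"
  have s: "0 < s" unfolding s_def using q0_pos K_pos by (intro sum_pos) auto
  let ?c = "s * \<kappa> / k1"
  have "eventually (\<lambda>n. max 1 (ln (A n * \<kappa>)) \<le> Lb n + max 1 (ln ?c)) sequentially"
    using ev
  proof eventually_elim
    case (elim n)
    have "Max ((\<lambda>i. prob_accept0 (Pj \<nu> f i) (T n) (d n)) ` {1..K}) \<le> s / A n"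
    proof (rule Max.boundedI)
      fix p assume "p \<in> (\<lambda>i. prob_accept0 (Pj \<nu> f i) (T n) (d n)) ` {1..K}"
      then obtain i where i: "i \<in> {1..K}" and p: "p = prob_accept0 (Pj \<nu> f i) (T n) (d n)" by blast
      have "p \<le> 1 / q0 i / A n"
        unfolding p using error_0_le[OF tt AB_pos(1) i, of n] by (simp add: mult.commute)
      also have "1 / q0 i \<le> s"
        unfolding s_def using i q0_pos by (intro member_le_sum) (auto simp: less_imp_le)
      finally show "p \<le> s / A n" using AB_pos(1)[of n] by (simp add: divide_right_mono)
    qed (use K_pos in auto)
    with elim have "k1 * \<beta> n \<le> s / A n" by linarith
    then have "A n \<le> s / k1 * (1 / \<beta> n)"
      using AB_pos(1)[of n] ab_range[of n] k by (simp add: field_simps)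
    then have "A n * \<kappa> \<le> s / k1 * (1 / \<beta> n) * \<kappa>"
      using \<kappa>_pos by (intro mult_right_mono) auto
    then have "A n * \<kappa> \<le> ?c * (1 / \<beta> n)" by (simp add: mult_ac)
    then have "ln (A n * \<kappa>) \<le> ln (?c * (1 / \<beta> n))"
      using AB_pos(1)[of n] \<kappa>_pos by (intro ln_mono) auto
    also have "\<dots> = ln ?c + Lb n"
      using s k \<kappa>_pos ab_range[of n] by (intro ln_mult_pos) auto
    finally show ?case using Lb_pos[of n] by auto
  qed
  then show ?thesis by blast
qed

lemma ESS_alternative:
  assumes i: "i \<in> {1..K}"
  shows "\<exists>C::real. eventually (\<lambda>n. ESS (Pj \<nu> f i) (T n) < \<infinity> \<and> ESS (Pj \<nu> f i) (T n)
    \<le> (INF \<delta>\<in>test_class \<nu> f K (\<alpha> n) (\<beta> n). ESS (Pj \<nu> f i) (fst \<delta>)) + ennreal C) sequentially"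
proof -
  obtain k where k: "0 < k" "(\<lambda>n. \<bar>ln (\<alpha> n)\<bar> / \<bar>ln (\<beta> n)\<bar>) \<longlonglongrightarrow> k" using A2 by blast
  obtain C where C: "\<And>n. ESS (Pj \<nu> f i) (T n) \<le> ennreal (max 1 (ln (B n / q1 i)) / I1 i + C)"
    using ESS_upper_1[OF i] tt AB_pos by blast
  obtain c where c: "eventually (\<lambda>n. max 1 (ln (B n / q1 i)) \<le> La n + c) sequentially"
    using log_B_le[OF q1_pos[OF i]] by blast
  show ?thesis
  proof (rule additive_gap[OF I1_pos[OF i]])
    show "ennreal (((1 - \<beta> n) * La n - 2) / I1 i)
        \<le> (INF \<delta>\<in>test_class \<nu> f K (\<alpha> n) (\<beta> n). ESS (Pj \<nu> f i) (fst \<delta>))" for n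
      using ab_range[of n] by (intro lower_bound_1 i) auto
    show "eventually (\<lambda>n. ESS (Pj \<nu> f i) (T n) \<le> ennreal (La n / I1 i + (c / I1 i + C))) sequentially"
      using c
    proof eventually_elim
      case (elim n)
      then have "max 1 (ln (B n / q1 i)) / I1 i \<le> (La n + c) / I1 i"
        using I1_pos[OF i] by (intro divide_right_mono) auto
      then have "ennreal (max 1 (ln (B n / q1 i)) / I1 i + C) \<le> ennreal (La n / I1 i + (c / I1 i + C))"
        by (intro ennreal_leI) (simp add: add_divide_distrib)
      then show ?case using C[of n] by (rule order_trans[rotated])
    qed
    show "eventually (\<lambda>n. \<beta> n * La n \<le> k + 1) sequentially"
      by (rule cross_log_bounded(1)[OF ab_range k])
  qed
qed

lemma ESS_null_unique:
  assumes gap: "\<And>i. i \<in> {2..K} \<Longrightarrow> I0 1 < I0 i"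
  shows "\<exists>C::real. eventually (\<lambda>n. ESS (Pj \<nu> f 0) (T n) < \<infinity> \<and> ESS (Pj \<nu> f 0) (T n)
    \<le> (INF \<delta>\<in>test_class \<nu> f K (\<alpha> n) (\<beta> n). ESS (Pj \<nu> f 0) (fst \<delta>)) + ennreal C) sequentially"
proof -
  have one: "1 \<in> {1..K}" using K_pos by simp
  obtain k where k: "0 < k" "(\<lambda>n. \<bar>ln (\<alpha> n)\<bar> / \<bar>ln (\<beta> n)\<bar>) \<longlonglongrightarrow> k" using A2 by blast
  obtain C where C: "\<And>n. ESS (Pj \<nu> f 0) (T n) \<le> ennreal (max 1 (ln (A n * \<kappa>)) / I0 1 + C)"
    using ESS_upper_0_unique[OF gap] tt AB_pos by blast
  obtain c where c: "eventually (\<lambda>n. max 1 (ln (A n * \<kappa>)) \<le> Lb n + c) sequentially"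
    using log_A_le by blast
  show ?thesis
  proof (rule additive_gap[OF I0_pos[OF one]])
    show "ennreal (((1 - \<alpha> n) * Lb n - 2) / I0 1)
        \<le> (INF \<delta>\<in>test_class \<nu> f K (\<alpha> n) (\<beta> n). ESS (Pj \<nu> f 0) (fst \<delta>))" for n
      using ab_range[of n] by (intro lower_bound_0 one) auto
    show "eventually (\<lambda>n. ESS (Pj \<nu> f 0) (T n) \<le> ennreal (Lb n / I0 1 + (c / I0 1 + C))) sequentially"
      using c
    proof eventually_elim
      case (elim n)
      then have "max 1 (ln (A n * \<kappa>)) / I0 1 \<le> (Lb n + c) / I0 1"
        using I0_pos[OF one] by (intro divide_right_mono) auto
      then have "ennreal (max 1 (ln (A n * \<kappa>)) / I0 1 + C) \<le> ennreal (Lb n / I0 1 + (c / I0 1 + C))"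
        by (intro ennreal_leI) (simp add: add_divide_distrib)
      then show ?case using C[of n] by (rule order_trans[rotated])
    qed
    show "eventually (\<lambda>n. \<alpha> n * Lb n \<le> 2 / k) sequentially"
      by (rule cross_log_bounded(2)[OF ab_range k])
  qed
qed

lemma ESS_null:
  assumes min: "\<And>i. i \<in> {1..K} \<Longrightarrow> I0 1 \<le> I0 i" and \<epsilon>: "0 < \<epsilon>"
  shows "eventually (\<lambda>n. ESS (Pj \<nu> f 0) (T n) < \<infinity> \<and>
    ennreal (1 - \<epsilon>) * (INF \<delta>\<in>test_class \<nu> f K (\<alpha> n) (\<beta> n). ESS (Pj \<nu> f 0) (fst \<delta>)) \<le> ESS (Pj \<nu> f 0) (T n) \<and>
    ESS (Pj \<nu> f 0) (T n)
      \<le> ennreal (1 + \<epsilon>) * (INF \<delta>\<in>test_class \<nu> f K (\<alpha> n) (\<beta> n). ESS (Pj \<nu> f 0) (fst \<delta>))) sequentially"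
proof -
  let ?V = "\<lambda>n. INF \<delta>\<in>test_class \<nu> f K (\<alpha> n) (\<beta> n). ESS (Pj \<nu> f 0) (fst \<delta>)"
  have one: "1 \<in> {1..K}" using K_pos by simp
  note I = I0_pos[OF one]
  obtain k where k: "0 < k" "(\<lambda>n. \<bar>ln (\<alpha> n)\<bar> / \<bar>ln (\<beta> n)\<bar>) \<longlonglongrightarrow> k" using A2 by blast
  \<comment> \<open>Chosen so that the flatter line costs exactly the factor
    \<open>1 + \<epsilon> / 2\<close>, leaving the rest of \<open>\<epsilon>\<close> for the
    constants.\<close>
  define \<eta> where "\<eta> = \<epsilon> / (2 + \<epsilon>)"
  have \<eta>: "0 < \<eta>" "\<eta> < 1" "1 / (1 - \<eta>) = 1 + \<epsilon> / 2"
    using \<epsilon> by (auto simp: \<eta>_def field_simps)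
  obtain C where C: "\<And>n. ESS (Pj \<nu> f 0) (T n) \<le> ennreal (max 1 (ln (A n * \<kappa>)) / ((1 - \<eta>) * I0 1) + C)"
    using ESS_upper_0[OF I min \<eta>(1,2)] tt AB_pos by blast
  obtain c where c: "eventually (\<lambda>n. max 1 (ln (A n * \<kappa>)) \<le> Lb n + c) sequentially"
    using log_A_le by blast
  have "eventually (\<lambda>n. ESS (Pj \<nu> f 0) (T n) < \<infinity> \<and> ESS (Pj \<nu> f 0) (T n) \<le> ennreal (1 + \<epsilon>) * ?V n) sequentially"
  proof (rule multiplicative_gap[OF I \<epsilon>])
    show "ennreal (((1 - \<alpha> n) * Lb n - 2) / I0 1) \<le> ?V n" for n
      using ab_range[of n] by (intro lower_bound_0 one) auto
    show "eventually (\<lambda>n. ESS (Pj \<nu> f 0) (T n)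
        \<le> ennreal (Lb n * (1 + \<epsilon> / 2) / I0 1 + (c * (1 + \<epsilon> / 2) / I0 1 + C))) sequentially"
      using c
    proof eventually_elim
      case (elim n)
      have "max 1 (ln (A n * \<kappa>)) / ((1 - \<eta>) * I0 1) = max 1 (ln (A n * \<kappa>)) * (1 / (1 - \<eta>)) / I0 1"
        by simp
      also have "\<dots> \<le> (Lb n + c) * (1 + \<epsilon> / 2) / I0 1"
        unfolding \<eta>(3) using elim I \<epsilon> by (intro divide_right_mono mult_right_mono) auto
      finally have "ennreal (max 1 (ln (A n * \<kappa>)) / ((1 - \<eta>) * I0 1) + C)
          \<le> ennreal (Lb n * (1 + \<epsilon> / 2) / I0 1 + (c * (1 + \<epsilon> / 2) / I0 1 + C))"
        by (intro ennreal_leI) (simp add: add_divide_distrib distrib_right)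
      then show ?case using C[of n] by (rule order_trans[rotated])
    qed
    show "eventually (\<lambda>n. \<alpha> n * Lb n \<le> 2 / k) sequentially"
      by (rule cross_log_bounded(2)[OF ab_range k])
    have "filterlim (\<lambda>n. inverse (\<beta> n)) at_top sequentially"
      using beta_lim ab_range by (intro filterlim_inverse_at_top) auto
    then show "filterlim Lb at_top sequentially"
      by (intro filterlim_compose[OF ln_at_top]) (simp add: inverse_eq_divide)
  qed
  then show ?thesis
  proof eventually_elim
    case (elim n)
    \<comment> \<open>The lower estimate is mere membership in the class; for
      \<open>\<epsilon> > 1\<close> the factor \<open>ennreal (1 - \<epsilon>)\<close> is 0.\<close>
    have "ennreal (1 - \<epsilon>) * ?V n \<le> 1 * ?V n"
      using \<epsilon> by (intro mult_right_mono) (auto simp: ennreal_le_1)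
    also have "?V n \<le> ESS (Pj \<nu> f 0) (T n)" using INF_lower[OF in_class[of n], of "\<lambda>\<delta>. ESS (Pj \<nu> f 0) (fst \<delta>)"] by simp
    finally show ?case using elim by simp
  qed
qed

end

theorem theorem3:
  fixes \<nu> :: "'a::euclidean_space measure"
    and f :: "nat \<Rightarrow> 'a \<Rightarrow> real"
    and K r :: nat
    and q0 q1 :: "nat \<Rightarrow> real"
    and \<alpha> \<beta> :: "nat \<Rightarrow> real"
    and AM BM AN BN :: "nat \<Rightarrow> real"
  assumes sets_nu: "sets \<nu> = sets borel"
    and sf_nu: "sigma_finite_measure \<nu>"
    and nondeg_nu: "emeasure \<nu> (space \<nu>) > 0"
    and K_pos: "K \<ge> 1"
    and f_meas: "\<And>j. j \<le> K \<Longrightarrow> f j \<in> borel_measurable borel"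
    and f_nonneg: "\<And>j x. j \<le> K \<Longrightarrow> f j x \<ge> 0"
    and f_dens: "\<And>j. j \<le> K \<Longrightarrow> (\<integral>\<^sup>+ x. ennreal (f j x) \<partial>\<nu>) = 1"
    and f_support: "\<And>j. j \<le> K \<Longrightarrow> {x. f j x > 0} = {x. f 0 x > 0}"
    and f_distinct: "\<And>i. i \<in> {1..K} \<Longrightarrow> emeasure \<nu> {x. f i x \<noteq> f 0 x} > 0"
    and nonarith0: "\<And>i. i \<in> {1..K} \<Longrightarrow> non_arithmetic (P1 \<nu> f 0) (llr f i)"
    and nonarith1: "\<And>i. i \<in> {1..K} \<Longrightarrow> non_arithmetic (P1 \<nu> f i) (llr f i)"
    and I_fin: "\<And>i. i \<in> {1..K} \<Longrightarrow> integrable (P1 \<nu> f i) (llr f i)"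
    and I0_fin: "\<And>i. i \<in> {1..K} \<Longrightarrow> integrable (P1 \<nu> f 0) (llr f i)"
    and r_range: "1 \<le> r" "r \<le> K"
    and order_min: "\<And>i. i \<in> {1..r} \<Longrightarrow>
        (\<integral>x. - llr f i x \<partial>P1 \<nu> f 0) = (\<integral>x. - llr f 1 x \<partial>P1 \<nu> f 0)"
    and order_gap: "\<And>i. i \<in> {r+1..K} \<Longrightarrow>
        (\<integral>x. - llr f 1 x \<partial>P1 \<nu> f 0) < (\<integral>x. - llr f i x \<partial>P1 \<nu> f 0)"
    and order_sorted: "\<And>i j. i \<in> {r+1..K} \<Longrightarrow> j \<in> {r+1..K} \<Longrightarrow> i \<le> j \<Longrightarrow>
        (\<integral>x. - llr f i x \<partial>P1 \<nu> f 0) \<le> (\<integral>x. - llr f j x \<partial>P1 \<nu> f 0)"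
    and q0_pos: "\<And>i. i \<in> {1..K} \<Longrightarrow> q0 i > 0"
    and q1_pos: "\<And>i. i \<in> {1..K} \<Longrightarrow> q1 i > 0"
    \<comment> \<open>(A1)\<close>
    and A1_i: "\<And>i. i \<in> {1..K} \<Longrightarrow> integrable (P1 \<nu> f i) (\<lambda>x. (llr f i x)\<^sup>2)"
    and A1_0: "\<And>i. i \<in> {1..K} \<Longrightarrow> integrable (P1 \<nu> f 0) (\<lambda>x. (llr f i x)\<^sup>2)"
    \<comment> \<open>(A2): alpha, beta -> 0 along sequences with |log alpha| / |log beta| -> k\<close>
    and ab_range: "\<And>n. 0 < \<alpha> n \<and> \<alpha> n < 1 \<and> 0 < \<beta> n \<and> \<beta> n < 1"
    and alpha_lim: "\<alpha> \<longlonglongrightarrow> 0"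
    and beta_lim: "\<beta> \<longlonglongrightarrow> 0"
    and A2: "\<exists>k>0. (\<lambda>n. \<bar>ln (\<alpha> n)\<bar> / \<bar>ln (\<beta> n)\<bar>) \<longlonglongrightarrow> k"
    \<comment> \<open>thresholds\<close>
    and thr: "\<And>n. AM n > 1 \<and> BM n > 1 \<and> AN n > 1 \<and> BN n > 1"
    \<comment> \<open>both tests in C(alpha, beta)\<close>
    and M_in: "\<And>n. (MiLRT_time f K q0 q1 (AM n) (BM n), MiLRT_dec f K q0 q1 (AM n) (BM n))
                  \<in> test_class \<nu> f K (\<alpha> n) (\<beta> n)"
    and N_in: "\<And>n. (WGLRT_time f K q0 q1 (AN n) (BN n), WGLRT_dec f K q0 q1 (AN n) (BN n))
                  \<in> test_class \<nu> f K (\<alpha> n) (\<beta> n)"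
    \<comment> \<open>(A3) for the MiLRT\<close>
    and A3_M: "\<exists>k0\<in>{0<..1}. \<exists>k1\<in>{0<..1}. \<forall>\<epsilon>>0. eventually (\<lambda>n.
        k0 * \<alpha> n * (1 - \<epsilon>) \<le> prob_accept1 (Pj \<nu> f 0) (MiLRT_time f K q0 q1 (AM n) (BM n)) (MiLRT_dec f K q0 q1 (AM n) (BM n))
      \<and> prob_accept1 (Pj \<nu> f 0) (MiLRT_time f K q0 q1 (AM n) (BM n)) (MiLRT_dec f K q0 q1 (AM n) (BM n)) \<le> \<alpha> n * (1 + \<epsilon>)
      \<and> k1 * \<beta> n * (1 - \<epsilon>) \<le> Max ((\<lambda>i. prob_accept0 (Pj \<nu> f i) (MiLRT_time f K q0 q1 (AM n) (BM n)) (MiLRT_dec f K q0 q1 (AM n) (BM n))) ` {1..K})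
      \<and> Max ((\<lambda>i. prob_accept0 (Pj \<nu> f i) (MiLRT_time f K q0 q1 (AM n) (BM n)) (MiLRT_dec f K q0 q1 (AM n) (BM n))) ` {1..K}) \<le> \<beta> n * (1 + \<epsilon>))
      sequentially"
    \<comment> \<open>(A3) for the WGLRT\<close>
    and A3_N: "\<exists>k0\<in>{0<..1}. \<exists>k1\<in>{0<..1}. \<forall>\<epsilon>>0. eventually (\<lambda>n.
        k0 * \<alpha> n * (1 - \<epsilon>) \<le> prob_accept1 (Pj \<nu> f 0) (WGLRT_time f K q0 q1 (AN n) (BN n)) (WGLRT_dec f K q0 q1 (AN n) (BN n))
      \<and> prob_accept1 (Pj \<nu> f 0) (WGLRT_time f K q0 q1 (AN n) (BN n)) (WGLRT_dec f K q0 q1 (AN n) (BN n)) \<le> \<alpha> n * (1 + \<epsilon>)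
      \<and> k1 * \<beta> n * (1 - \<epsilon>) \<le> Max ((\<lambda>i. prob_accept0 (Pj \<nu> f i) (WGLRT_time f K q0 q1 (AN n) (BN n)) (WGLRT_dec f K q0 q1 (AN n) (BN n))) ` {1..K})
      \<and> Max ((\<lambda>i. prob_accept0 (Pj \<nu> f i) (WGLRT_time f K q0 q1 (AN n) (BN n)) (WGLRT_dec f K q0 q1 (AN n) (BN n))) ` {1..K}) \<le> \<beta> n * (1 + \<epsilon>))
      sequentially"
  shows
    \<comment> \<open>(a)\<close>
    "(\<forall>i\<in>{1..K}.
       (\<exists>C::real. eventually (\<lambda>n.
          ESS (Pj \<nu> f i) (MiLRT_time f K q0 q1 (AM n) (BM n)) < \<infinity> \<and>
          ESS (Pj \<nu> f i) (MiLRT_time f K q0 q1 (AM n) (BM n))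
            \<le> (INF \<delta>\<in>test_class \<nu> f K (\<alpha> n) (\<beta> n). ESS (Pj \<nu> f i) (fst \<delta>)) + ennreal C) sequentially) \<and>
       (\<exists>C::real. eventually (\<lambda>n.
          ESS (Pj \<nu> f i) (WGLRT_time f K q0 q1 (AN n) (BN n)) < \<infinity> \<and>
          ESS (Pj \<nu> f i) (WGLRT_time f K q0 q1 (AN n) (BN n))
            \<le> (INF \<delta>\<in>test_class \<nu> f K (\<alpha> n) (\<beta> n). ESS (Pj \<nu> f i) (fst \<delta>)) + ennreal C) sequentially))
     \<and>
     \<comment> \<open>(b), r = 1\<close>
     (r = 1 \<longrightarrow>
       (\<exists>C::real. eventually (\<lambda>n.
          ESS (Pj \<nu> f 0) (MiLRT_time f K q0 q1 (AM n) (BM n)) < \<infinity> \<and>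
          ESS (Pj \<nu> f 0) (MiLRT_time f K q0 q1 (AM n) (BM n))
            \<le> (INF \<delta>\<in>test_class \<nu> f K (\<alpha> n) (\<beta> n). ESS (Pj \<nu> f 0) (fst \<delta>)) + ennreal C) sequentially) \<and>
       (\<exists>C::real. eventually (\<lambda>n.
          ESS (Pj \<nu> f 0) (WGLRT_time f K q0 q1 (AN n) (BN n)) < \<infinity> \<and>
          ESS (Pj \<nu> f 0) (WGLRT_time f K q0 q1 (AN n) (BN n))
            \<le> (INF \<delta>\<in>test_class \<nu> f K (\<alpha> n) (\<beta> n). ESS (Pj \<nu> f 0) (fst \<delta>)) + ennreal C) sequentially))
     \<and>
     \<comment> \<open>(b), r > 1\<close>
     (r > 1 \<longrightarrow>
       (\<forall>\<epsilon>>0. eventually (\<lambda>n.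
          ESS (Pj \<nu> f 0) (MiLRT_time f K q0 q1 (AM n) (BM n)) < \<infinity> \<and>
          ennreal (1 - \<epsilon>) * (INF \<delta>\<in>test_class \<nu> f K (\<alpha> n) (\<beta> n). ESS (Pj \<nu> f 0) (fst \<delta>))
            \<le> ESS (Pj \<nu> f 0) (MiLRT_time f K q0 q1 (AM n) (BM n)) \<and>
          ESS (Pj \<nu> f 0) (MiLRT_time f K q0 q1 (AM n) (BM n))
            \<le> ennreal (1 + \<epsilon>) * (INF \<delta>\<in>test_class \<nu> f K (\<alpha> n) (\<beta> n). ESS (Pj \<nu> f 0) (fst \<delta>))) sequentially) \<and>
       (\<forall>\<epsilon>>0. eventually (\<lambda>n.
          ESS (Pj \<nu> f 0) (WGLRT_time f K q0 q1 (AN n) (BN n)) < \<infinity> \<and>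
          ennreal (1 - \<epsilon>) * (INF \<delta>\<in>test_class \<nu> f K (\<alpha> n) (\<beta> n). ESS (Pj \<nu> f 0) (fst \<delta>))
            \<le> ESS (Pj \<nu> f 0) (WGLRT_time f K q0 q1 (AN n) (BN n)) \<and>
          ESS (Pj \<nu> f 0) (WGLRT_time f K q0 q1 (AN n) (BN n))
            \<le> ennreal (1 + \<epsilon>) * (INF \<delta>\<in>test_class \<nu> f K (\<alpha> n) (\<beta> n). ESS (Pj \<nu> f 0) (fst \<delta>))) sequentially))"
proof -
  interpret lr_model \<nu> f K q0 q1
    by (unfold_locales; fact assms)
  \<comment> \<open>Each test with its own thresholds instantiates the same locale, so every
    estimate is available for both.\<close>
  interpret M: test_family \<nu> f K q0 q1 \<alpha> \<beta> AM BM
    "\<lambda>n. MiLRT_time f K q0 q1 (AM n) (BM n)" "\<lambda>n. MiLRT_dec f K q0 q1 (AM n) (BM n)"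
  proof unfold_locales
    show "0 < AM n" "0 < BM n" for n using thr[of n] by auto
    then show "threshold_test (MiLRT_time f K q0 q1 (AM n) (BM n)) (MiLRT_dec f K q0 q1 (AM n) (BM n)) (AM n) (BM n)" for n
      by (intro MiLRT_threshold_test[OF M_in]) blast
  qed (fact ab_range beta_lim A2 M_in A3_M)+
  interpret N: test_family \<nu> f K q0 q1 \<alpha> \<beta> AN BN
    "\<lambda>n. WGLRT_time f K q0 q1 (AN n) (BN n)" "\<lambda>n. WGLRT_dec f K q0 q1 (AN n) (BN n)"
  proof unfold_locales
    show "0 < AN n" "0 < BN n" for n using thr[of n] by auto
    then show "threshold_test (WGLRT_time f K q0 q1 (AN n) (BN n)) (WGLRT_dec f K q0 q1 (AN n) (BN n)) (AN n) (BN n)" for n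
      by (intro WGLRT_threshold_test[OF N_in]) blast
  qed (fact ab_range beta_lim A2 N_in A3_N)+
  have gap: "I0 1 < I0 i" if "r = 1" "i \<in> {2..K}" for i
    using order_gap[of i] that unfolding I0_def by simp
  have min: "I0 1 \<le> I0 i" if "i \<in> {1..K}" for i
  proof (cases "i \<le> r")
    case True
    then show ?thesis using order_min[of i] that unfolding I0_def by simp
  next
    case False
    then show ?thesis using order_gap[of i] that unfolding I0_def by simp
  qed
  show ?thesis
    using M.ESS_alternative N.ESS_alternative M.ESS_null_unique[OF gap] N.ESS_null_unique[OF gap]
      M.ESS_null[OF min] N.ESS_null[OF min] by blast
qed

end
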